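(* Let $\epsilon\ge0$ and $h_b\in[0,1/2]$. (i) For every $\mathrm U\in[0,\infty)$ and $t\in\mathbb R$: $e^{it\mathcal A_{\mathrm U}}\mathfrak P_{\mathrm U}=\mathfrak P_{\mathrm U}e^{itM_{\mathrm E(\mathrm U,\cdot)}}$. (ii) $\text{s-}\lim_{\mathrm U\to\infty}\mathfrak P_{\mathrm U}=\mathfrak P_\infty$, and for every $t\in\mathbb R$, $\text{s-}\lim_{\mathrm U\to\infty}e^{it\mathcal A_{\mathrm U}}\mathfrak P_{\mathrm U}=\mathfrak P_\infty e^{itM_{\mathrm E(\infty,\cdot)}}$.
   Context: Notation: $\mathbb T^2=[-\pi,\pi)^2$ with normalized Haar measure $\nu$; $L^2(\mathbb T^2)=L^2(\mathbb T^2,\nu)$; $L^2(\mathbb T^2,\mathcal H)$ the square-integrable $\mathcal H$-valued functions. For $f\in\ell^1(\mathbb Z^2)$, $\hat f(k)=\sum_{x}e^{ik\cdot x}f(x)$, $k\in\mathbb R^2$. $\hat{\mathfrak e}_x(p)=e^{ip\cdot x}$; $P_x$ the orthogonal projection onto $\mathbb C\hat{\mathfrak e}_x$; $M_g$ multiplication by $g$; $\cos(q):=\cos q_1+\cos q_2$. Data: $\epsilon,h_b\ge0$; $\mathrm u:\mathbb Z^2\to[0,\infty)$, $\upsilon,\mathfrak p_1,\mathfrak p_2:\mathbb Z^2\to\mathbb R$, all invariant under $90^\circ$-rotations, $\mathrm u,\upsilon$ absolutely summable, $\sum_z e^{\alpha_0|z|}|\mathfrak p_j(z)|<\infty$ for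 some $\alpha_0>0$, $\mathfrak p_2(z)=0$ for $z\notin(2\mathbb Z)^2$, $\mathfrak p_1+\mathfrak p_2\neq0$, and for every $k$ some $x$ with $\mathfrak p_2(x)\neq-e^{ik\cdot x/2}\mathfrak p_1(x)$. For $k,p\in\mathbb T^2$: $\mathfrak b(k)=h_b\epsilon(2-\cos k)$, $\mathfrak f(k)(p)=\epsilon(4-\cos(p+k)-\cos p)$, $\mathfrak d(k)(p)=\hat{\mathfrak p}_1(k+p)+\hat{\mathfrak p}_2(k/2+p)$. For $\mathrm U\ge0$: $A_{1,1}(\mathrm U,k)=M_{\mathfrak f(k)}+\sum_x\mathrm u(x)P_x+\mathrm UP_0$; on $\mathcal H=L^2(\mathbb T^2)\oplus\mathbb C$, $A(\mathrm U,k)(\varphi,z)=\big(A_{1,1}(\mathrm U,k)\varphi+\hat\upsilon(k)z\,\mathfrak d(k),\ \hat\upsilon(k)\langle\mathfrak d(k),\varphi\rangle+\mathfrak b(k)z\big)$; $\mathcal A_{\mathrm U}:=\int^\oplus A(\mathrm U,k)\nu(dk)$ on $L^2(\mathbb T^2,\mathcal H)$, acting by $(\mathcal A_{\mathrm U}\Psi)(k)=A(\mathrm U,k)\Psi(k)$. $\mathrm E(\mathrm U,k):=\min\sigma(A(\mathrm U,k))$, $\mathrm E(\infty,k):=\lim_{\mathrm U\to\infty}\mathrm E(\mathrm U,k)$ (exists); for $k\neq0$, $\Psi(\mathrm U,k):=\big(\hat\upsilon(k)(A_{1,1}(\mathrm U,k)-\mathrm E(\mathrm U,k)\mathfrak 1)^{-1}\mathfrak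 d(k),-1\big)$ (the resolvent exists) and $\Psi(\infty,k):=\lim_{\mathrm U\to\infty}\Psi(\mathrm U,k)\neq0$ (exists in $\mathcal H$). For $\mathrm U\in[0,\infty]$, $M_{\mathrm E(\mathrm U,\cdot)}$ is multiplication by $\mathrm E(\mathrm U,\cdot)$ on $L^2(\mathbb T^2)$, and $\mathfrak P_{\mathrm U}:L^2(\mathbb T^2)\to L^2(\mathbb T^2,\mathcal H)$ is $(\mathfrak P_{\mathrm U}\varphi)(k)=\varphi(k)\|\Psi(\mathrm U,k)\|^{-1}\Psi(\mathrm U,k)$ for $k\neq0$. *)

theory Defs
  imports "HOL-Analysis.Analysis"
begin

text \<open>Points of the torus T^2 are represented by pairs of reals in [-pi,pi)^2;
  sites of Z^2 by pairs of integers.  Elements of L^2(T^2) are represented by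
  functions (real*real) => complex, elements of H = L^2(T^2) + C by pairs.\<close>

type_synonym pt = "real \<times> real"
type_synonym site = "int \<times> int"
type_synonym hv = "(pt \<Rightarrow> complex) \<times> complex"

definition T2 :: "pt set" where
  "T2 = {-pi..<pi} \<times> {-pi..<pi}"

definition nu :: "pt measure" where
  "nu = uniform_measure lborel T2"

definition dotp :: "pt \<Rightarrow> site \<Rightarrow> real" where
  "dotp k x = fst k * of_int (fst x) + snd k * of_int (snd x)"

definition cos2 :: "pt \<Rightarrow> real" where
  "cos2 q = cos (fst q) + cos (snd q)"

definition rot90 :: "site \<Rightarrow> site" where
  "rot90 x = (- snd x, fst x)"

definition enorm_site :: "site \<Rightarrow> real" where
  "enorm_site z = sqrt (of_int (fst z)^2 + of_int (snd z)^2)"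

definition fhat :: "(site \<Rightarrow> real) \<Rightarrow> pt \<Rightarrow> complex" where
  "fhat f k = (\<Sum>\<^sub>\<infinity>x. cis (dotp k x) * complex_of_real (f x))"

definition ehat :: "site \<Rightarrow> pt \<Rightarrow> complex" where
  "ehat x p = cis (dotp p x)"

definition ip :: "(pt \<Rightarrow> complex) \<Rightarrow> (pt \<Rightarrow> complex) \<Rightarrow> complex" where
  "ip \<phi> \<psi> = (\<integral>p. cnj (\<phi> p) * \<psi> p \<partial>nu)"

definition l2n2 :: "(pt \<Rightarrow> complex) \<Rightarrow> ennreal" where
  "l2n2 \<phi> = (\<integral>\<^sup>+p. ennreal ((cmod (\<phi> p))\<^sup>2) \<partial>nu)"

definition inL2 :: "(pt \<Rightarrow> complex) \<Rightarrow> bool" where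
  "inL2 \<phi> \<longleftrightarrow> \<phi> \<in> borel_measurable nu \<and> l2n2 \<phi> < \<infinity>"

definition inH :: "hv \<Rightarrow> bool" where
  "inH \<psi> \<longleftrightarrow> inL2 (fst \<psi>)"

definition hn2 :: "hv \<Rightarrow> ennreal" where
  "hn2 \<psi> = l2n2 (fst \<psi>) + ennreal ((cmod (snd \<psi>))\<^sup>2)"

definition hnorm :: "hv \<Rightarrow> real" where
  "hnorm \<psi> = sqrt (enn2real (hn2 \<psi>))"

definition hadd :: "hv \<Rightarrow> hv \<Rightarrow> hv" where
  "hadd a b = ((\<lambda>p. fst a p + fst b p), snd a + snd b)"

definition hminus :: "hv \<Rightarrow> hv \<Rightarrow> hv" where
  "hminus a b = ((\<lambda>p. fst a p - fst b p), snd a - snd b)"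

definition hscal :: "complex \<Rightarrow> hv \<Rightarrow> hv" where
  "hscal c a = ((\<lambda>p. c * fst a p), c * snd a)"

definition hzero :: hv where
  "hzero = ((\<lambda>p. 0), 0)"

text \<open>equality in H (i.e. almost everywhere in the L^2 component)\<close>
definition heq :: "hv \<Rightarrow> hv \<Rightarrow> bool" where
  "heq a b \<longleftrightarrow> hn2 (hminus a b) = 0"

definition resolvent_set :: "(hv \<Rightarrow> hv) \<Rightarrow> complex set" where
  "resolvent_set T = {lam. \<exists>R (C::real).
      (\<forall>\<psi>. inH \<psi> \<longrightarrow> inH (R \<psi>) \<and> hnorm (R \<psi>) \<le> C * hnorm \<psi>) \<and>
      (\<forall>\<psi> \<phi>. inH \<psi> \<and> inH \<phi> \<and> heq \<psi> \<phi> \<longrightarrow> heq (R \<psi>) (R \<phi>)) \<and>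
      (\<forall>\<psi>. inH \<psi> \<longrightarrow> heq (R (hminus (T \<psi>) (hscal lam \<psi>))) \<psi>
                   \<and> heq (hminus (T (R \<psi>)) (hscal lam (R \<psi>))) \<psi>)}"

definition spectrum :: "(hv \<Rightarrow> hv) \<Rightarrow> complex set" where
  "spectrum T = - resolvent_set T"

definition bfun :: "real \<Rightarrow> real \<Rightarrow> pt \<Rightarrow> real" where
  "bfun eps hb k = hb * eps * (2 - cos2 k)"

definition ffun :: "real \<Rightarrow> pt \<Rightarrow> pt \<Rightarrow> real" where
  "ffun eps k p = eps * (4 - cos2 (p + k) - cos2 p)"

definition dfun :: "(site \<Rightarrow> real) \<Rightarrow> (site \<Rightarrow> real) \<Rightarrow> pt \<Rightarrow> pt \<Rightarrow> complex" where
  "dfun p1 p2 k p = fhat p1 (k + p) + fhat p2 ((1/2) *\<^sub>R k + p)"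

definition A11 :: "real \<Rightarrow> (site \<Rightarrow> real) \<Rightarrow> real \<Rightarrow> pt \<Rightarrow> (pt \<Rightarrow> complex) \<Rightarrow> (pt \<Rightarrow> complex)" where
  "A11 eps u U k \<phi> = (\<lambda>p. complex_of_real (ffun eps k p) * \<phi> p
      + (\<Sum>\<^sub>\<infinity>x. complex_of_real (u x) * ip (ehat x) \<phi> * ehat x p)
      + complex_of_real U * ip (ehat (0,0)) \<phi> * ehat (0,0) p)"

definition Aop :: "real \<Rightarrow> real \<Rightarrow> (site \<Rightarrow> real) \<Rightarrow> (site \<Rightarrow> real) \<Rightarrow> (site \<Rightarrow> real)
    \<Rightarrow> (site \<Rightarrow> real) \<Rightarrow> real \<Rightarrow> pt \<Rightarrow> hv \<Rightarrow> hv" where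
  "Aop eps hb u ups p1 p2 U k \<psi> =
     ((\<lambda>p. A11 eps u U k (fst \<psi>) p + fhat ups k * snd \<psi> * dfun p1 p2 k p),
      fhat ups k * ip (dfun p1 p2 k) (fst \<psi>) + complex_of_real (bfun eps hb k) * snd \<psi>)"

text \<open>E(U,k) = min of the spectrum of A(U,k) (which is real)\<close>
definition Eg :: "real \<Rightarrow> real \<Rightarrow> (site \<Rightarrow> real) \<Rightarrow> (site \<Rightarrow> real) \<Rightarrow> (site \<Rightarrow> real)
    \<Rightarrow> (site \<Rightarrow> real) \<Rightarrow> real \<Rightarrow> pt \<Rightarrow> real" where
  "Eg eps hb u ups p1 p2 U k = Inf (Re ` spectrum (Aop eps hb u ups p1 p2 U k))"

definition Einf :: "real \<Rightarrow> real \<Rightarrow> (site \<Rightarrow> real) \<Rightarrow> (site \<Rightarrow> real) \<Rightarrow> (site \<Rightarrow> real)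
    \<Rightarrow> (site \<Rightarrow> real) \<Rightarrow> pt \<Rightarrow> real" where
  "Einf eps hb u ups p1 p2 k = Lim at_top (\<lambda>U. Eg eps hb u ups p1 p2 U k)"

text \<open>(A_{1,1}(U,k) - E(U,k))^{-1} d(k): the (a.e. unique) L^2 solution phi of
  (A_{1,1}(U,k) - E(U,k)) phi = d(k)\<close>
definition resd :: "real \<Rightarrow> real \<Rightarrow> (site \<Rightarrow> real) \<Rightarrow> (site \<Rightarrow> real) \<Rightarrow> (site \<Rightarrow> real)
    \<Rightarrow> (site \<Rightarrow> real) \<Rightarrow> real \<Rightarrow> pt \<Rightarrow> (pt \<Rightarrow> complex)" where
  "resd eps hb u ups p1 p2 U k = (SOME \<phi>. inL2 \<phi> \<and>
      l2n2 (\<lambda>p. A11 eps u U k \<phi> p - complex_of_real (Eg eps hb u ups p1 p2 U k) * \<phi> p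
                - dfun p1 p2 k p) = 0)"

definition PsiU :: "real \<Rightarrow> real \<Rightarrow> (site \<Rightarrow> real) \<Rightarrow> (site \<Rightarrow> real) \<Rightarrow> (site \<Rightarrow> real)
    \<Rightarrow> (site \<Rightarrow> real) \<Rightarrow> real \<Rightarrow> pt \<Rightarrow> hv" where
  "PsiU eps hb u ups p1 p2 U k =
     ((\<lambda>p. fhat ups k * resd eps hb u ups p1 p2 U k p), -1)"

definition PsiInf :: "real \<Rightarrow> real \<Rightarrow> (site \<Rightarrow> real) \<Rightarrow> (site \<Rightarrow> real) \<Rightarrow> (site \<Rightarrow> real)
    \<Rightarrow> (site \<Rightarrow> real) \<Rightarrow> pt \<Rightarrow> hv" where
  "PsiInf eps hb u ups p1 p2 k = (SOME \<psi>. inH \<psi> \<and>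
      ((\<lambda>U. hn2 (hminus (PsiU eps hb u ups p1 p2 U k) \<psi>)) \<longlongrightarrow> 0) at_top)"

definition Pmap :: "(pt \<Rightarrow> hv) \<Rightarrow> (pt \<Rightarrow> complex) \<Rightarrow> pt \<Rightarrow> hv" where
  "Pmap \<Psi> \<phi> k = (if k = 0 then hzero
                   else hscal (\<phi> k / complex_of_real (hnorm (\<Psi> k))) (\<Psi> k))"

definition L2Hn2 :: "(pt \<Rightarrow> hv) \<Rightarrow> ennreal" where
  "L2Hn2 F = (\<integral>\<^sup>+k. hn2 (F k) \<partial>nu)"

definition L2Hdist2 :: "(pt \<Rightarrow> hv) \<Rightarrow> (pt \<Rightarrow> hv) \<Rightarrow> ennreal" where
  "L2Hdist2 F G = L2Hn2 (\<lambda>k. hminus (F k) (G k))"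

definition exp_partial :: "(pt \<Rightarrow> hv \<Rightarrow> hv) \<Rightarrow> real \<Rightarrow> nat \<Rightarrow> (pt \<Rightarrow> hv) \<Rightarrow> pt \<Rightarrow> hv" where
  "exp_partial A t N F k =
     ((\<lambda>p. \<Sum>n<N. (\<i> * complex_of_real t) ^ n / of_nat (fact n) * fst ((A k ^^ n) (F k)) p),
      (\<Sum>n<N. (\<i> * complex_of_real t) ^ n / of_nat (fact n) * snd ((A k ^^ n) (F k))))"

text \<open>e^{it \<A>} F for the decomposable bounded operator \<A> = direct integral of A(k):
  the L^2(T^2,H)-limit of the exponential series, chosen as a jointly measurable version\<close>
definition exp_it :: "(pt \<Rightarrow> hv \<Rightarrow> hv) \<Rightarrow> real \<Rightarrow> (pt \<Rightarrow> hv) \<Rightarrow> (pt \<Rightarrow> hv)" where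
  "exp_it A t F = (SOME G.
      (\<lambda>kp. fst (G (fst kp)) (snd kp)) \<in> borel_measurable (nu \<Otimes>\<^sub>M nu) \<and>
      (\<lambda>k. snd (G k)) \<in> borel_measurable nu \<and>
      (\<lambda>N. L2Hdist2 (exp_partial A t N F) G) \<longlonglongrightarrow> 0)"

end

theory Submission
  imports Defs
begin

text \<open>
  Fix \<open>k \<noteq> 0\<close>, let \<open>m\<close> be a lower bound of \<open>A\<^sub>1\<^sub>,\<^sub>1\<close> and write \<open>v\<close> for the Fourier transform of
  \<open>\<upsilon>\<close> at \<open>k\<close>, which is real by rotation invariance. For \<open>q < m\<close>, completing the square gives
  \<open>\<langle>(\<phi>,z), (A - q)(\<phi>,z)\<rangle> = \<langle>\<phi>', (A\<^sub>1\<^sub>,\<^sub>1 - q)\<phi>'\<rangle> - h(q) |z|\<^sup>2\<close> with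
  \<open>\<phi>' = \<phi> + vz (A\<^sub>1\<^sub>,\<^sub>1 - q)\<^sup>-\<^sup>1 d\<close> and \<open>h(q) = q - b + v\<^sup>2 \<langle>d, (A\<^sub>1\<^sub>,\<^sub>1 - q)\<^sup>-\<^sup>1 d\<rangle>\<close>. Hence \<open>E\<close> is the zero of
  \<open>h\<close> below \<open>m\<close>, \<open>A \<Psi> = E \<Psi>\<close>, and \<open>q \<le> E\<close> iff \<open>h(q) \<le> 0\<close>, which shows that \<open>E\<close> is measurable in
  \<open>k\<close>. The resolvent is a Neumann series, so \<open>\<Psi>\<close> is jointly measurable, and summing the
  exponential series on the eigenvector gives (i).

  In the limit \<open>U \<longrightarrow> \<infinity>\<close> the eigenvalue increases and is at most \<open>b\<close>. The energy of
  \<open>\<Psi>(U') - \<Psi>(U)\<close> is at most \<open>(E(U') - E(U)) \<parallel>\<Psi>(U')\<parallel>\<^sup>2\<close>, so \<open>\<Psi>(U)\<close> is Cauchy as long as \<open>m - E\<close>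
  stays away from 0. This fails only if \<open>\<epsilon> = 0\<close> and \<open>d\<close> is a multiple of the constant function,
  where \<open>\<Psi>\<close> is explicit. Dominated convergence gives (ii).
\<close>

section \<open>Square-integrable functions on the torus\<close>

text \<open>Square-integrable functions are plain representatives, and \<open>resd\<close>,
  \<open>PsiInf\<close> and \<open>exp_it\<close> are arbitrary choices, while \<open>exp_it\<close>
  also asks for joint measurability. Hence every chosen object is compared almost everywhere with an
  explicit one, and the resolvent is a pointwise series whose step size is a formula in k, so that
  it inherits measurability. The zero of h exists because some trial vector has energy below m: for
  q between that energy and m, h(q) \<le> 0 would force every energy up to q, whereas h is negative
  far to the left. For \<epsilon> > 0 the vector (0,1) suffices, and here the bound 1/2 on
  \<open>hb\<close> enters: with c = |cos (x/2)|, b < m reduces coordinatewise to (1 - c)^2 \<ge> 0.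
  For \<epsilon> = 0 both b and m vanish and the coupling itself must lower the energy. If v = 0 as
  well, then E = m = 0 and no resolvent is at hand, hence a separate degenerate case. The limit
  works with energies alone: raising U adds a non-negative rank-one form, so the eigenvector at U'
  is a trial vector at U.\<close>

lemma T2_sets [measurable]: "T2 \<in> sets borel"
proof -
  have "{-pi..<pi} \<times> {-pi..<pi} \<in> sets (borel \<Otimes>\<^sub>M borel :: (real \<times> real) measure)"
    by (intro pair_measureI) auto
  then show ?thesis unfolding T2_def borel_prod .
qed

lemma emeasure_T2: "emeasure lborel T2 = ennreal (4 * pi\<^sup>2)"
proof -
  have "emeasure (lborel :: pt measure) T2
      = emeasure (lborel \<Otimes>\<^sub>M lborel :: pt measure) ({-pi..<pi} \<times> {-pi..<pi})"
    by (simp add: lborel_prod T2_def)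
  also have "\<dots> = emeasure lborel {-pi..<pi} * emeasure lborel {-pi..<pi}"
    by (rule lborel.emeasure_pair_measure_Times) auto
  also have "\<dots> = ennreal (4 * pi\<^sup>2)"
    by (simp add: ennreal_mult[symmetric] power2_eq_square)
  finally show ?thesis .
qed

lemma sets_nu [measurable_cong, simp]: "sets nu = sets borel"
  by (simp add: nu_def)

lemma space_nu [simp]: "space nu = UNIV"
  by (simp add: nu_def)

lemma emeasure_nu_UNIV: "emeasure nu UNIV = 1"
proof -
  have "(4 * pi\<^sup>2 :: real) > 0" by simp
  then show ?thesis
    unfolding nu_def
    by (subst emeasure_uniform_measure) (auto simp: emeasure_T2 divide_ennreal simp del: zero_less_power2)
qed

interpretation nu: finite_measure nu
  by standard (simp add: emeasure_nu_UNIV)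

lemma measure_nu_UNIV [simp]: "measure nu UNIV = 1"
  by (simp add: measure_def emeasure_nu_UNIV)

lemma AE_nu_T2: "AE k in nu. k \<in> T2"
  unfolding nu_def by (rule AE_uniform_measureI) auto

lemma AE_nu_nonzero: "AE k in nu. k \<noteq> (0::pt)"
proof -
  have "AE k in lborel. k \<noteq> (0::pt)"
    by (rule AE_lborel_singleton)
  then show ?thesis
    unfolding nu_def by (intro AE_uniform_measureI) auto
qed

text \<open>Real-valued counterpart of \<open>l2n2\<close>, for use with subtraction and square
  roots. It carries the norm only on \<open>inL2\<close> functions, because the Bochner integral of
  a non-integrable function is 0.\<close>

definition n2 :: "(pt \<Rightarrow> complex) \<Rightarrow> real" where
  "n2 \<phi> = (\<integral>p. (cmod (\<phi> p))\<^sup>2 \<partial>nu)"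

definition nm :: "(pt \<Rightarrow> complex) \<Rightarrow> real" where
  "nm \<phi> = sqrt (n2 \<phi>)"

lemma n2_nonneg [simp]: "0 \<le> n2 \<phi>"
  by (simp add: n2_def)

lemma nm_nonneg [simp]: "0 \<le> nm \<phi>"
  by (simp add: nm_def)

lemma nm_square [simp]: "(nm \<phi>)\<^sup>2 = n2 \<phi>"
  by (simp add: nm_def)

lemma inL2_iff: "inL2 \<phi> \<longleftrightarrow> \<phi> \<in> borel_measurable nu \<and> integrable nu (\<lambda>p. (cmod (\<phi> p))\<^sup>2)"
  unfolding inL2_def l2n2_def by (auto simp: integrable_iff_bounded)

lemma inL2_measurable: "inL2 \<phi> \<Longrightarrow> \<phi> \<in> borel_measurable nu"
  by (simp add: inL2_def)

lemma l2n2_eq: "inL2 \<phi> \<Longrightarrow> l2n2 \<phi> = ennreal (n2 \<phi>)"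
  unfolding l2n2_def n2_def
  by (rule nn_integral_eq_integral) (auto simp: inL2_iff)

lemma inL2_scale: "inL2 \<phi> \<Longrightarrow> inL2 (\<lambda>p. c * \<phi> p)"
  by (auto simp: inL2_iff norm_mult power_mult_distrib)

lemma inL2_add:
  assumes "inL2 a" "inL2 b" shows "inL2 (\<lambda>p. a p + b p)"
proof -
  have "integrable nu (\<lambda>p. (cmod (a p + b p))\<^sup>2)"
  proof (rule Bochner_Integration.integrable_bound)
    show "integrable nu (\<lambda>p. 2 * (cmod (a p))\<^sup>2 + 2 * (cmod (b p))\<^sup>2)"
      using assms by (auto simp: inL2_iff)
    show "(\<lambda>p. (cmod (a p + b p))\<^sup>2) \<in> borel_measurable nu"
      using assms by (auto simp: inL2_iff)
    have "(cmod (x + y))\<^sup>2 \<le> 2 * (cmod x)\<^sup>2 + 2 * (cmod y)\<^sup>2" for x y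
    proof -
      have "(cmod (x + y))\<^sup>2 \<le> (cmod x + cmod y)\<^sup>2"
        by (intro power_mono norm_triangle_ineq) auto
      also have "\<dots> \<le> 2 * (cmod x)\<^sup>2 + 2 * (cmod y)\<^sup>2"
        using sum_squares_bound[of "cmod x" "cmod y"] by (simp add: power2_sum)
      finally show ?thesis .
    qed
    then show "AE p in nu. norm ((cmod (a p + b p))\<^sup>2) \<le> norm (2 * (cmod (a p))\<^sup>2 + 2 * (cmod (b p))\<^sup>2)"
      by (intro AE_I2) auto
  qed
  then show ?thesis using assms by (auto simp: inL2_iff)
qed

lemma inL2_minus:
  assumes "inL2 a" "inL2 b" shows "inL2 (\<lambda>p. a p - b p)"
  using inL2_add[OF assms(1) inL2_scale[OF assms(2), of "-1"]] by simp

lemma inL2_zero [simp]: "inL2 (\<lambda>p. 0)"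
  by (simp add: inL2_iff)

lemma inL2_sum:
  assumes "\<And>i. i \<in> I \<Longrightarrow> inL2 (f i)" shows "inL2 (\<lambda>p. \<Sum>i\<in>I. f i p)"
  using assms
proof (induction I rule: infinite_finite_induct)
  case (insert x F) then show ?case by (auto intro!: inL2_add)
qed auto

lemma inL2_bounded:
  assumes "\<phi> \<in> borel_measurable nu" "\<And>p. cmod (\<phi> p) \<le> C"
  shows "inL2 \<phi>" "n2 \<phi> \<le> C\<^sup>2"
proof -
  have b: "(cmod (\<phi> p))\<^sup>2 \<le> C\<^sup>2" for p
    using assms(2) by (intro power_mono) auto
  have i: "integrable nu (\<lambda>p. (cmod (\<phi> p))\<^sup>2)"
    by (rule nu.integrable_const_bound[where B="C\<^sup>2"]) (use assms b in auto)
  then show "inL2 \<phi>" using assms by (simp add: inL2_iff)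
  have "n2 \<phi> \<le> (\<integral>p. C\<^sup>2 \<partial>nu)"
    unfolding n2_def by (intro integral_mono i) (use b in auto)
  then show "n2 \<phi> \<le> C\<^sup>2" by simp
qed

lemma inL2_bounded_mult:
  assumes "g \<in> borel_measurable nu" "\<And>p. cmod (g p) \<le> C" "inL2 \<phi>"
  shows "inL2 (\<lambda>p. g p * \<phi> p)" "n2 (\<lambda>p. g p * \<phi> p) \<le> C\<^sup>2 * n2 \<phi>"
proof -
  have b: "(cmod (g p * \<phi> p))\<^sup>2 \<le> C\<^sup>2 * (cmod (\<phi> p))\<^sup>2" for p
    unfolding norm_mult power_mult_distrib
    using assms(2) by (intro mult_right_mono power_mono) auto
  have j: "integrable nu (\<lambda>p. C\<^sup>2 * (cmod (\<phi> p))\<^sup>2)" using assms by (auto simp: inL2_iff)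
  have i: "integrable nu (\<lambda>p. (cmod (g p * \<phi> p))\<^sup>2)"
    by (rule Bochner_Integration.integrable_bound[OF j])
       (use assms b in \<open>auto simp: inL2_iff intro!: AE_I2\<close>)
  then show "inL2 (\<lambda>p. g p * \<phi> p)" using assms by (auto simp: inL2_iff)
  have "n2 (\<lambda>p. g p * \<phi> p) \<le> (\<integral>p. C\<^sup>2 * (cmod (\<phi> p))\<^sup>2 \<partial>nu)"
    unfolding n2_def by (intro integral_mono i j) (use b in auto)
  then show "n2 (\<lambda>p. g p * \<phi> p) \<le> C\<^sup>2 * n2 \<phi>" by (simp add: n2_def)
qed

lemma ip_integrable:
  assumes "inL2 a" "inL2 b" shows "integrable nu (\<lambda>p. cnj (a p) * b p)"
proof (rule Bochner_Integration.integrable_bound)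
  show "integrable nu (\<lambda>p. (cmod (a p))\<^sup>2 + (cmod (b p))\<^sup>2)"
    using assms by (auto simp: inL2_iff)
  have "(\<lambda>p. cnj (a p)) \<in> borel_measurable nu"
    using assms by (intro borel_measurable_continuous_on[of cnj]) (auto simp: inL2_iff intro: continuous_intros)
  then show "(\<lambda>p. cnj (a p) * b p) \<in> borel_measurable nu"
    using assms by (auto simp: inL2_iff)
  have "cmod (cnj x * y) \<le> (cmod x)\<^sup>2 + (cmod y)\<^sup>2" for x y
    using sum_squares_bound[of "cmod x" "cmod y"]
      mult_nonneg_nonneg[OF norm_ge_zero[of x] norm_ge_zero[of y]]
    unfolding norm_mult complex_mod_cnj by linarith
  then show "AE p in nu. norm (cnj (a p) * b p) \<le> norm ((cmod (a p))\<^sup>2 + (cmod (b p))\<^sup>2)"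
    by (intro AE_I2) auto
qed

lemma ip_add_right: "inL2 a \<Longrightarrow> inL2 b \<Longrightarrow> inL2 c \<Longrightarrow> ip a (\<lambda>p. b p + c p) = ip a b + ip a c"
  unfolding ip_def by (simp add: distrib_left ip_integrable)

lemma ip_minus_right: "inL2 a \<Longrightarrow> inL2 b \<Longrightarrow> inL2 c \<Longrightarrow> ip a (\<lambda>p. b p - c p) = ip a b - ip a c"
  unfolding ip_def by (simp add: right_diff_distrib ip_integrable)

lemma ip_scale_right: "ip a (\<lambda>p. c * b p) = c * ip a b"
  unfolding ip_def by (simp add: mult.left_commute)

lemma ip_cnj: "ip b a = cnj (ip a b)"
proof -
  have "cnj (ip a b) = (\<integral>p. cnj (cnj (a p) * b p) \<partial>nu)"
    unfolding ip_def by (rule Bochner_Integration.integral_cnj[symmetric])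
  then show ?thesis by (simp add: ip_def mult.commute)
qed

lemma ip_add_left: "inL2 a \<Longrightarrow> inL2 b \<Longrightarrow> inL2 c \<Longrightarrow> ip (\<lambda>p. a p + b p) c = ip a c + ip b c"
  by (subst (1 2 3) ip_cnj) (simp add: ip_add_right)

lemma ip_minus_left: "inL2 a \<Longrightarrow> inL2 b \<Longrightarrow> inL2 c \<Longrightarrow> ip (\<lambda>p. a p - b p) c = ip a c - ip b c"
  by (subst (1 2 3) ip_cnj) (simp add: ip_minus_right)

lemma ip_scale_left: "ip (\<lambda>p. c * a p) b = cnj c * ip a b"
  by (subst (1 2) ip_cnj) (simp add: ip_scale_right)

lemma ip_self: "ip a a = complex_of_real (n2 a)"
proof -
  have "ip a a = (\<integral>p. complex_of_real ((cmod (a p))\<^sup>2) \<partial>nu)"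
    unfolding ip_def by (intro Bochner_Integration.integral_cong) (simp_all add: complex_norm_square mult.commute del: of_real_power)
  then show ?thesis unfolding n2_def by (simp del: of_real_power)
qed

lemma ip_zero_right [simp]: "ip a (\<lambda>p. 0) = 0"
  and ip_zero_left [simp]: "ip (\<lambda>p. 0) a = 0"
  by (simp_all add: ip_def)

lemma n2_scale: "n2 (\<lambda>p. c * a p) = (cmod c)\<^sup>2 * n2 a"
  by (simp add: n2_def norm_mult power_mult_distrib)

lemma nm_scale: "nm (\<lambda>p. c * a p) = cmod c * nm a"
  by (simp add: nm_def n2_scale real_sqrt_mult)

lemma n2_zero [simp]: "n2 (\<lambda>p. 0) = 0" by (simp add: n2_def)

lemma nm_zero [simp]: "nm (\<lambda>p. 0) = 0" by (simp add: nm_def)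

lemma n2_minus_expand:
  assumes "inL2 a" "inL2 b"
  shows "n2 (\<lambda>p. a p - b p) = n2 a - 2 * Re (ip a b) + n2 b"
proof -
  have "complex_of_real (n2 (\<lambda>p. a p - b p)) = ip a a - ip a b - (ip b a - ip b b)"
    unfolding ip_self[symmetric]
    by (simp add: ip_minus_left ip_minus_right inL2_minus assms)
  also have "ip b a = cnj (ip a b)" by (rule ip_cnj)
  finally have "Re (complex_of_real (n2 (\<lambda>p. a p - b p))) = Re (ip a a - ip a b - (cnj (ip a b) - ip b b))"
    by (rule arg_cong)
  then show ?thesis by (simp add: ip_self)
qed

text \<open>The square norm of \<open>a - t * r * b\<close> with \<open>r = ip b a\<close> is
  non-negative for every real t. The factor r makes the cross term real, and the optimal t gives the
  bound.\<close>

lemma ip_cauchy_schwarz: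
  assumes "inL2 a" "inL2 b" shows "cmod (ip a b) \<le> nm a * nm b"
proof -
  define r where "r = ip b a"
  have r: "ip a b = cnj r" unfolding r_def by (rule ip_cnj)
  have key: "0 \<le> n2 a - 2 * t * (cmod r)\<^sup>2 + t\<^sup>2 * (cmod r)\<^sup>2 * n2 b" for t :: real
  proof -
    have "0 \<le> n2 (\<lambda>p. a p - (of_real t * r) * b p)" by simp
    also have "\<dots> = n2 a - 2 * Re (ip a (\<lambda>p. (of_real t * r) * b p)) + n2 (\<lambda>p. (of_real t * r) * b p)"
      by (rule n2_minus_expand) (auto intro: assms inL2_scale)
    also have "Re (ip a (\<lambda>p. (of_real t * r) * b p)) = t * (cmod r)\<^sup>2"
    proof -
      have "ip a (\<lambda>p. (of_real t * r) * b p) = of_real t * (r * cnj r)"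
        by (simp add: ip_scale_right r)
      also have "r * cnj r = of_real ((cmod r)\<^sup>2)" by (simp add: complex_norm_square del: of_real_power)
      finally show ?thesis by (simp flip: of_real_mult)
    qed
    also have "n2 (\<lambda>p. (of_real t * r) * b p) = t\<^sup>2 * (cmod r)\<^sup>2 * n2 b"
      by (simp add: n2_scale norm_mult power_mult_distrib)
    finally show ?thesis by (simp add: mult.assoc)
  qed
  have "(cmod r)\<^sup>2 \<le> n2 a * n2 b"
  proof (cases "n2 b = 0")
    case True
    have "(cmod r)\<^sup>2 = 0"
    proof (rule ccontr)
      assume "(cmod r)\<^sup>2 \<noteq> 0"
      then have "(cmod r)\<^sup>2 > 0" by simp
      \<comment> \<open>Without the quadratic term the expression is affine in t; this t gives it
        the value -1.\<close>
      with key[of "(n2 a + 1) / (2 * (cmod r)\<^sup>2)"] True show False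
        by (simp add: field_simps)
    qed
    with True show ?thesis by simp
  next
    case False
    then have p: "n2 b > 0" by (simp add: order_less_le)
    have "2 * (1 / n2 b) * (cmod r)\<^sup>2 - (1 / n2 b)\<^sup>2 * (cmod r)\<^sup>2 * n2 b = (cmod r)\<^sup>2 / n2 b"
      using p by (simp add: power2_eq_square field_simps)
    with key[of "1 / n2 b"] have "(cmod r)\<^sup>2 / n2 b \<le> n2 a" by linarith
    with p show ?thesis by (simp add: pos_divide_le_eq)
  qed
  then have "(cmod r)\<^sup>2 \<le> (nm a * nm b)\<^sup>2" by (simp add: power_mult_distrib)
  then have "cmod r \<le> nm a * nm b"
    by (rule power2_le_imp_le) simp
  then show ?thesis by (simp add: r)
qed

lemma nm_triangle_minus:
  assumes "inL2 a" "inL2 b" shows "nm (\<lambda>p. a p - b p) \<le> nm a + nm b"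
proof -
  have "\<bar>Re (ip a b)\<bar> \<le> nm a * nm b"
    using ip_cauchy_schwarz[OF assms] abs_Re_le_cmod order_trans by blast
  then have "n2 (\<lambda>p. a p - b p) \<le> (nm a + nm b)\<^sup>2"
    by (simp add: n2_minus_expand[OF assms] power2_sum)
  then show ?thesis unfolding nm_def[of "\<lambda>p. a p - b p"]
    by (intro real_le_lsqrt) auto
qed

lemma nm_triangle:
  assumes "inL2 a" "inL2 b" shows "nm (\<lambda>p. a p + b p) \<le> nm a + nm b"
  using nm_triangle_minus[OF assms(1) inL2_scale[OF assms(2), of "-1"]] nm_scale[of "-1" b] by simp

lemma nm_commute_minus: "nm (\<lambda>p. a p - b p) = nm (\<lambda>p. b p - a p)"
  by (simp add: nm_def n2_def norm_minus_commute)

lemma nm_diff_le: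
  assumes "inL2 a" "inL2 b" shows "\<bar>nm a - nm b\<bar> \<le> nm (\<lambda>p. a p - b p)"
proof -
  have "nm a \<le> nm (\<lambda>p. a p - b p) + nm b"
    using nm_triangle[OF inL2_minus[OF assms] assms(2)] by simp
  moreover have "nm b \<le> nm (\<lambda>p. b p - a p) + nm a"
    using nm_triangle[OF inL2_minus[OF assms(2,1)] assms(1)] by simp
  ultimately show ?thesis using nm_commute_minus[of a b] by linarith
qed

lemma nm_sum_le:
  assumes "finite I" "\<And>i. i \<in> I \<Longrightarrow> inL2 (f i)"
  shows "nm (\<lambda>p. \<Sum>i\<in>I. f i p) \<le> (\<Sum>i\<in>I. nm (f i))"
  using assms
proof (induction I rule: finite_induct)
  case (insert x F)
  have "nm (\<lambda>p. f x p + (\<Sum>i\<in>F. f i p)) \<le> nm (f x) + nm (\<lambda>p. \<Sum>i\<in>F. f i p)"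
    by (rule nm_triangle) (use insert in \<open>auto intro: inL2_sum\<close>)
  with insert show ?case by auto
qed auto

lemma n2_zero_iff_AE:
  assumes "inL2 a" shows "n2 a = 0 \<longleftrightarrow> (AE p in nu. a p = 0)"
  unfolding n2_def using assms
  by (subst integral_nonneg_eq_0_iff_AE) (auto simp: inL2_iff)

lemma n2_cong_AE:
  assumes "AE p in nu. a p = b p" "inL2 a" "inL2 b" shows "n2 a = n2 b"
  unfolding n2_def by (rule integral_cong_AE) (use assms in \<open>auto simp: inL2_iff\<close>)

lemma ip_cong_AE:
  assumes "AE p in nu. b p = c p" "inL2 a" "inL2 b" "inL2 c" shows "ip a b = ip a c"
  unfolding ip_def
  by (rule integral_cong_AE) (use assms ip_integrable[OF assms(2,3)] ip_integrable[OF assms(2,4)] in auto)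

text \<open>Cauchy-Schwarz against the constant 1, which has norm 1 since \<open>nu\<close> has
  total mass 1. It turns L^2 bounds into the L^1 bounds behind almost everywhere
  convergence.\<close>

lemma integral_norm_le_nm:
  assumes "inL2 a" shows "integrable nu (\<lambda>p. cmod (a p))" "(\<integral>p. cmod (a p) \<partial>nu) \<le> nm a"
proof -
  let ?b = "\<lambda>p. complex_of_real (cmod (a p))"
  have b: "inL2 ?b" using assms by (auto simp: inL2_iff intro!: borel_measurable_of_real)
  have one: "inL2 (\<lambda>p. 1)" by (simp add: inL2_iff)
  have "integrable nu (\<lambda>p. ?b p)" using ip_integrable[OF one b] by simp
  then show i: "integrable nu (\<lambda>p. cmod (a p))" by (metis complex_of_real_integrable_eq)
  have "cmod (ip (\<lambda>p. 1) ?b) \<le> nm (\<lambda>p. 1) * nm ?b" by (rule ip_cauchy_schwarz[OF one b])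
  moreover have "nm ?b = nm a" "nm (\<lambda>p. 1) = 1" by (simp_all add: nm_def n2_def)
  moreover have "ip (\<lambda>p. 1) ?b = of_real (\<integral>p. cmod (a p) \<partial>nu)" by (simp add: ip_def)
  ultimately show "(\<integral>p. cmod (a p) \<partial>nu) \<le> nm a" by simp
qed

section \<open>Coercive operators and the Neumann series\<close>

lemma borel_measurable_suminf_banach:
  fixes f :: "nat \<Rightarrow> 'a \<Rightarrow> complex"
  assumes "\<And>n. f n \<in> borel_measurable M"
  shows "(\<lambda>x. \<Sum>n. f n x) \<in> borel_measurable M"
  unfolding suminf_eq_lim using assms by (intro borel_measurable_lim_metric borel_measurable_sum) auto

text \<open>The sum is the pointwise \<open>suminf\<close>, so measurability in further parameters
  passes through it. Adding up the L^1 norms gives absolute convergence almost everywhere; Fatou's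
  lemma, applied to finite tails bounded uniformly in their length, then gives the L^2
  estimate.\<close>

lemma L2_geometric_series:
  assumes f: "\<And>n. inL2 (f n)" and b: "\<And>n. nm (f n) \<le> C * q ^ n" and q: "0 \<le> q" "q < 1"
  shows "inL2 (\<lambda>p. \<Sum>n. f n p)"
    and "nm (\<lambda>p. (\<Sum>n. f n p) - (\<Sum>n<N. f n p)) \<le> C * q ^ N / (1 - q)"
proof -
  have C: "0 \<le> C" using order_trans[OF nm_nonneg b[of 0]] by simp
  have meas: "f n \<in> borel_measurable nu" for n using f by (rule inL2_measurable)
  have summ: "AE p in nu. summable (\<lambda>n. f n p)"
  proof -
    have "(\<integral>\<^sup>+p. (\<Sum>n. ennreal (cmod (f n p))) \<partial>nu) = (\<Sum>n. \<integral>\<^sup>+p. ennreal (cmod (f n p)) \<partial>nu)"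
      by (rule nn_integral_suminf) (use meas in measurable)
    also have "\<dots> \<le> (\<Sum>n. ennreal (C * q ^ n))"
    proof (rule suminf_le)
      fix n
      have "(\<integral>\<^sup>+p. ennreal (cmod (f n p)) \<partial>nu) = ennreal (\<integral>p. cmod (f n p) \<partial>nu)"
        by (rule nn_integral_eq_integral) (use integral_norm_le_nm(1)[OF f] in auto)
      also have "\<dots> \<le> ennreal (C * q ^ n)"
        using integral_norm_le_nm(2)[OF f, of n] b[of n] by (intro ennreal_leI) linarith
      finally show "(\<integral>\<^sup>+p. ennreal (cmod (f n p)) \<partial>nu) \<le> ennreal (C * q ^ n)" .
    qed auto
    also have "\<dots> = ennreal (\<Sum>n. C * q ^ n)"
      by (rule suminf_ennreal2) (use C q in \<open>auto intro!: summable_mult summable_geometric\<close>)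
    finally have "(\<integral>\<^sup>+p. (\<Sum>n. ennreal (cmod (f n p))) \<partial>nu) \<noteq> \<infinity>"
      by (auto simp: top_unique)
    then have "AE p in nu. (\<Sum>n. ennreal (cmod (f n p))) \<noteq> \<infinity>"
      by (intro nn_integral_PInf_AE) (use meas in measurable)
    then show ?thesis
    proof eventually_elim
      case (elim p)
      have "summable (\<lambda>n. cmod (f n p))"
        by (rule summable_suminf_not_top) (use elim in auto)
      then show ?case by (rule summable_norm_cancel)
    qed
  qed
  let ?S = "\<lambda>p. \<Sum>n. f n p" and ?P = "\<lambda>N p. \<Sum>n<N. f n p"
  have Sm: "?S \<in> borel_measurable nu" by (rule borel_measurable_suminf_banach) (rule meas)
  have Pm: "?P N \<in> borel_measurable nu" for N using meas by measurable
  have fin: "l2n2 (\<lambda>p. ?S p - ?P N p) \<le> ennreal ((C * q ^ N / (1 - q))\<^sup>2)" for N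
  proof -
    have bd: "l2n2 (\<lambda>p. ?P M p - ?P N p) \<le> ennreal ((C * q ^ N / (1 - q))\<^sup>2)" if "M \<ge> N" for M
    proof -
      have e: "(\<lambda>p. ?P M p - ?P N p) = (\<lambda>p. \<Sum>n\<in>{N..<M}. f n p)"
        using that by (auto simp: fun_eq_iff lessThan_atLeast0 sum_diff_nat_ivl)
      have L: "inL2 (\<lambda>p. \<Sum>n\<in>{N..<M}. f n p)" by (rule inL2_sum) (rule f)
      have "nm (\<lambda>p. \<Sum>n\<in>{N..<M}. f n p) \<le> (\<Sum>n\<in>{N..<M}. nm (f n))"
        by (rule nm_sum_le) (auto intro: f)
      also have "\<dots> \<le> (\<Sum>n\<in>{N..<M}. C * q ^ n)" by (rule sum_mono) (rule b)
      also have "\<dots> = C * q ^ N * (\<Sum>n<M - N. q ^ n)"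
      proof -
        have "(\<Sum>n\<in>{N..<M}. C * q ^ n) = (\<Sum>n\<in>{0..<M-N}. C * q ^ (n + N))"
          using sum.shift_bounds_nat_ivl[of "\<lambda>n. C * q ^ n" 0 N "M - N"] that by simp
        then show ?thesis
          by (simp add: power_add sum_distrib_left mult_ac lessThan_atLeast0)
      qed
      also have "\<dots> \<le> C * q ^ N * (1 / (1 - q))"
      proof (rule mult_left_mono)
        have "(\<Sum>n<M - N. q ^ n) \<le> (\<Sum>n. q ^ n)"
          by (rule sum_le_suminf) (use q in \<open>auto intro!: summable_geometric\<close>)
        also have "\<dots> = 1 / (1 - q)" using q by (intro suminf_geometric) auto
        finally show "(\<Sum>n<M - N. q ^ n) \<le> 1 / (1 - q)" .
      qed (use C q in auto)
      finally have "nm (\<lambda>p. \<Sum>n\<in>{N..<M}. f n p) \<le> C * q ^ N / (1 - q)" by simp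
      then have "n2 (\<lambda>p. \<Sum>n\<in>{N..<M}. f n p) \<le> (C * q ^ N / (1 - q))\<^sup>2"
        unfolding nm_square[symmetric] by (intro power_mono) auto
      then show ?thesis unfolding e l2n2_eq[OF L] by (rule ennreal_leI)
    qed
    have "l2n2 (\<lambda>p. ?S p - ?P N p) = (\<integral>\<^sup>+p. liminf (\<lambda>M. ennreal ((cmod (?P M p - ?P N p))\<^sup>2)) \<partial>nu)"
      unfolding l2n2_def
    proof (rule nn_integral_cong_AE)
      show "AE p in nu. ennreal ((cmod (?S p - ?P N p))\<^sup>2)
          = liminf (\<lambda>M. ennreal ((cmod (?P M p - ?P N p))\<^sup>2))"
        using summ
      proof eventually_elim
        case (elim p)
        have "(\<lambda>M. ?P M p) \<longlonglongrightarrow> ?S p" using elim by (rule summable_LIMSEQ)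
        then have "(\<lambda>M. ennreal ((cmod (?P M p - ?P N p))\<^sup>2)) \<longlonglongrightarrow> ennreal ((cmod (?S p - ?P N p))\<^sup>2)"
          by (intro tendsto_ennrealI tendsto_power tendsto_norm tendsto_diff tendsto_const)
        then show ?case by (intro lim_imp_Liminf[symmetric]) auto
      qed
    qed
    also have "\<dots> \<le> liminf (\<lambda>M. l2n2 (\<lambda>p. ?P M p - ?P N p))"
      unfolding l2n2_def by (rule nn_integral_liminf) (use Pm in measurable)
    also have "\<dots> \<le> liminf (\<lambda>M. ennreal ((C * q ^ N / (1 - q))\<^sup>2))"
      by (rule Liminf_mono) (use bd in \<open>auto simp: eventually_sequentially\<close>)
    also have "\<dots> = ennreal ((C * q ^ N / (1 - q))\<^sup>2)" by (simp add: Liminf_const)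
    finally show ?thesis .
  qed
  have L: "inL2 (\<lambda>p. ?S p - ?P N p)" for N
    unfolding inL2_def using fin[of N] Sm Pm
    by (auto intro: le_less_trans)
  show "inL2 ?S" using L[of 0] by simp
  have "n2 (\<lambda>p. ?S p - ?P N p) \<le> (C * q ^ N / (1 - q))\<^sup>2"
    using fin[of N] unfolding l2n2_eq[OF L] by simp
  then show "nm (\<lambda>p. ?S p - ?P N p) \<le> C * q ^ N / (1 - q)"
    unfolding nm_def using C q by (intro real_le_lsqrt) auto
qed

text \<open>Linearity is an identity of functions, not just almost everywhere, so that B can be
  moved through sums pointwise when the residual of the Neumann series is computed.\<close>

definition bdop :: "((pt \<Rightarrow> complex) \<Rightarrow> pt \<Rightarrow> complex) \<Rightarrow> real \<Rightarrow> bool" where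
  "bdop B M \<longleftrightarrow> 0 \<le> M \<and> (\<forall>\<phi>. inL2 \<phi> \<longrightarrow> inL2 (B \<phi>) \<and> nm (B \<phi>) \<le> M * nm \<phi>) \<and>
     (\<forall>\<phi> \<psi> c. inL2 \<phi> \<longrightarrow> inL2 \<psi> \<longrightarrow> B (\<lambda>p. \<phi> p + c * \<psi> p) = (\<lambda>p. B \<phi> p + c * B \<psi> p))"

definition nstep :: "((pt \<Rightarrow> complex) \<Rightarrow> pt \<Rightarrow> complex) \<Rightarrow> real \<Rightarrow> (pt \<Rightarrow> complex) \<Rightarrow> pt \<Rightarrow> complex" where
  "nstep B \<tau> \<phi> = (\<lambda>p. \<phi> p - complex_of_real \<tau> * B \<phi> p)"

text \<open>Formally the inverse of B is \<tau> times the sum of (1 - \<tau> B)^n. An explicit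
  series replaces a chosen solution of B x = d, so joint measurability is inherited when B and d
  depend on k.\<close>

definition nsol :: "((pt \<Rightarrow> complex) \<Rightarrow> pt \<Rightarrow> complex) \<Rightarrow> real \<Rightarrow> (pt \<Rightarrow> complex) \<Rightarrow> pt \<Rightarrow> complex" where
  "nsol B \<tau> d = (\<lambda>p. complex_of_real \<tau> * (\<Sum>n. (nstep B \<tau> ^^ n) d p))"

lemma bdop_inL2: "bdop B M \<Longrightarrow> inL2 \<phi> \<Longrightarrow> inL2 (B \<phi>)"
  and bdop_nm: "bdop B M \<Longrightarrow> inL2 \<phi> \<Longrightarrow> nm (B \<phi>) \<le> M * nm \<phi>"
  and bdop_linear: "bdop B M \<Longrightarrow> inL2 \<phi> \<Longrightarrow> inL2 \<psi> \<Longrightarrow> B (\<lambda>p. \<phi> p + c * \<psi> p) = (\<lambda>p. B \<phi> p + c * B \<psi> p)"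
  by (auto simp: bdop_def)

lemma bdop_zero: assumes "bdop B M" shows "B (\<lambda>p. 0) = (\<lambda>p. 0)"
  using bdop_linear[OF assms inL2_zero inL2_zero, of "-1"] by simp

lemma bdop_scale: assumes "bdop B M" "inL2 \<phi>" shows "B (\<lambda>p. c * \<phi> p) = (\<lambda>p. c * B \<phi> p)"
  using bdop_linear[OF assms(1) inL2_zero assms(2), of c] bdop_zero[OF assms(1)] by simp

lemma bdop_minus: assumes "bdop B M" "inL2 \<phi>" "inL2 \<psi>" shows "B (\<lambda>p. \<phi> p - \<psi> p) = (\<lambda>p. B \<phi> p - B \<psi> p)"
  using bdop_linear[OF assms, of "-1"] by simp

lemma bdop_sum:
  assumes "bdop B M" "\<And>i. i \<in> I \<Longrightarrow> inL2 (f i)"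
  shows "B (\<lambda>p. \<Sum>i\<in>I. f i p) = (\<lambda>p. \<Sum>i\<in>I. B (f i) p)"
  using assms(2)
proof (induction I rule: infinite_finite_induct)
  case (insert x F)
  have "B (\<lambda>p. f x p + 1 * (\<Sum>i\<in>F. f i p)) = (\<lambda>p. B (f x) p + 1 * B (\<lambda>p. \<Sum>i\<in>F. f i p) p)"
    by (rule bdop_linear[OF assms(1)]) (use insert in \<open>auto intro: inL2_sum\<close>)
  with insert show ?case by simp
qed (auto simp: bdop_zero[OF assms(1)])

lemma coercive_nm_le:
  assumes "\<delta> * n2 \<phi> \<le> Re (ip \<phi> \<eta>)" "inL2 \<phi>" "inL2 \<eta>"
  shows "\<delta> * nm \<phi> \<le> nm \<eta>"
proof (cases "nm \<phi> = 0")
  case False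
  have "\<delta> * nm \<phi> * nm \<phi> = \<delta> * n2 \<phi>" by (simp flip: nm_square add: power2_eq_square)
  also have "\<dots> \<le> nm \<eta> * nm \<phi>"
    using assms(1) ip_cauchy_schwarz[OF assms(2,3)] complex_Re_le_cmod[of "ip \<phi> \<eta>"] by (simp add: mult.commute)
  finally show ?thesis using False nm_nonneg[of \<phi>] by (simp add: mult_le_cancel_right)
qed simp

text \<open>The Neumann series converges because \<open>\<parallel>1 - \<tau>B\<parallel>\<^sup>2 \<le> 1 - 2\<tau>\<delta> + \<tau>\<^sup>2M\<^sup>2 < 1\<close> for \<open>\<tau> = \<delta>/M\<^sup>2\<close>.\<close>

lemma neumann_solves:
  assumes B: "bdop B M" and \<delta>: "0 < \<delta>" "\<delta> \<le> M"
    and coerc: "\<And>\<phi>. inL2 \<phi> \<Longrightarrow> \<delta> * n2 \<phi> \<le> Re (ip \<phi> (B \<phi>))" and d: "inL2 d"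
  shows "inL2 (nsol B (\<delta> / M\<^sup>2) d)" "AE p in nu. B (nsol B (\<delta> / M\<^sup>2) d) p = d p"
proof -
  define \<tau> where "\<tau> = \<delta> / M\<^sup>2"
  define q where "q = sqrt (1 - \<delta>\<^sup>2 / M\<^sup>2)"
  define x where "x n = (nstep B \<tau> ^^ n) d" for n
  have M: "0 < M" using \<delta> by simp
  have \<tau>: "0 < \<tau>" using \<delta> M by (simp add: \<tau>_def)
  have le1: "\<delta>\<^sup>2 / M\<^sup>2 \<le> 1" using \<delta> M by (simp add: divide_le_eq_1 power_mono)
  have q: "0 \<le> q" "q < 1" using le1 \<delta> M by (auto simp: q_def)
  have q2: "q\<^sup>2 = 1 - \<delta>\<^sup>2 / M\<^sup>2" using le1 by (simp add: q_def)
  have step: "inL2 (nstep B \<tau> \<phi>)" "nm (nstep B \<tau> \<phi>) \<le> q * nm \<phi>" if \<phi>: "inL2 \<phi>" for \<phi>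
  proof -
    have B\<phi>: "inL2 (B \<phi>)" using B \<phi> by (rule bdop_inL2)
    show "inL2 (nstep B \<tau> \<phi>)" unfolding nstep_def by (intro inL2_minus inL2_scale \<phi> B\<phi>)
    have "n2 (nstep B \<tau> \<phi>) = n2 \<phi> - 2 * \<tau> * Re (ip \<phi> (B \<phi>)) + \<tau>\<^sup>2 * n2 (B \<phi>)"
      unfolding nstep_def
      by (subst n2_minus_expand) (auto intro: \<phi> B\<phi> inL2_scale simp: ip_scale_right n2_scale)
    moreover have "\<tau> * (\<delta> * n2 \<phi>) \<le> \<tau> * Re (ip \<phi> (B \<phi>))"
      using coerc[OF \<phi>] \<tau> by simp
    moreover have "n2 (B \<phi>) \<le> M\<^sup>2 * n2 \<phi>"
      using power_mono[OF bdop_nm[OF B \<phi>], of 2] by (simp add: power_mult_distrib)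
    then have "\<tau>\<^sup>2 * n2 (B \<phi>) \<le> \<tau>\<^sup>2 * (M\<^sup>2 * n2 \<phi>)" by (rule mult_left_mono) simp
    ultimately have "n2 (nstep B \<tau> \<phi>) \<le> n2 \<phi> - 2 * \<tau> * \<delta> * n2 \<phi> + \<tau>\<^sup>2 * M\<^sup>2 * n2 \<phi>" by (simp add: mult.assoc)
    also have "\<dots> = q\<^sup>2 * n2 \<phi>"
      unfolding q2 \<tau>_def using M by (simp add: field_simps power2_eq_square)
    finally have "n2 (nstep B \<tau> \<phi>) \<le> (q * nm \<phi>)\<^sup>2" by (simp add: power_mult_distrib)
    then show "nm (nstep B \<tau> \<phi>) \<le> q * nm \<phi>"
      unfolding nm_def[of "nstep B \<tau> \<phi>"] using q by (intro real_le_lsqrt) auto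
  qed
  have xL: "inL2 (x n)" for n by (induction n) (auto simp: x_def d step)
  have xn: "nm (x n) \<le> nm d * q ^ n" for n
  proof (induction n)
    case (Suc n)
    have "nm (x (Suc n)) \<le> q * nm (x n)" using step(2)[OF xL[of n]] by (simp add: x_def)
    also have "\<dots> \<le> q * (nm d * q ^ n)" using Suc q by (intro mult_left_mono) auto
    finally show ?case by (simp add: mult_ac)
  qed (simp add: x_def)
  let ?S = "\<lambda>p. \<Sum>n. x n p" and ?P = "\<lambda>N p. \<Sum>n<N. x n p"
  have S: "inL2 ?S" and SN: "\<And>N. nm (\<lambda>p. ?S p - ?P N p) \<le> nm d * q ^ N / (1 - q)"
    using L2_geometric_series[of x "nm d" q] xL xn q by auto
  have sol: "nsol B (\<delta> / M\<^sup>2) d = (\<lambda>p. complex_of_real \<tau> * ?S p)"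
    by (simp add: nsol_def \<tau>_def x_def)
  show L: "inL2 (nsol B (\<delta> / M\<^sup>2) d)" unfolding sol by (rule inL2_scale[OF S])
  let ?R = "\<lambda>p. B (nsol B (\<delta> / M\<^sup>2) d) p - d p"
  have RL: "inL2 ?R" by (intro inL2_minus bdop_inL2[OF B] L d)
  \<comment> \<open>The residual does not depend on N, yet is at most a constant times q^N for every
    N; hence it vanishes.\<close>
  have bound: "nm ?R \<le> (\<tau> * M * (nm d / (1 - q)) + nm d) * q ^ N" for N
  proof -
    have P: "inL2 (?P N)" by (rule inL2_sum) (rule xL)
    have SP: "inL2 (\<lambda>p. ?S p - ?P N p)" by (rule inL2_minus[OF S P])
    \<comment> \<open>By the form of \<open>nstep\<close>, \<tau> B maps the n-th iterate to its
      difference from the next one, so the partial sums telescope.\<close>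
    have tel: "complex_of_real \<tau> * B (?P N) p = d p - x N p" for p
    proof -
      have "complex_of_real \<tau> * B (?P N) p = (\<Sum>n<N. x n p - x (Suc n) p)"
        by (subst bdop_sum[OF B xL]) (simp add: sum_distrib_left x_def nstep_def)
      also have "\<dots> = x 0 p - x N p" by (rule sum_lessThan_telescope')
      finally show ?thesis by (simp add: x_def)
    qed
    have eq: "?R = (\<lambda>p. complex_of_real \<tau> * B (\<lambda>p. ?S p - ?P N p) p - x N p)"
    proof
      fix p
      have "B (nsol B (\<delta> / M\<^sup>2) d) p = complex_of_real \<tau> * B ?S p"
        unfolding sol by (subst bdop_scale[OF B S]) simp
      moreover have "B (\<lambda>p. ?S p - ?P N p) p = B ?S p - B (?P N) p"
        by (subst bdop_minus[OF B S P]) simp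
      ultimately show "?R p = complex_of_real \<tau> * B (\<lambda>p. ?S p - ?P N p) p - x N p"
        using tel[of p] by (simp add: right_diff_distrib)
    qed
    have "nm ?R \<le> nm (\<lambda>p. complex_of_real \<tau> * B (\<lambda>p. ?S p - ?P N p) p) + nm (x N)"
      unfolding eq by (rule nm_triangle_minus) (auto intro!: inL2_scale bdop_inL2[OF B] SP xL)
    also have "nm (\<lambda>p. complex_of_real \<tau> * B (\<lambda>p. ?S p - ?P N p) p) = \<tau> * nm (B (\<lambda>p. ?S p - ?P N p))"
      using \<tau> by (simp add: nm_scale)
    also have "\<dots> \<le> \<tau> * (M * (nm d * q ^ N / (1 - q)))"
    proof (rule mult_left_mono)
      have "nm (B (\<lambda>p. ?S p - ?P N p)) \<le> M * nm (\<lambda>p. ?S p - ?P N p)" by (rule bdop_nm[OF B SP])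
      also have "\<dots> \<le> M * (nm d * q ^ N / (1 - q))" using SN[of N] M by (intro mult_left_mono) auto
      finally show "nm (B (\<lambda>p. ?S p - ?P N p)) \<le> M * (nm d * q ^ N / (1 - q))" .
    qed (use \<tau> in simp)
    also have "nm (x N) \<le> nm d * q ^ N" by (rule xn)
    finally show ?thesis by (simp add: algebra_simps)
  qed
  have "(\<lambda>N. (\<tau> * M * (nm d / (1 - q)) + nm d) * q ^ N) \<longlonglongrightarrow> (\<tau> * M * (nm d / (1 - q)) + nm d) * 0"
    using q by (intro tendsto_mult tendsto_const LIMSEQ_realpow_zero) auto
  then have "nm ?R \<le> 0" using bound by (intro LIMSEQ_le_const[where X="\<lambda>N. (\<tau> * M * (nm d / (1 - q)) + nm d) * q ^ N"]) auto
  then have "n2 ?R = 0" by (intro order_antisym) (auto simp: nm_def)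
  then have "AE p in nu. ?R p = 0" using n2_zero_iff_AE[OF RL] by simp
  then show "AE p in nu. B (nsol B (\<delta> / M\<^sup>2) d) p = d p" by eventually_elim simp
qed

section \<open>Fourier series\<close>

text \<open>Turns sums over the lattice into ordinary series, to which measurability of limits and
  termwise integration apply.\<close>

definition site_enum :: "nat \<Rightarrow> site" where "site_enum = from_nat_into UNIV"

lemma bij_site_enum: "bij_betw site_enum UNIV UNIV"
  unfolding site_enum_def
proof (rule bij_betw_from_nat_into)
  show "infinite (UNIV :: site set)" by (simp add: finite_prod infinite_UNIV_int)
qed auto

lemma abs_summable_site:
  fixes f :: "site \<Rightarrow> complex"
  assumes "(\<lambda>x. norm (f x)) summable_on UNIV"
  shows "summable (\<lambda>n. norm (f (site_enum n)))" "(\<Sum>\<^sub>\<infinity>x. f x) = (\<Sum>n. f (site_enum n))"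
proof -
  have "(\<lambda>n. norm (f (site_enum n))) summable_on UNIV"
    by (subst summable_on_reindex_bij_betw[OF bij_site_enum, of "\<lambda>x. norm (f x)"]) (rule assms)
  then show s: "summable (\<lambda>n. norm (f (site_enum n)))"
    by (rule summable_on_imp_summable)
  have "((\<lambda>n. f (site_enum n)) has_sum (\<Sum>n. f (site_enum n))) UNIV"
    by (rule norm_summable_imp_has_sum[OF s]) (rule summable_sums[OF summable_norm_cancel[OF s]])
  then have "(f has_sum (\<Sum>n. f (site_enum n))) UNIV"
    by (subst (asm) has_sum_reindex_bij_betw[OF bij_site_enum, of f])
  then show "(\<Sum>\<^sub>\<infinity>x. f x) = (\<Sum>n. f (site_enum n))" by (rule infsumI)
qed

section \<open>Characters of the torus and their orthonormality\<close>

lemma norm_ehat [simp]: "cmod (ehat x p) = 1"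
  by (simp add: ehat_def)

lemma cis_measurable [measurable (raw)]:
  "f \<in> borel_measurable M \<Longrightarrow> (\<lambda>x. cis (f x)) \<in> borel_measurable M"
  by (rule borel_measurable_continuous_on[where f=cis]) (auto intro: continuous_intros)

lemma dotp_measurable: "(\<lambda>p. dotp p x) \<in> borel_measurable borel"
  unfolding dotp_def by (intro borel_measurable_continuous_onI continuous_intros)

lemma ehat_measurable [measurable]: "ehat x \<in> borel_measurable borel"
  unfolding ehat_def[abs_def] using dotp_measurable by measurable

lemma ehat_measurable_nu: "ehat x \<in> borel_measurable nu"
  by measurable

lemma inL2_ehat [simp]: "inL2 (ehat x)"
  by (rule inL2_bounded(1)[where C=1, OF ehat_measurable_nu]) simp

lemma integral_cis_Ico:
  fixes n :: int
  shows "integrable lborel (\<lambda>s. indicator {-pi..<pi} s *\<^sub>R cis (s * of_int n))"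
    and "(\<integral>s. indicator {-pi..<pi} s *\<^sub>R cis (s * of_int n) \<partial>lborel) = (if n = 0 then of_real (2 * pi) else 0)"
proof -
  define F where "F = (\<lambda>s::real. if n = 0 then of_real s else cis (s * of_int n) / (\<i> * of_int n))"
  have D: "(F has_vector_derivative cis (s * of_int n)) (at s within {-pi..pi})" for s
  proof (cases "n = 0")
    case True
    have "(complex_of_real has_vector_derivative 1) (at s within {-pi..pi})"
      using has_vector_derivative_of_real[OF DERIV_ident] by simp
    then show ?thesis using True by (simp add: F_def)
  next
    case False
    have "((\<lambda>s. exp (\<i> * of_real s * of_int n) / (\<i> * of_int n)) has_vector_derivative
       exp (\<i> * of_real s * of_int n)) (at s within {-pi..pi})"
    proof (rule has_vector_derivative_real_field)
      show "((\<lambda>z. exp (\<i> * z * of_int n) / (\<i> * of_int n)) has_field_derivative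
        exp (\<i> * of_real s * of_int n)) (at (complex_of_real s))"
        using False by (auto intro!: derivative_eq_intros)
    qed
    then show ?thesis using False by (simp add: F_def cis_conv_exp mult.assoc)
  qed
  have c: "continuous_on {-pi..pi} (\<lambda>s. cis (s * of_int n))" by (intro continuous_intros)
  have 1: "has_bochner_integral lborel (\<lambda>s. indicator {-pi..pi} s *\<^sub>R cis (s * of_int n)) (F pi - F (-pi))"
    by (rule has_bochner_integral_FTC_Icc) (use D c in auto)
  \<comment> \<open>The fundamental theorem works on the closed interval; the endpoint pi is a null
    set.\<close>
  have ae: "AE s in lborel. indicator {-pi..pi} s *\<^sub>R cis (s * of_int n) = indicator {-pi..<pi} s *\<^sub>R cis (s * of_int n)"
    using AE_lborel_singleton[of pi] by eventually_elim (auto split: split_indicator)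
  have 2: "has_bochner_integral lborel (\<lambda>s. indicator {-pi..<pi} s *\<^sub>R cis (s * of_int n)) (F pi - F (-pi))"
    by (rule iffD1[OF has_bochner_integral_cong_AE[OF _ _ ae] 1]) measurable
  have F: "F pi - F (-pi) = (if n = 0 then of_real (2 * pi) else 0)"
  proof (cases "n = 0")
    case False
    have "cis (pi * of_int n) = cis (- pi * of_int n)"
      by (simp add: complex_eq_iff sin_npi_int)
    then show ?thesis using False by (simp add: F_def)
  qed (simp add: F_def)
  show "integrable lborel (\<lambda>s. indicator {-pi..<pi} s *\<^sub>R cis (s * of_int n))"
    "(\<integral>s. indicator {-pi..<pi} s *\<^sub>R cis (s * of_int n) \<partial>lborel) = (if n = 0 then of_real (2 * pi) else 0)"
    using 2 F by (auto simp: has_bochner_integral_iff)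
qed

lemma integral_nu:
  fixes f :: "pt \<Rightarrow> complex"
  assumes "f \<in> borel_measurable borel"
  shows "(\<integral>p. f p \<partial>nu) = (\<integral>p. indicator T2 p *\<^sub>R f p \<partial>lborel) / of_real (4 * pi\<^sup>2)"
proof -
  have p: "(4 * pi\<^sup>2 :: real) > 0" by simp
  have e: "nu = density lborel (\<lambda>p. ennreal (indicator T2 p / (4 * pi\<^sup>2)))"
    unfolding nu_def uniform_measure_def emeasure_T2
    by (rule arg_cong[where f="density lborel"], rule ext)
       (use p in \<open>auto simp: divide_ennreal split: split_indicator simp flip: ennreal_1\<close>)
  have "(\<integral>p. f p \<partial>nu) = (\<integral>p. (indicator T2 p / (4 * pi\<^sup>2)) *\<^sub>R f p \<partial>lborel)"
    unfolding e by (rule integral_density) (use assms in \<open>auto intro!: AE_I2\<close>)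
  also have "\<dots> = (\<integral>p. (indicator T2 p *\<^sub>R f p) / of_real (4 * pi\<^sup>2) \<partial>lborel)"
    by (rule Bochner_Integration.integral_cong) (auto simp: scaleR_conv_of_real)
  also have "\<dots> = (\<integral>p. indicator T2 p *\<^sub>R f p \<partial>lborel) / of_real (4 * pi\<^sup>2)"
    by (rule integral_divide_zero)
  finally show ?thesis .
qed

lemma integral_ehat: "(\<integral>p. ehat x p \<partial>nu) = (if x = (0,0) then 1 else 0)"
proof -
  obtain a b where x: "x = (a, b)" by (cases x)
  let ?g = "\<lambda>(n::int) s. indicator {-pi..<pi} s *\<^sub>R cis (s * of_int n)"
  have fac: "indicator T2 p *\<^sub>R ehat x p = ?g a (fst p) * ?g b (snd p)" for p
    by (cases p) (auto simp: x T2_def ehat_def dotp_def cis_mult split: split_indicator)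
  have ig: "integrable (lborel \<Otimes>\<^sub>M lborel) (\<lambda>p. ?g a (fst p) * ?g b (snd p))"
  proof -
    have "integrable lborel (\<lambda>p. indicator T2 p *\<^sub>R ehat x p)"
    proof (rule Bochner_Integration.integrable_bound)
      show "integrable lborel (\<lambda>p. indicator T2 p :: real)"
        by (rule integrable_real_indicator) (auto simp: emeasure_T2)
      show "(\<lambda>p. indicator T2 p *\<^sub>R ehat x p) \<in> borel_measurable lborel" by measurable
    qed (auto intro!: AE_I2)
    then show ?thesis unfolding fac lborel_prod .
  qed
  have "(\<integral>p. indicator T2 p *\<^sub>R ehat x p \<partial>lborel)
      = (\<integral>p. ?g a (fst p) * ?g b (snd p) \<partial>(lborel \<Otimes>\<^sub>M lborel))"
    unfolding fac lborel_prod ..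
  also have "\<dots> = (\<integral>s. \<integral>t. ?g a s * ?g b t \<partial>lborel \<partial>lborel)"
    using lborel_pair.integral_fst'[OF ig] by simp
  also have "\<dots> = (\<integral>s. ?g a s \<partial>lborel) * (\<integral>t. ?g b t \<partial>lborel)"
    by (simp only: integral_mult_right_zero integral_mult_left_zero)
  also have "\<dots> = (if x = (0,0) then of_real (4 * pi\<^sup>2) else 0)"
    by (simp add: integral_cis_Ico x power2_eq_square)
  finally show ?thesis by (subst integral_nu) auto
qed

lemma ip_ehat: "ip (ehat x) (ehat y) = (if x = y then 1 else 0)"
proof -
  have "cnj (ehat x p) * ehat y p = ehat (y - x) p" for p
    by (simp add: ehat_def dotp_def cis_cnj cis_mult algebra_simps)
  then have "ip (ehat x) (ehat y) = (\<integral>p. ehat (y - x) p \<partial>nu)" by (simp add: ip_def)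
  also have "\<dots> = (if x = y then 1 else 0)"
    unfolding integral_ehat by (auto simp: prod_eq_iff)
  finally show ?thesis .
qed

lemma n2_ehat [simp]: "n2 (ehat x) = 1"
  by (simp add: n2_def)

lemma nm_ehat [simp]: "nm (ehat x) = 1"
  by (simp add: nm_def)

lemma ip_ehat_le: "inL2 \<phi> \<Longrightarrow> cmod (ip (ehat x) \<phi>) \<le> nm \<phi>"
  using ip_cauchy_schwarz[of "ehat x" \<phi>] by simp

text \<open>The function with Fourier coefficients c. Both d(k) and the potential term of A_{1,1}
  applied to a vector have this form.\<close>

definition FS :: "(site \<Rightarrow> complex) \<Rightarrow> pt \<Rightarrow> complex" where
  "FS c p = (\<Sum>\<^sub>\<infinity>x. c x * ehat x p)"

context
  fixes c :: "site \<Rightarrow> complex"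
  assumes c: "(\<lambda>x. cmod (c x)) summable_on UNIV"
begin

lemma FS_abs_summable: "(\<lambda>x. cmod (c x * ehat x p)) summable_on UNIV"
  using c by (simp add: norm_mult)

lemma FS_suminf: "FS c p = (\<Sum>n. c (site_enum n) * ehat (site_enum n) p)"
  unfolding FS_def by (rule abs_summable_site(2)) (rule FS_abs_summable)

lemma FS_bound: "cmod (FS c p) \<le> (\<Sum>\<^sub>\<infinity>x. cmod (c x))"
  unfolding FS_def using norm_infsum_bound[OF FS_abs_summable, of p] by (simp add: norm_mult)

lemma FS_measurable: "FS c \<in> borel_measurable nu"
  unfolding FS_suminf[abs_def] by (rule borel_measurable_suminf_banach) (use ehat_measurable_nu in measurable)

lemma inL2_FS: "inL2 (FS c)" and n2_FS_le: "n2 (FS c) \<le> (\<Sum>\<^sub>\<infinity>x. cmod (c x))\<^sup>2"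
  using inL2_bounded[OF FS_measurable FS_bound] by auto

text \<open>Characters have modulus 1, so absolute summability of c justifies integrating term by
  term along \<open>site_enum\<close>.\<close>

lemma ip_FS:
  assumes "inL2 \<phi>" shows "ip \<phi> (FS c) = (\<Sum>\<^sub>\<infinity>x. c x * ip \<phi> (ehat x))"
proof -
  have s: "summable (\<lambda>n. cmod (c (site_enum n)))" by (rule abs_summable_site(1)) (rule c)
  have m: "(\<lambda>p. cnj (\<phi> p)) \<in> borel_measurable nu"
    using assms by (intro borel_measurable_continuous_on[of cnj]) (auto simp: inL2_iff intro: continuous_intros)
  have sp: "summable (\<lambda>n. c (site_enum n) * ehat (site_enum n) p)" for p
    by (rule summable_norm_cancel) (simp add: norm_mult s)
  have "ip \<phi> (FS c) = (\<integral>p. (\<Sum>n. c (site_enum n) * (cnj (\<phi> p) * ehat (site_enum n) p)) \<partial>nu)"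
    unfolding ip_def FS_suminf
    by (rule Bochner_Integration.integral_cong[OF refl])
       (simp add: suminf_mult[OF sp, symmetric] mult_ac)
  also have "\<dots> = (\<Sum>n. \<integral>p. c (site_enum n) * (cnj (\<phi> p) * ehat (site_enum n) p) \<partial>nu)"
  proof (rule integral_suminf)
    show "integrable nu (\<lambda>p. c (site_enum n) * (cnj (\<phi> p) * ehat (site_enum n) p))" for n
      by (intro integrable_mult_right ip_integrable assms inL2_ehat)
    show "AE p in nu. summable (\<lambda>n. norm (c (site_enum n) * (cnj (\<phi> p) * ehat (site_enum n) p)))"
      using s by (intro AE_I2) (simp add: norm_mult summable_mult2)
    show "summable (\<lambda>n. \<integral>p. norm (c (site_enum n) * (cnj (\<phi> p) * ehat (site_enum n) p)) \<partial>nu)"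
      using s by (simp add: norm_mult summable_mult2)
  qed
  also have "\<dots> = (\<Sum>n. c (site_enum n) * ip \<phi> (ehat (site_enum n)))"
    by (simp add: ip_def)
  also have "\<dots> = (\<Sum>\<^sub>\<infinity>x. c x * ip \<phi> (ehat x))"
  proof (rule abs_summable_site(2)[symmetric])
    show "(\<lambda>x. cmod (c x * ip \<phi> (ehat x))) summable_on UNIV"
    proof (rule summable_on_comparison_test)
      show "(\<lambda>x. cmod (c x) * nm \<phi>) summable_on UNIV" using c by (rule summable_on_cmult_left)
      show "0 \<le> cmod (c x * ip \<phi> (ehat x))" for x by simp
      show "cmod (c x * ip \<phi> (ehat x)) \<le> cmod (c x) * nm \<phi>" for x
        using ip_cauchy_schwarz[OF assms inL2_ehat, of x] by (simp add: norm_mult mult_left_mono)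
    qed
  qed
  finally show ?thesis .
qed

lemma ip_ehat_FS: "ip (ehat y) (FS c) = c y"
proof -
  have "ip (ehat y) (FS c) = (\<Sum>\<^sub>\<infinity>x. c x * (if y = x then 1 else 0))"
    by (simp add: ip_FS ip_ehat)
  also have "\<dots> = (\<Sum>\<^sub>\<infinity>x\<in>{y}. c x)"
    by (rule infsum_cong_neutral) auto
  finally show ?thesis by simp
qed

end

section \<open>The operators of the model\<close>

locale model =
  fixes eps hb :: real and u ups p1 p2 :: "site \<Rightarrow> real"
  assumes eps: "0 \<le> eps" and hb: "0 \<le> hb" "hb \<le> 1/2"
    and u_nonneg: "\<And>x. 0 \<le> u x"
    and ups_rot: "\<And>x. ups (rot90 x) = ups x"
    and u_sum: "u summable_on UNIV" and ups_sum: "(\<lambda>x. \<bar>ups x\<bar>) summable_on UNIV"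
    and p1_sum: "(\<lambda>x. \<bar>p1 x\<bar>) summable_on UNIV" and p2_sum: "(\<lambda>x. \<bar>p2 x\<bar>) summable_on UNIV"
    and p_cond: "\<And>k. k \<in> T2 \<Longrightarrow> \<exists>x. complex_of_real (p2 x) \<noteq> - cis (dotp k x / 2) * complex_of_real (p1 x)"
begin

abbreviation A :: "real \<Rightarrow> pt \<Rightarrow> (pt \<Rightarrow> complex) \<Rightarrow> pt \<Rightarrow> complex" where "A \<equiv> A11 eps u"
abbreviation AA :: "real \<Rightarrow> pt \<Rightarrow> hv \<Rightarrow> hv" where "AA \<equiv> Aop eps hb u ups p1 p2"
abbreviation E :: "real \<Rightarrow> pt \<Rightarrow> real" where "E \<equiv> Eg eps hb u ups p1 p2"
abbreviation D :: "pt \<Rightarrow> pt \<Rightarrow> complex" where "D \<equiv> dfun p1 p2"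
abbreviation b :: "pt \<Rightarrow> real" where "b \<equiv> bfun eps hb"
abbreviation e0 :: "pt \<Rightarrow> complex" where "e0 \<equiv> ehat (0,0)"

abbreviation PS :: "real \<Rightarrow> pt \<Rightarrow> hv" where "PS \<equiv> PsiU eps hb u ups p1 p2"
abbreviation PI :: "pt \<Rightarrow> hv" where "PI \<equiv> PsiInf eps hb u ups p1 p2"
abbreviation EI :: "pt \<Rightarrow> real" where "EI \<equiv> Einf eps hb u ups p1 p2"

section \<open>Form factors and their Fourier coefficients\<close>

definition V :: "pt \<Rightarrow> real" where "V k = Re (fhat ups k)"

definition VM :: real where "VM = (\<Sum>\<^sub>\<infinity>x. \<bar>ups x\<bar>)"

text \<open>A lower bound of the symbol \<open>\<ff>(k)\<close>, obtained from
  \<open>cos (p + k) + cos p = 2 cos (k/2) cos (p + k/2)\<close>.\<close>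

definition m :: "pt \<Rightarrow> real" where
  "m k = eps * (4 - 2 * \<bar>cos (fst k / 2)\<bar> - 2 * \<bar>cos (snd k / 2)\<bar>)"

text \<open>Two quarter turns are the inversion; this symmetry makes the Fourier transform of
  \<open>ups\<close> real.\<close>

lemma ups_minus: "ups (- x) = ups x"
proof -
  have "rot90 (rot90 x) = - x" by (simp add: rot90_def prod_eq_iff)
  then show ?thesis using ups_rot[of "rot90 x"] ups_rot[of x] by simp
qed

lemma fhat_ups: "fhat ups k = complex_of_real (V k)"
proof -
  have "cnj (fhat ups k) = (\<Sum>\<^sub>\<infinity>x. cnj (cis (dotp k x) * complex_of_real (ups x)))"
    unfolding fhat_def by (rule infsum_cnj[symmetric])
  also have "\<dots> = (\<Sum>\<^sub>\<infinity>x. cis (dotp k (- x)) * complex_of_real (ups (- x)))"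
    by (simp add: ups_minus cis_cnj dotp_def)
  also have "\<dots> = fhat ups k"
    unfolding fhat_def
    by (rule infsum_reindex_bij_betw[of uminus UNIV UNIV "\<lambda>x. cis (dotp k x) * complex_of_real (ups x)"])
       (rule bij_betw_byWitness[where f'=uminus], auto)
  finally show ?thesis unfolding V_def by (simp add: complex_eq_iff)
qed

lemma V_bound: "\<bar>V k\<bar> \<le> VM"
proof -
  have "\<bar>V k\<bar> = cmod (fhat ups k)" by (simp add: fhat_ups)
  also have "\<dots> \<le> (\<Sum>\<^sub>\<infinity>x. cmod (cis (dotp k x) * complex_of_real (ups x)))"
    unfolding fhat_def by (rule norm_infsum_bound) (use ups_sum in \<open>simp add: norm_mult\<close>)
  finally show ?thesis by (simp add: norm_mult VM_def)
qed

text \<open>Fourier coefficients of d(k): shifting the argument by k or k/2 becomes a phase.\<close>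

definition dc :: "pt \<Rightarrow> site \<Rightarrow> complex" where
  "dc k x = cis (dotp k x) * of_real (p1 x) + cis (dotp k x / 2) * of_real (p2 x)"

definition DM :: real where "DM = (\<Sum>\<^sub>\<infinity>x. \<bar>p1 x\<bar> + \<bar>p2 x\<bar>)"

lemma dc_le: "cmod (dc k x) \<le> \<bar>p1 x\<bar> + \<bar>p2 x\<bar>"
  unfolding dc_def by (rule order_trans[OF norm_triangle_ineq]) (simp add: norm_mult)

lemma dc_summable: "(\<lambda>x. cmod (dc k x)) summable_on UNIV"
  by (rule summable_on_comparison_test[OF summable_on_add[OF p1_sum p2_sum]]) (auto simp: dc_le)

lemma D_FS: "D k = FS (dc k)"
proof
  fix p
  have a: "(\<lambda>x. cis (dotp q x) * complex_of_real (f x)) summable_on UNIV"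
    if "(\<lambda>x. \<bar>f x\<bar>) summable_on UNIV" for f q
    by (rule abs_summable_summable) (use that in \<open>simp add: norm_mult\<close>)
  have "D k p = (\<Sum>\<^sub>\<infinity>x. cis (dotp (k + p) x) * of_real (p1 x) + cis (dotp ((1/2) *\<^sub>R k + p) x) * of_real (p2 x))"
    unfolding dfun_def fhat_def by (rule infsum_add[symmetric]) (intro a p1_sum p2_sum)+
  also have "\<dots> = FS (dc k) p"
    unfolding FS_def dc_def
    by (rule infsum_cong) (simp add: ehat_def dotp_def distrib_right cis_mult algebra_simps add_divide_distrib)
  finally show "D k p = FS (dc k) p" .
qed

lemma inL2_D: "inL2 (D k)"
  unfolding D_FS by (rule inL2_FS[OF dc_summable])

lemma n2_D_le: "n2 (D k) \<le> DM\<^sup>2"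
proof -
  have "(\<Sum>\<^sub>\<infinity>x. cmod (dc k x)) \<le> DM"
    unfolding DM_def by (rule infsum_mono[OF dc_summable summable_on_add[OF p1_sum p2_sum] dc_le])
  moreover have "0 \<le> (\<Sum>\<^sub>\<infinity>x. cmod (dc k x))" by (rule infsum_nonneg) simp
  ultimately have "(\<Sum>\<^sub>\<infinity>x. cmod (dc k x))\<^sup>2 \<le> DM\<^sup>2" by (rule power_mono)
  then show ?thesis unfolding D_FS using n2_FS_le[OF dc_summable, of k] by linarith
qed

text \<open>Up to a factor of modulus 1, the coefficient of d(k) at x is
  \<open>cis (dotp k x / 2) * p1 x + p2 x\<close>. So \<open>p_cond\<close> says exactly that some
  Fourier coefficient of d(k) is nonzero.\<close>

lemma D_nonzero: assumes "k \<in> T2" shows "0 < n2 (D k)"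
proof (rule ccontr)
  assume "\<not> 0 < n2 (D k)"
  then have "n2 (D k) = 0" using n2_nonneg[of "D k"] by linarith
  then have 0: "nm (D k) = 0" by (simp add: nm_def)
  obtain x where x: "complex_of_real (p2 x) \<noteq> - cis (dotp k x / 2) * complex_of_real (p1 x)"
    using p_cond[OF assms] by blast
  have "dc k x = cis (dotp k x / 2) * (cis (dotp k x / 2) * of_real (p1 x) + of_real (p2 x))"
    by (simp add: dc_def distrib_left mult.assoc[symmetric] cis_mult)
  moreover have "cis (dotp k x / 2) * of_real (p1 x) + complex_of_real (p2 x) \<noteq> 0"
    using x by (metis add.commute eq_neg_iff_add_eq_0 mult_minus_left)
  ultimately have "dc k x \<noteq> 0" by simp
  moreover have "dc k x = ip (ehat x) (D k)" unfolding D_FS by (rule ip_ehat_FS[OF dc_summable, symmetric])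
  ultimately show False using ip_ehat_le[OF inL2_D, of x k] 0 by simp
qed

definition kc :: "(pt \<Rightarrow> complex) \<Rightarrow> site \<Rightarrow> complex" where
  "kc \<phi> x = complex_of_real (u x) * ip (ehat x) \<phi>"

lemma A_eq: "A U k \<phi> = (\<lambda>p. complex_of_real (ffun eps k p) * \<phi> p + FS (kc \<phi>) p
    + (complex_of_real U * ip e0 \<phi>) * e0 p)"
  by (simp add: A11_def FS_def kc_def)

definition uM :: real where "uM = (\<Sum>\<^sub>\<infinity>x. u x)"

lemma assumes "inL2 \<phi>" shows kc_summable: "(\<lambda>x. cmod (kc \<phi> x)) summable_on UNIV"
  and kc_infsum_le: "(\<Sum>\<^sub>\<infinity>x. cmod (kc \<phi> x)) \<le> uM * nm \<phi>"
proof -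
  have le: "cmod (kc \<phi> x) \<le> u x * nm \<phi>" for x
    using ip_ehat_le[OF assms] u_nonneg by (simp add: kc_def norm_mult mult_left_mono)
  have s: "(\<lambda>x. u x * nm \<phi>) summable_on UNIV" using u_sum by (rule summable_on_cmult_left)
  show *: "(\<lambda>x. cmod (kc \<phi> x)) summable_on UNIV"
    by (rule summable_on_comparison_test[OF s]) (auto simp: le)
  have "(\<Sum>\<^sub>\<infinity>x. cmod (kc \<phi> x)) \<le> (\<Sum>\<^sub>\<infinity>x. u x * nm \<phi>)" by (rule infsum_mono[OF * s le])
  then show "(\<Sum>\<^sub>\<infinity>x. cmod (kc \<phi> x)) \<le> uM * nm \<phi>" by (simp add: uM_def infsum_cmult_left')
qed

lemma uM_nonneg: "0 \<le> uM"
  unfolding uM_def by (rule infsum_nonneg) (rule u_nonneg)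

lemma inL2_Kphi: assumes "inL2 \<phi>" shows "inL2 (FS (kc \<phi>))" "nm (FS (kc \<phi>)) \<le> uM * nm \<phi>"
proof -
  show "inL2 (FS (kc \<phi>))" by (rule inL2_FS[OF kc_summable[OF assms]])
  have "n2 (FS (kc \<phi>)) \<le> (\<Sum>\<^sub>\<infinity>x. cmod (kc \<phi> x))\<^sup>2" by (rule n2_FS_le[OF kc_summable[OF assms]])
  also have "\<dots> \<le> (uM * nm \<phi>)\<^sup>2"
    by (intro power_mono kc_infsum_le assms infsum_nonneg) auto
  finally show "nm (FS (kc \<phi>)) \<le> uM * nm \<phi>"
    unfolding nm_def[of "FS (kc \<phi>)"] using uM_nonneg by (intro real_le_lsqrt) auto
qed

lemma ffun_measurable: "(\<lambda>p. complex_of_real (ffun eps k p)) \<in> borel_measurable nu"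
proof -
  have "continuous_on UNIV (\<lambda>p. complex_of_real (ffun eps k p))"
    unfolding ffun_def cos2_def by (intro continuous_intros)
  then show ?thesis by (simp add: borel_measurable_continuous_onI measurable_cong_sets[OF sets_nu refl])
qed

lemma ffun_bound: "cmod (complex_of_real (ffun eps k p)) \<le> 8 * eps"
proof -
  have "\<bar>4 - cos2 (p + k) - cos2 p\<bar> \<le> 8"
    unfolding cos2_def using cos_le_one[of "fst (p+k)"] cos_le_one[of "snd (p+k)"] cos_le_one[of "fst p"] cos_le_one[of "snd p"]
      cos_ge_minus_one[of "fst (p+k)"] cos_ge_minus_one[of "snd (p+k)"] cos_ge_minus_one[of "fst p"] cos_ge_minus_one[of "snd p"]
    by linarith
  then have "eps * \<bar>4 - cos2 (p + k) - cos2 p\<bar> \<le> eps * 8" using eps by (rule mult_left_mono)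
  then show ?thesis unfolding norm_of_real ffun_def using eps by (simp add: abs_mult)
qed

section \<open>The lower bound of the symbol, compared with b\<close>

lemma cos_sum_le: "cos (x + y) + cos x \<le> 2 * \<bar>cos (y / 2)\<bar>" for x y :: real
proof -
  have "cos (x + y) + cos x = 2 * cos (x + y / 2) * cos (y / 2)"
    using cos_plus_cos[of "x + y" x] by (simp add: add_divide_distrib)
  also have "\<dots> \<le> \<bar>2 * cos (x + y / 2) * cos (y / 2)\<bar>" by (rule abs_ge_self)
  also have "\<dots> \<le> 2 * \<bar>cos (y / 2)\<bar>"
    using mult_right_mono[OF abs_cos_le_one[of "x + y / 2"], of "\<bar>cos (y / 2)\<bar>"] by (simp add: abs_mult)
  finally show ?thesis .
qed

lemma m_le_ffun: "m k \<le> ffun eps k p"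
  unfolding m_def ffun_def
  using cos_sum_le[of "fst p" "fst k"] cos_sum_le[of "snd p" "snd k"] eps
  by (intro mult_left_mono) (auto simp: cos2_def)

lemma m_nonneg: "0 \<le> m k"
  unfolding m_def using eps abs_cos_le_one[of "fst k / 2"] abs_cos_le_one[of "snd k / 2"]
  by (intro mult_nonneg_nonneg) linarith+

lemma b_nonneg: "0 \<le> b k"
  unfolding bfun_def cos2_def
  by (intro mult_nonneg_nonneg eps hb) (use cos_le_one[of "fst k"] cos_le_one[of "snd k"] in linarith)+

lemma b_le: "b k \<le> 2 * eps"
proof -
  have "2 - cos2 k \<le> 4" unfolding cos2_def
    using cos_ge_minus_one[of "fst k"] cos_ge_minus_one[of "snd k"] by linarith
  then have "hb * eps * (2 - cos2 k) \<le> hb * eps * 4" using hb eps by (intro mult_left_mono) auto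
  also have "\<dots> \<le> 1/2 * (eps * 4)" using mult_right_mono[OF hb(2), of "eps * 4"] eps by simp
  finally show ?thesis by (simp add: bfun_def)
qed

lemma abs_cos_half_less_one: assumes "x \<in> {-pi..<pi}" "x \<noteq> 0" shows "\<bar>cos (x / 2)\<bar> < 1"
proof -
  have "cos (\<bar>x\<bar> / 2) < cos 0" by (rule cos_monotone_0_pi) (use assms in auto)
  then have "cos (x / 2) < 1" by (cases "x \<ge> 0") auto
  moreover have "0 \<le> cos (x / 2)" by (rule cos_ge_zero) (use assms in auto)
  ultimately show ?thesis by simp
qed

lemma half_one_minus_cos_le: "(1 - cos x) / 2 \<le> 2 - 2 * \<bar>cos (x / 2)\<bar>"
  and half_one_minus_cos_less: "\<bar>cos (x / 2)\<bar> < 1 \<Longrightarrow> (1 - cos x) / 2 < 2 - 2 * \<bar>cos (x / 2)\<bar>" for x :: real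
proof -
  have "cos x = 2 * \<bar>cos (x / 2)\<bar>\<^sup>2 - 1" using cos_double_cos[of "x / 2"] by simp
  then have e: "2 - 2 * \<bar>cos (x / 2)\<bar> - (1 - cos x) / 2 = (1 - \<bar>cos (x / 2)\<bar>)\<^sup>2"
    by (simp add: power2_diff field_simps)
  have "0 \<le> (1 - \<bar>cos (x / 2)\<bar>)\<^sup>2" by simp
  then show "(1 - cos x) / 2 \<le> 2 - 2 * \<bar>cos (x / 2)\<bar>" using e by linarith
  assume "\<bar>cos (x / 2)\<bar> < 1"
  then have "0 < (1 - \<bar>cos (x / 2)\<bar>)\<^sup>2" by (intro zero_less_power) simp
  then show "(1 - cos x) / 2 < 2 - 2 * \<bar>cos (x / 2)\<bar>" using e by linarith
qed

text \<open>A nonzero point of the half-open square has a coordinate x with 0 < |x/2| \<le> pi/2,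
  which makes one of the two coordinatewise inequalities strict.\<close>

lemma b_less_m: assumes "k \<in> T2" "k \<noteq> 0" "0 < eps" shows "b k < m k"
proof -
  have "\<bar>cos (fst k / 2)\<bar> < 1 \<or> \<bar>cos (snd k / 2)\<bar> < 1"
    using assms(1,2) abs_cos_half_less_one[of "fst k"] abs_cos_half_less_one[of "snd k"]
    by (auto simp: T2_def prod_eq_iff)
  then have "(1 - cos (fst k)) / 2 + (1 - cos (snd k)) / 2 < (2 - 2 * \<bar>cos (fst k / 2)\<bar>) + (2 - 2 * \<bar>cos (snd k / 2)\<bar>)"
    using half_one_minus_cos_le[of "fst k"] half_one_minus_cos_le[of "snd k"]
      half_one_minus_cos_less[of "fst k"] half_one_minus_cos_less[of "snd k"] by linarith
  then have 1: "eps * ((2 - cos2 k) / 2) < m k"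
    unfolding m_def using assms(3) by (intro mult_strict_left_mono) (auto simp: cos2_def field_simps)
  have "0 \<le> 2 - cos2 k" unfolding cos2_def using cos_le_one[of "fst k"] cos_le_one[of "snd k"] by linarith
  then have "hb * (eps * (2 - cos2 k)) \<le> 1/2 * (eps * (2 - cos2 k))"
    using hb assms(3) by (intro mult_right_mono) auto
  with 1 show ?thesis by (simp add: bfun_def)
qed

lemma b_eps0: "eps = 0 \<Longrightarrow> b k = 0" and m_eps0: "eps = 0 \<Longrightarrow> m k = 0"
  unfolding bfun_def m_def by simp_all

section \<open>Boundedness, symmetry and lower bound of A_{1,1}\<close>

definition MA :: "real \<Rightarrow> real" where "MA U = 8 * eps + uM + U"

context
  fixes U :: real and k :: pt
  assumes U: "0 \<le> U"
begin

lemma ffun_mult: assumes "inL2 \<phi>"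
  shows "inL2 (\<lambda>p. complex_of_real (ffun eps k p) * \<phi> p)"
    "nm (\<lambda>p. complex_of_real (ffun eps k p) * \<phi> p) \<le> 8 * eps * nm \<phi>"
proof -
  show "inL2 (\<lambda>p. complex_of_real (ffun eps k p) * \<phi> p)"
    by (rule inL2_bounded_mult(1)[OF ffun_measurable ffun_bound assms])
  have "n2 (\<lambda>p. complex_of_real (ffun eps k p) * \<phi> p) \<le> (8 * eps * nm \<phi>)\<^sup>2"
    using inL2_bounded_mult(2)[OF ffun_measurable ffun_bound assms, of k] by (simp add: power_mult_distrib)
  then show "nm (\<lambda>p. complex_of_real (ffun eps k p) * \<phi> p) \<le> 8 * eps * nm \<phi>"
    unfolding nm_def[of "\<lambda>p. complex_of_real (ffun eps k p) * \<phi> p"] using eps by (intro real_le_lsqrt) auto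
qed

lemma bdop_A: "bdop (A U k) (MA U)"
  unfolding bdop_def
proof (intro conjI allI impI)
  show "0 \<le> MA U" using eps uM_nonneg U by (simp add: MA_def)
next
  fix \<phi> assume \<phi>: "inL2 \<phi>"
  note L = ffun_mult(1)[OF \<phi>] inL2_Kphi(1)[OF \<phi>] inL2_scale[OF inL2_ehat, of "complex_of_real U * ip e0 \<phi>" "(0,0)"]
  show "inL2 (A U k \<phi>)" unfolding A_eq by (intro inL2_add L)
  have "nm (A U k \<phi>) \<le> (nm (\<lambda>p. complex_of_real (ffun eps k p) * \<phi> p) + nm (FS (kc \<phi>)))
      + nm (\<lambda>p. (complex_of_real U * ip e0 \<phi>) * e0 p)"
    unfolding A_eq by (rule order_trans[OF nm_triangle add_right_mono[OF nm_triangle]]) (intro inL2_add L)+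
  moreover have "nm (\<lambda>p. (complex_of_real U * ip e0 \<phi>) * e0 p) \<le> U * nm \<phi>"
    unfolding nm_scale using U ip_ehat_le[OF \<phi>] by (simp add: norm_mult mult_left_mono)
  ultimately show "nm (A U k \<phi>) \<le> MA U * nm \<phi>"
    using ffun_mult(2)[OF \<phi>] inL2_Kphi(2)[OF \<phi>] by (simp add: MA_def algebra_simps)
next
  fix \<phi> \<psi> c assume \<phi>: "inL2 \<phi>" and \<psi>: "inL2 \<psi>"
  have ip: "ip (ehat x) (\<lambda>p. \<phi> p + c * \<psi> p) = ip (ehat x) \<phi> + c * ip (ehat x) \<psi>" for x
    by (simp add: ip_add_right ip_scale_right \<phi> \<psi> inL2_scale)
  have "FS (kc (\<lambda>p. \<phi> p + c * \<psi> p)) p = FS (kc \<phi>) p + c * FS (kc \<psi>) p" for p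
  proof -
    have s: "(\<lambda>x. kc \<phi> x * ehat x p) summable_on UNIV" if "inL2 \<phi>" for \<phi>
      by (rule abs_summable_summable[OF FS_abs_summable[OF kc_summable[OF that]]])
    have "FS (kc (\<lambda>p. \<phi> p + c * \<psi> p)) p = (\<Sum>\<^sub>\<infinity>x. kc \<phi> x * ehat x p + c * (kc \<psi> x * ehat x p))"
      unfolding FS_def kc_def ip by (rule infsum_cong) (simp add: algebra_simps)
    also have "\<dots> = (\<Sum>\<^sub>\<infinity>x. kc \<phi> x * ehat x p) + (\<Sum>\<^sub>\<infinity>x. c * (kc \<psi> x * ehat x p))"
      by (rule infsum_add[OF s[OF \<phi>] summable_on_cmult_right[OF s[OF \<psi>]]])
    also have "\<dots> = FS (kc \<phi>) p + c * FS (kc \<psi>) p" by (simp add: FS_def infsum_cmult_right')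
    finally show ?thesis .
  qed
  then show "A U k (\<lambda>p. \<phi> p + c * \<psi> p) = (\<lambda>p. A U k \<phi> p + c * A U k \<psi> p)"
    unfolding A_eq ip by (simp add: fun_eq_iff algebra_simps)
qed

lemma inL2_A: "inL2 \<phi> \<Longrightarrow> inL2 (A U k \<phi>)"
  by (rule bdop_inL2[OF bdop_A])

lemma ip_A: assumes "inL2 \<phi>" "inL2 \<psi>"
  shows "ip \<psi> (A U k \<phi>) = ip \<psi> (\<lambda>p. complex_of_real (ffun eps k p) * \<phi> p)
     + (\<Sum>\<^sub>\<infinity>x. complex_of_real (u x) * ip (ehat x) \<phi> * cnj (ip (ehat x) \<psi>))
     + complex_of_real U * ip e0 \<phi> * cnj (ip e0 \<psi>)"
proof -
  note L = ffun_mult(1)[OF assms(1)] inL2_Kphi(1)[OF assms(1)] inL2_scale[OF inL2_ehat, of "complex_of_real U * ip e0 \<phi>" "(0,0)"]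
  have c: "ip \<psi> (ehat x) = cnj (ip (ehat x) \<psi>)" for x by (rule ip_cnj)
  have "ip \<psi> (A U k \<phi>) = ip \<psi> (\<lambda>p. complex_of_real (ffun eps k p) * \<phi> p) + ip \<psi> (FS (kc \<phi>))
      + ip \<psi> (\<lambda>p. (complex_of_real U * ip e0 \<phi>) * e0 p)"
    unfolding A_eq by (simp add: ip_add_right L inL2_add assms)
  then show ?thesis
    unfolding ip_FS[OF kc_summable[OF assms(1)] assms(2)] ip_scale_right kc_def c .
qed

lemma A_symmetric: assumes "inL2 \<phi>" "inL2 \<psi>"
  shows "ip \<psi> (A U k \<phi>) = cnj (ip \<phi> (A U k \<psi>))"
proof -
  have 1: "ip \<psi> (\<lambda>p. complex_of_real (ffun eps k p) * \<phi> p) = cnj (ip \<phi> (\<lambda>p. complex_of_real (ffun eps k p) * \<psi> p))"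
    by (subst ip_cnj) (simp add: ip_def mult_ac)
  have 2: "(\<Sum>\<^sub>\<infinity>x. complex_of_real (u x) * ip (ehat x) \<phi> * cnj (ip (ehat x) \<psi>))
      = cnj (\<Sum>\<^sub>\<infinity>x. complex_of_real (u x) * ip (ehat x) \<psi> * cnj (ip (ehat x) \<phi>))"
    by (subst infsum_cnj[symmetric]) (simp add: mult_ac)
  show ?thesis unfolding ip_A[OF assms] ip_A[OF assms(2,1)] 1 2 by (simp add: mult_ac)
qed

text \<open>The terms from \<open>u\<close> and \<open>U\<close> contribute non-negative multiples
  of squared Fourier coefficients, so only multiplication by the symbol has to be bounded from
  below.\<close>

lemma A_form_ge: assumes "inL2 \<phi>" shows "m k * n2 \<phi> \<le> Re (ip \<phi> (A U k \<phi>))"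
proof -
  have sq: "complex_of_real r * z * cnj z = complex_of_real (r * (cmod z)\<^sup>2)" for r z
    by (simp add: complex_norm_square mult.assoc del: of_real_power)
  have i: "integrable nu (\<lambda>p. ffun eps k p * (cmod (\<phi> p))\<^sup>2)"
  proof -
    have "integrable nu (\<lambda>p. complex_of_real (ffun eps k p * (cmod (\<phi> p))\<^sup>2))"
      using ip_integrable[OF assms ffun_mult(1)[OF assms]]
      by (rule back_subst[where P="integrable nu"]) (auto simp: fun_eq_iff complex_norm_square mult_ac simp del: of_real_power)
    then show ?thesis by (simp only: complex_of_real_integrable_eq)
  qed
  have "ip \<phi> (\<lambda>p. complex_of_real (ffun eps k p) * \<phi> p) = (\<integral>p. complex_of_real (ffun eps k p * (cmod (\<phi> p))\<^sup>2) \<partial>nu)"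
    unfolding ip_def by (rule Bochner_Integration.integral_cong) (auto simp: complex_norm_square mult_ac simp del: of_real_power)
  then have "Re (ip \<phi> (\<lambda>p. complex_of_real (ffun eps k p) * \<phi> p)) = (\<integral>p. ffun eps k p * (cmod (\<phi> p))\<^sup>2 \<partial>nu)"
    by (simp only: integral_complex_of_real Re_complex_of_real)
  also have "\<dots> \<ge> (\<integral>p. m k * (cmod (\<phi> p))\<^sup>2 \<partial>nu)"
    by (rule integral_mono[OF _ i]) (use assms m_le_ffun in \<open>auto simp: inL2_iff mult_right_mono\<close>)
  finally have 1: "m k * n2 \<phi> \<le> Re (ip \<phi> (\<lambda>p. complex_of_real (ffun eps k p) * \<phi> p))" by (simp add: n2_def)
  have "(\<Sum>\<^sub>\<infinity>x. complex_of_real (u x) * ip (ehat x) \<phi> * cnj (ip (ehat x) \<phi>)) = complex_of_real (\<Sum>\<^sub>\<infinity>x. u x * (cmod (ip (ehat x) \<phi>))\<^sup>2)"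
  proof -
    have "(\<lambda>x. u x * (cmod (ip (ehat x) \<phi>))\<^sup>2) summable_on UNIV"
    proof (rule summable_on_comparison_test)
      show "(\<lambda>x. u x * n2 \<phi>) summable_on UNIV" using u_sum by (rule summable_on_cmult_left)
      show "u x * (cmod (ip (ehat x) \<phi>))\<^sup>2 \<le> u x * n2 \<phi>" for x
        unfolding nm_square[symmetric] by (intro mult_left_mono power_mono ip_ehat_le assms u_nonneg) auto
    qed (simp add: u_nonneg)
    then show ?thesis unfolding sq by (intro infsumI has_sum_of_real has_sum_infsum)
  qed
  moreover have "0 \<le> (\<Sum>\<^sub>\<infinity>x. u x * (cmod (ip (ehat x) \<phi>))\<^sup>2)"
    by (rule infsum_nonneg) (simp add: u_nonneg)
  moreover have "complex_of_real U * ip e0 \<phi> * cnj (ip e0 \<phi>) = complex_of_real (U * (cmod (ip e0 \<phi>))\<^sup>2)" by (rule sq)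
  moreover have "0 \<le> U * (cmod (ip e0 \<phi>))\<^sup>2" using U by simp
  ultimately show ?thesis unfolding ip_A[OF assms assms] using 1
    by (simp only: plus_complex.sel Re_complex_of_real)
qed

lemma A_form_le: assumes "inL2 \<phi>" shows "Re (ip \<phi> (A U k \<phi>)) \<le> MA U * n2 \<phi>"
proof -
  have "Re (ip \<phi> (A U k \<phi>)) \<le> nm \<phi> * nm (A U k \<phi>)"
    using ip_cauchy_schwarz[OF assms inL2_A[OF assms]] complex_Re_le_cmod order_trans by blast
  also have "\<dots> \<le> nm \<phi> * (MA U * nm \<phi>)" by (intro mult_left_mono bdop_nm[OF bdop_A] assms) simp
  finally show ?thesis by (simp add: mult_ac power2_eq_square flip: nm_square)
qed

end

text \<open>U enters through a rank-one projection only. Hence energies increase with U, and a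
  function orthogonal to \<open>e0\<close> has an energy independent of U.\<close>

lemma A_change_U:
  assumes "0 \<le> U" "0 \<le> U'" "inL2 \<phi>"
  shows "Re (ip \<phi> (A U' k \<phi>)) = Re (ip \<phi> (A U k \<phi>)) + (U' - U) * (cmod (ip e0 \<phi>))\<^sup>2"
proof -
  have sq: "z * cnj z = complex_of_real ((cmod z)\<^sup>2)" for z
    by (simp add: complex_norm_square del: of_real_power)
  show ?thesis unfolding ip_A[OF assms(1,3,3)] ip_A[OF assms(2,3,3)] mult.assoc sq
    by (simp add: algebra_simps del: of_real_power)
qed

text \<open>Each projection other than the one at the origin annihilates the constant function. This
  makes the eigenvector of the fibre explicit when d(k) is a multiple of \<open>e0\<close>.\<close>

lemma A_e0: assumes "eps = 0" shows "A U k e0 = (\<lambda>p. complex_of_real (u (0,0) + U) * e0 p)"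
proof -
  have "FS (kc e0) p = complex_of_real (u (0,0)) * e0 p" for p
  proof -
    have "FS (kc e0) p = (\<Sum>\<^sub>\<infinity>x\<in>{(0,0)::site}. complex_of_real (u (0,0)) * e0 p)"
      unfolding FS_def by (rule infsum_cong_neutral) (auto simp: kc_def ip_ehat)
    then show ?thesis by simp
  qed
  then show ?thesis unfolding A_eq using assms by (simp add: fun_eq_iff ffun_def ip_ehat algebra_simps)
qed

end

section \<open>The ground state of a fibre\<close>

definition hip :: "hv \<Rightarrow> hv \<Rightarrow> complex" where
  "hip a c = ip (fst a) (fst c) + cnj (snd a) * snd c"

definition hq :: "hv \<Rightarrow> real" where
  "hq a = n2 (fst a) + (cmod (snd a))\<^sup>2"

lemma hq_nonneg [simp]: "0 \<le> hq a"
  by (simp add: hq_def)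

lemma hn2_eq: "inH a \<Longrightarrow> hn2 a = ennreal (hq a)"
  by (simp add: hn2_def hq_def l2n2_eq inH_def ennreal_plus)

lemma hnorm_eq: "inH a \<Longrightarrow> hnorm a = sqrt (hq a)"
  by (simp add: hnorm_def hn2_eq)

lemma inH_hminus: "inH a \<Longrightarrow> inH c \<Longrightarrow> inH (hminus a c)"
  by (simp add: inH_def hminus_def inL2_minus)

lemma inH_hscal: "inH a \<Longrightarrow> inH (hscal c a)"
  by (simp add: inH_def hscal_def inL2_scale)

lemma inH_hzero [simp]: "inH hzero"
  by (simp add: inH_def hzero_def)

text \<open>On \<open>inH\<close> vectors this is \<open>heq\<close>, but it needs no integrability
  and passes through the operations by almost-everywhere reasoning.\<close>

definition aeq :: "hv \<Rightarrow> hv \<Rightarrow> bool" where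
  "aeq a c \<longleftrightarrow> (AE p in nu. fst a p = fst c p) \<and> snd a = snd c"

lemma aeq_refl [simp]: "aeq a a" by (simp add: aeq_def)

lemma aeq_sym: "aeq a c \<Longrightarrow> aeq c a"
  by (auto simp: aeq_def elim: AE_mp)

lemma aeq_trans: "aeq a c \<Longrightarrow> aeq c d \<Longrightarrow> aeq a d"
  unfolding aeq_def by (auto elim: AE_mp)

lemma aeq_hminus: "aeq a a' \<Longrightarrow> aeq c c' \<Longrightarrow> aeq (hminus a c) (hminus a' c')"
  unfolding aeq_def hminus_def by (auto elim: AE_mp)

lemma aeq_hscal: "aeq a a' \<Longrightarrow> aeq (hscal z a) (hscal z a')"
  unfolding aeq_def hscal_def by (auto elim: AE_mp)

lemma hn2_cong: "aeq a c \<Longrightarrow> hn2 a = hn2 c"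
  unfolding aeq_def hn2_def l2n2_def by (auto intro!: arg_cong2[where f="(+)"] nn_integral_cong_AE elim: AE_mp)

lemma hq_cong: "aeq a c \<Longrightarrow> inH a \<Longrightarrow> inH c \<Longrightarrow> hq a = hq c"
  unfolding aeq_def hq_def inH_def by (auto intro: n2_cong_AE)

lemma hq_eq_0: assumes "inH a" shows "hq a = 0 \<longleftrightarrow> aeq a hzero"
proof -
  have "hq a = 0 \<longleftrightarrow> n2 (fst a) = 0 \<and> snd a = 0"
    unfolding hq_def by (auto simp: add_nonneg_eq_0_iff)
  then show ?thesis using n2_zero_iff_AE[of "fst a"] assms by (simp add: inH_def aeq_def hzero_def)
qed

lemma heq_iff_aeq: assumes "inH a" "inH c" shows "heq a c \<longleftrightarrow> aeq a c"
proof -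
  have "heq a c \<longleftrightarrow> hq (hminus a c) = 0"
    unfolding heq_def hn2_eq[OF inH_hminus[OF assms]] by simp
  also have "\<dots> \<longleftrightarrow> aeq (hminus a c) hzero" by (rule hq_eq_0[OF inH_hminus[OF assms]])
  also have "\<dots> \<longleftrightarrow> aeq a c" by (simp add: aeq_def hminus_def hzero_def)
  finally show ?thesis .
qed

lemma hip_cauchy_schwarz: assumes "inH a" "inH c" shows "cmod (hip a c) \<le> sqrt (hq a) * sqrt (hq c)"
proof -
  have "cmod (hip a c) \<le> cmod (ip (fst a) (fst c)) + cmod (cnj (snd a) * snd c)"
    unfolding hip_def by (rule norm_triangle_ineq)
  also have "\<dots> \<le> nm (fst a) * nm (fst c) + cmod (snd a) * cmod (snd c)"
    using ip_cauchy_schwarz[of "fst a" "fst c"] assms by (simp add: inH_def norm_mult)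
  also have "\<dots> \<le> sqrt (hq a * hq c)"
  proof (rule real_le_rsqrt)
    have "0 \<le> (nm (fst a) * cmod (snd c) - cmod (snd a) * nm (fst c))\<^sup>2" by simp
    then show "(nm (fst a) * nm (fst c) + cmod (snd a) * cmod (snd c))\<^sup>2 \<le> hq a * hq c"
      unfolding hq_def nm_square[symmetric] by (simp add: power2_eq_square algebra_simps)
  qed
  finally show ?thesis by (simp add: real_sqrt_mult)
qed

lemma hip_hminus_right: "inH a \<Longrightarrow> inH c \<Longrightarrow> inH d \<Longrightarrow> hip a (hminus c d) = hip a c - hip a d"
  by (simp add: hip_def hminus_def ip_minus_right inH_def algebra_simps)

lemma hip_hscal_right: "hip a (hscal z c) = z * hip a c"
  by (simp add: hip_def hscal_def ip_scale_right algebra_simps)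

lemma hip_self: "hip a a = complex_of_real (hq a)"
  by (simp add: hip_def hq_def ip_self complex_norm_square mult.commute del: of_real_power)

lemma hip_cong: "aeq c d \<Longrightarrow> inH a \<Longrightarrow> inH c \<Longrightarrow> inH d \<Longrightarrow> hip a c = hip a d"
  unfolding hip_def aeq_def inH_def by (auto intro: ip_cong_AE)

text \<open>Coercivity bounds \<psi> by (T - lam) \<psi>, which gives injectivity modulo null sets.
  The inverse is a choice of preimages, and injectivity makes this choice respect
  \<open>heq\<close>.\<close>

lemma resolvent_setI:
  assumes TH: "\<And>\<psi>. inH \<psi> \<Longrightarrow> inH (T \<psi>)"
    and lin: "\<And>a c. inH a \<Longrightarrow> inH c \<Longrightarrow> T (hminus a c) = hminus (T a) (T c)"
    and coerc: "0 < \<delta>" "\<And>\<psi>. inH \<psi> \<Longrightarrow> \<delta> * hq \<psi> \<le> Re (hip \<psi> (hminus (T \<psi>) (hscal lam \<psi>)))"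
    and surj: "\<And>\<eta>. inH \<eta> \<Longrightarrow> \<exists>\<psi>. inH \<psi> \<and> aeq (hminus (T \<psi>) (hscal lam \<psi>)) \<eta>"
  shows "lam \<in> resolvent_set T"
proof -
  define S where "S \<psi> = hminus (T \<psi>) (hscal lam \<psi>)" for \<psi>
  have SH: "inH (S \<psi>)" if "inH \<psi>" for \<psi> unfolding S_def by (intro inH_hminus TH inH_hscal that)
  have S_lin: "S (hminus a c) = hminus (S a) (S c)" if "inH a" "inH c" for a c
    unfolding S_def lin[OF that] by (auto simp: hminus_def hscal_def algebra_simps)
  have bd: "\<delta> * sqrt (hq \<psi>) \<le> sqrt (hq (S \<psi>))" if "inH \<psi>" for \<psi>
  proof (cases "hq \<psi> = 0")
    case False
    have "\<delta> * sqrt (hq \<psi>) * sqrt (hq \<psi>) = \<delta> * hq \<psi>" by simp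
    also have "\<dots> \<le> cmod (hip \<psi> (S \<psi>))"
      using coerc(2)[OF that] complex_Re_le_cmod[of "hip \<psi> (S \<psi>)"] by (simp add: S_def)
    also have "\<dots> \<le> sqrt (hq (S \<psi>)) * sqrt (hq \<psi>)"
      using hip_cauchy_schwarz[OF that SH[OF that]] by (simp add: mult.commute)
    finally show ?thesis using False by (simp add: mult_le_cancel_right order_less_le)
  qed simp
  have inj: "aeq a c" if "inH a" "inH c" "aeq (S a) (S c)" for a c
  proof -
    have "aeq (S (hminus a c)) hzero"
      unfolding S_lin[OF that(1,2)] using that(3) by (simp add: aeq_def hminus_def hzero_def)
    then have "hq (S (hminus a c)) = 0" using hq_eq_0[OF SH[OF inH_hminus[OF that(1,2)]]] by simp
    then have "\<delta> * sqrt (hq (hminus a c)) \<le> 0" using bd[OF inH_hminus[OF that(1,2)]] by simp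
    then have "sqrt (hq (hminus a c)) \<le> 0" using coerc(1) by (simp add: mult_le_0_iff)
    then have "hq (hminus a c) = 0" using hq_nonneg[of "hminus a c"] by simp
    then have "heq a c" unfolding heq_def hn2_eq[OF inH_hminus[OF that(1,2)]] by simp
    then show ?thesis using heq_iff_aeq[OF that(1,2)] by simp
  qed
  define R where "R \<eta> = (SOME \<psi>. inH \<psi> \<and> aeq (S \<psi>) \<eta>)" for \<eta>
  have R: "inH (R \<eta>)" "aeq (S (R \<eta>)) \<eta>" if "inH \<eta>" for \<eta>
    using someI_ex[OF surj[OF that]] unfolding R_def S_def by auto
  have "inH (R \<psi>) \<and> hnorm (R \<psi>) \<le> (1 / \<delta>) * hnorm \<psi>" if "inH \<psi>" for \<psi>
  proof -
    have "\<delta> * sqrt (hq (R \<psi>)) \<le> sqrt (hq \<psi>)"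
      using bd[OF R(1)[OF that]] hq_cong[OF R(2)[OF that] SH[OF R(1)[OF that]] that] by simp
    then show ?thesis using R(1)[OF that] coerc(1) that by (simp add: hnorm_eq field_simps)
  qed
  moreover have "heq (R \<psi>) (R \<phi>)" if "inH \<psi> \<and> inH \<phi> \<and> heq \<psi> \<phi>" for \<psi> \<phi>
  proof -
    have "aeq \<psi> \<phi>" using that heq_iff_aeq by blast
    then have "aeq (S (R \<psi>)) (S (R \<phi>))" using R that by (meson aeq_sym aeq_trans)
    then show ?thesis using inj R that by (simp add: heq_iff_aeq)
  qed
  moreover have "heq (R (S \<psi>)) \<psi> \<and> heq (S (R \<psi>)) \<psi>" if "inH \<psi>" for \<psi>
    using inj R SH that by (simp add: heq_iff_aeq)
  ultimately show ?thesis unfolding resolvent_set_def S_def by blast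
qed

text \<open>A resolvent would send (T - lam) \<Psi>, which vanishes almost everywhere, both to
  \<Psi> and, by its norm bound, to 0.\<close>

lemma eigenvalue_in_spectrum:
  assumes "inH \<Psi>" "inH (T \<Psi>)" "0 < hq \<Psi>" "aeq (T \<Psi>) (hscal lam \<Psi>)"
  shows "lam \<in> spectrum T"
proof -
  have False if lam: "lam \<in> resolvent_set T"
  proof -
    let ?S = "hminus (T \<Psi>) (hscal lam \<Psi>)"
    obtain R C where R: "\<And>\<psi>. inH \<psi> \<Longrightarrow> inH (R \<psi>) \<and> hnorm (R \<psi>) \<le> C * hnorm \<psi>"
      "\<And>\<psi> \<phi>. inH \<psi> \<Longrightarrow> inH \<phi> \<Longrightarrow> heq \<psi> \<phi> \<Longrightarrow> heq (R \<psi>) (R \<phi>)"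
      "\<And>\<psi>. inH \<psi> \<Longrightarrow> heq (R (hminus (T \<psi>) (hscal lam \<psi>))) \<psi>"
      using lam unfolding resolvent_set_def by blast
    have SH: "inH ?S" by (intro inH_hminus assms inH_hscal)
    have "aeq ?S hzero" using assms(4) by (simp add: aeq_def hminus_def hzero_def)
    then have "heq (R ?S) (R hzero)" using R(2)[OF SH inH_hzero] SH by (simp add: heq_iff_aeq)
    then have 1: "aeq (R ?S) (R hzero)" using R(1) SH by (simp add: heq_iff_aeq)
    have 2: "aeq (R ?S) \<Psi>" using R(3)[OF assms(1)] R(1) SH assms(1) by (simp add: heq_iff_aeq)
    have "hnorm (R hzero) \<le> C * hnorm hzero" using R(1)[OF inH_hzero] by blast
    moreover have "hnorm hzero = 0" unfolding hnorm_eq[OF inH_hzero] by (simp add: hq_def hzero_def)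
    ultimately have "sqrt (hq (R hzero)) \<le> 0" using R(1)[OF inH_hzero] hnorm_eq[of "R hzero"] by simp
    moreover have "hq \<Psi> = hq (R hzero)"
      by (rule hq_cong[OF aeq_trans[OF aeq_sym[OF 2] 1]]) (use assms R(1) in auto)
    ultimately show False using assms(3) by simp
  qed
  then show ?thesis unfolding spectrum_def by blast
qed

section \<open>Block elimination and the eigenvector of the fibre operator\<close>

context model
begin

text \<open>The shift is complex because every complex number with small real part has to be
  excluded from the spectrum.\<close>

definition Ash :: "real \<Rightarrow> pt \<Rightarrow> complex \<Rightarrow> (pt \<Rightarrow> complex) \<Rightarrow> pt \<Rightarrow> complex" where
  "Ash U k l \<phi> = (\<lambda>p. A U k \<phi> p - l * \<phi> p)"

definition evec :: "pt \<Rightarrow> (pt \<Rightarrow> complex) \<Rightarrow> hv" where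
  "evec k \<xi> = ((\<lambda>p. complex_of_real (V k) * \<xi> p), -1)"

lemma inH_evec: "inL2 \<xi> \<Longrightarrow> inH (evec k \<xi>)"
  by (simp add: inH_def evec_def inL2_scale)

lemma hq_evec: "hq (evec k \<xi>) = (V k)\<^sup>2 * n2 \<xi> + 1"
  by (simp add: hq_def evec_def n2_scale)

context
  fixes U :: real and k :: pt
  assumes U: "0 \<le> U"
begin

lemma bdop_Ash: "bdop (Ash U k l) (MA U + cmod l)"
  unfolding bdop_def
proof (intro conjI allI impI)
  show "0 \<le> MA U + cmod l" using bdop_A[OF U, of k] by (simp add: bdop_def)
next
  fix \<phi> assume \<phi>: "inL2 \<phi>"
  note L = inL2_A[OF U \<phi>, of k] inL2_scale[OF \<phi>, of l]
  show "inL2 (Ash U k l \<phi>)" unfolding Ash_def by (intro inL2_minus L)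
  have "nm (Ash U k l \<phi>) \<le> nm (A U k \<phi>) + cmod l * nm \<phi>"
    unfolding Ash_def using nm_triangle_minus[OF L] by (simp add: nm_scale)
  then show "nm (Ash U k l \<phi>) \<le> (MA U + cmod l) * nm \<phi>"
    using bdop_nm[OF bdop_A[OF U, of k] \<phi>] by (simp add: distrib_right)
next
  fix \<phi> \<psi> c assume "inL2 \<phi>" "inL2 \<psi>"
  from bdop_linear[OF bdop_A[OF U, of k] this]
  show "Ash U k l (\<lambda>p. \<phi> p + c * \<psi> p) = (\<lambda>p. Ash U k l \<phi> p + c * Ash U k l \<psi> p)"
    by (simp add: Ash_def fun_eq_iff algebra_simps)
qed

lemmas inL2_Ash = bdop_inL2[OF bdop_Ash]

lemma ip_Ash: "inL2 \<phi> \<Longrightarrow> inL2 \<psi> \<Longrightarrow> ip \<psi> (Ash U k l \<phi>) = ip \<psi> (A U k \<phi>) - l * ip \<psi> \<phi>"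
  unfolding Ash_def by (simp add: ip_minus_right inL2_A[OF U] inL2_scale ip_scale_right)

lemma Ash_coercive: "inL2 \<phi> \<Longrightarrow> (m k - Re l) * n2 \<phi> \<le> Re (ip \<phi> (Ash U k l \<phi>))"
  using A_form_ge[OF U, of \<phi> k] by (simp add: ip_Ash ip_self algebra_simps)

lemma Ash_symmetric:
  "inL2 \<phi> \<Longrightarrow> inL2 \<psi> \<Longrightarrow> ip \<psi> (Ash U k (complex_of_real q) \<phi>) = cnj (ip \<phi> (Ash U k (complex_of_real q) \<psi>))"
  using A_symmetric[OF U, of \<phi> \<psi> k] ip_cnj[of \<psi> \<phi>] by (simp add: ip_Ash)

text \<open>The step size \<delta>/M^2 of \<open>neumann_solves\<close>, with coercivity constant m
  - Re l and the norm bound of \<open>bdop_Ash\<close>. Being a formula, it is measurable in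
  k.\<close>

definition NT :: "complex \<Rightarrow> real" where
  "NT l = (m k - Re l) / (MA U + cmod l)\<^sup>2"

definition X :: "complex \<Rightarrow> (pt \<Rightarrow> complex) \<Rightarrow> pt \<Rightarrow> complex" where
  "X l f = nsol (Ash U k l) (NT l) f"

lemma X_solves:
  assumes "Re l < m k" "inL2 f"
  shows "inL2 (X l f)" "AE p in nu. Ash U k l (X l f) p = f p"
proof -
  \<comment> \<open>Testing the lower and upper form bounds on one character compares the two
    constants, as \<delta> \<le> M requires.\<close>
  have "m k \<le> MA U" using order_trans[OF A_form_ge[OF U inL2_ehat] A_form_le[OF U inL2_ehat], of k "(0,0)"] by simp
  then have le: "m k - Re l \<le> MA U + cmod l" using abs_Re_le_cmod[of l] by linarith
  show "inL2 (X l f)" "AE p in nu. Ash U k l (X l f) p = f p"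
    unfolding X_def NT_def
    using neumann_solves[OF bdop_Ash _ le Ash_coercive assms(2)] assms(1) by auto
qed

lemma AA_eq: "AA U k \<psi> = ((\<lambda>p. A U k (fst \<psi>) p + (complex_of_real (V k) * snd \<psi>) * D k p),
   complex_of_real (V k) * ip (D k) (fst \<psi>) + complex_of_real (b k) * snd \<psi>)"
  by (simp add: Aop_def fhat_ups)

lemma inH_AA: "inH \<psi> \<Longrightarrow> inH (AA U k \<psi>)"
  unfolding AA_eq inH_def by (auto intro!: inL2_add inL2_A[OF U] inL2_scale inL2_D)

lemma AA_hminus: "inH a \<Longrightarrow> inH c \<Longrightarrow> AA U k (hminus a c) = hminus (AA U k a) (AA U k c)"
  unfolding AA_eq hminus_def inH_def
  by (simp add: bdop_minus[OF bdop_A[OF U]] ip_minus_right inL2_D algebra_simps)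

lemma AA_hscal: "inH a \<Longrightarrow> AA U k (hscal c a) = hscal c (AA U k a)"
  unfolding AA_eq hscal_def inH_def
  by (simp add: bdop_scale[OF bdop_A[OF U]] ip_scale_right algebra_simps)

lemma AA_cong: assumes "aeq a c" "inH a" "inH c" shows "aeq (AA U k a) (AA U k c)"
proof -
  have ip: "ip d (fst a) = ip d (fst c)" if "inL2 d" for d
    using assms that by (intro ip_cong_AE) (auto simp: aeq_def inH_def)
  have "kc (fst a) = kc (fst c)" by (simp add: kc_def fun_eq_iff ip)
  then have e: "fst (AA U k a) p = fst (AA U k c) p" if "fst a p = fst c p" for p
    using assms(1) that unfolding AA_eq A_eq by (simp add: ip aeq_def)
  have ae: "AE p in nu. fst a p = fst c p" and s: "snd a = snd c" using assms(1) by (simp_all add: aeq_def)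
  have "AE p in nu. fst (AA U k a) p = fst (AA U k c) p"
    using ae by eventually_elim (rule e)
  moreover have "snd (AA U k a) = snd (AA U k c)" unfolding AA_eq by (simp add: ip inL2_D s)
  ultimately show ?thesis by (simp add: aeq_def)
qed

lemma AA_form:
  assumes "inL2 \<phi>"
  shows "Re (hip (\<phi>, z) (AA U k (\<phi>, z))) = Re (ip \<phi> (A U k \<phi>)) + 2 * V k * Re (z * ip \<phi> (D k)) + b k * (cmod z)\<^sup>2"
proof -
  have c: "ip (D k) \<phi> = cnj (ip \<phi> (D k))" by (rule ip_cnj)
  have zz: "cnj z * (complex_of_real (b k) * z) = complex_of_real (b k * (cmod z)\<^sup>2)"
    by (simp add: complex_norm_square mult_ac del: of_real_power)
  have "hip (\<phi>, z) (AA U k (\<phi>, z)) = ip \<phi> (A U k \<phi>)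
      + complex_of_real (V k) * (z * ip \<phi> (D k)) + complex_of_real (V k) * cnj (z * ip \<phi> (D k))
      + complex_of_real (b k * (cmod z)\<^sup>2)"
    unfolding AA_eq hip_def fst_conv snd_conv distrib_left zz
    by (simp add: ip_add_right ip_scale_right inL2_scale inL2_A[OF U] inL2_D assms c mult_ac)
  then show ?thesis by (simp del: of_real_power)
qed

text \<open>Stated for any solution \<xi> instead of \<open>X\<close>, and without q < m, so that it
  also covers the degenerate eigenvalue e = m. The cross terms match by symmetry of A_{1,1}; for V k
  = 0 the vector \<xi> drops out.\<close>

lemma form_square:
  assumes \<phi>: "inL2 \<phi>" and \<xi>: "inL2 \<xi>" and sol: "V k \<noteq> 0 \<Longrightarrow> AE p in nu. Ash U k (complex_of_real q) \<xi> p = D k p"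
  shows "Re (hip (\<phi>, z) (AA U k (\<phi>, z))) - q * hq (\<phi>, z)
    = Re (ip (\<lambda>p. \<phi> p + (complex_of_real (V k) * z) * \<xi> p) (Ash U k (complex_of_real q) (\<lambda>p. \<phi> p + (complex_of_real (V k) * z) * \<xi> p)))
      - (q - b k + (V k)\<^sup>2 * Re (ip \<xi> (D k))) * (cmod z)\<^sup>2"
proof -
  let ?w = "complex_of_real (V k) * z" and ?B = "Ash U k (complex_of_real q)"
  have F: "Re (ip \<phi> (?B \<phi>)) = Re (ip \<phi> (A U k \<phi>)) - q * n2 \<phi>"
    by (simp add: ip_Ash \<phi> ip_self)
  show ?thesis
  proof (cases "V k = 0")
    case True
    then show ?thesis by (simp add: AA_form[OF \<phi>] F hq_def algebra_simps)
  next
    case False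
    note ae = sol[OF False]
    have 1: "ip \<psi> (?B \<xi>) = ip \<psi> (D k)" if "inL2 \<psi>" for \<psi>
      by (rule ip_cong_AE[OF ae that inL2_Ash[OF \<xi>] inL2_D])
    have 2: "ip \<xi> (?B \<phi>) = cnj (ip \<phi> (D k))"
      using Ash_symmetric[OF \<phi> \<xi>, of q] 1[OF \<phi>] by simp
    have "ip (\<lambda>p. \<phi> p + w * \<xi> p) (?B (\<lambda>p. \<phi> p + w * \<xi> p))
        = ip \<phi> (?B \<phi>) + w * ip \<phi> (D k) + cnj w * cnj (ip \<phi> (D k)) + (w * cnj w) * ip \<xi> (D k)" for w
    proof -
      have "ip (\<lambda>p. \<phi> p + w * \<xi> p) (?B (\<lambda>p. \<phi> p + w * \<xi> p))
          = ip \<phi> (?B \<phi>) + w * ip \<phi> (D k) + cnj w * (cnj (ip \<phi> (D k)) + w * ip \<xi> (D k))"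
        unfolding bdop_linear[OF bdop_Ash \<phi> \<xi>]
        by (simp add: ip_add_left ip_add_right ip_scale_left ip_scale_right inL2_add inL2_scale inL2_Ash \<phi> \<xi> 1 2)
      then show ?thesis by (simp add: algebra_simps)
    qed
    then have "ip (\<lambda>p. \<phi> p + ?w * \<xi> p) (?B (\<lambda>p. \<phi> p + ?w * \<xi> p))
        = ip \<phi> (?B \<phi>) + ?w * ip \<phi> (D k) + cnj ?w * cnj (ip \<phi> (D k)) + (?w * cnj ?w) * ip \<xi> (D k)" .
    also have "?w * cnj ?w = complex_of_real ((V k)\<^sup>2 * (cmod z)\<^sup>2)"
    proof -
      have "?w * cnj ?w = complex_of_real ((V k)\<^sup>2) * (z * cnj z)" by (simp add: power2_eq_square)
      then show ?thesis by (simp only: of_real_mult complex_norm_square[symmetric])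
    qed
    finally have "Re (ip (\<lambda>p. \<phi> p + ?w * \<xi> p) (?B (\<lambda>p. \<phi> p + ?w * \<xi> p)))
        = Re (ip \<phi> (?B \<phi>)) + 2 * V k * Re (z * ip \<phi> (D k)) + (V k)\<^sup>2 * (cmod z)\<^sup>2 * Re (ip \<xi> (D k))"
      by (simp del: of_real_power add: algebra_simps)
    then show ?thesis by (simp add: AA_form[OF \<phi>] F hq_def algebra_simps)
  qed
qed

text \<open>For \<open>V k = 0\<close> the equation is dropped: then \<open>\<xi>\<close> does not enter the eigenvector \<open>(V k \<xi>, -1)\<close>.\<close>

definition eig :: "real \<Rightarrow> (pt \<Rightarrow> complex) \<Rightarrow> bool" where
  "eig e \<xi> \<longleftrightarrow> inL2 \<xi> \<and> (V k \<noteq> 0 \<longrightarrow> (AE p in nu. Ash U k (complex_of_real e) \<xi> p = D k p))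
     \<and> e = b k - (V k)\<^sup>2 * Re (ip \<xi> (D k)) \<and> e \<le> m k"

lemma eig_ge:
  assumes e: "eig e \<xi>" and \<psi>: "inH \<psi>"
  shows "e * hq \<psi> \<le> Re (hip \<psi> (AA U k \<psi>))"
proof -
  obtain \<phi> z where p: "\<psi> = (\<phi>, z)" by (cases \<psi>)
  have \<phi>: "inL2 \<phi>" using \<psi> by (simp add: p inH_def)
  have \<xi>: "inL2 \<xi>" using e by (simp add: eig_def)
  have sol: "V k \<noteq> 0 \<Longrightarrow> AE p in nu. Ash U k (complex_of_real e) \<xi> p = D k p"
    using e unfolding eig_def by blast
  let ?f = "\<lambda>p. \<phi> p + (complex_of_real (V k) * z) * \<xi> p"
  have "(m k - e) * n2 ?f \<le> Re (ip ?f (Ash U k (complex_of_real e) ?f))"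
    using Ash_coercive[of ?f "complex_of_real e"] by (simp add: inL2_add inL2_scale \<phi> \<xi>)
  moreover have "0 \<le> (m k - e) * n2 ?f" using e by (simp add: eig_def)
  moreover have "e - b k + (V k)\<^sup>2 * Re (ip \<xi> (D k)) = 0" using e by (simp add: eig_def)
  ultimately show ?thesis
    using form_square[OF \<phi> \<xi> sol, of z] unfolding p by simp
qed

text \<open>The first component is the equation for \<xi>. The second requires the inner product of
  d with \<xi> to be real, which symmetry of A_{1,1} - e provides; it then becomes the equation for
  e in \<open>eig\<close>.\<close>

lemma eig_AA_evec:
  assumes e: "eig e \<xi>"
  shows "aeq (AA U k (evec k \<xi>)) (hscal (complex_of_real e) (evec k \<xi>))"
proof (cases "V k = 0")
  case True
  have "e = b k" using e True by (simp add: eig_def)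
  then show ?thesis
    unfolding AA_eq evec_def aeq_def hscal_def using True bdop_zero[OF bdop_A[OF U]] by simp
next
  case False
  have \<xi>: "inL2 \<xi>" using e by (simp add: eig_def)
  have ae: "AE p in nu. Ash U k (complex_of_real e) \<xi> p = D k p" using e False unfolding eig_def by blast
  have "ip \<xi> (D k) = ip \<xi> (Ash U k (complex_of_real e) \<xi>)"
    by (rule ip_cong_AE[OF ae \<xi> inL2_Ash[OF \<xi>] inL2_D, symmetric])
  then have "ip \<xi> (D k) = cnj (ip \<xi> (D k))" using Ash_symmetric[OF \<xi> \<xi>, of e] by simp
  then have r: "ip (D k) \<xi> = complex_of_real (Re (ip \<xi> (D k)))"
    using ip_cnj[of "D k" \<xi>] by (simp add: complex_eq_iff)
  have s: "complex_of_real e = complex_of_real (b k) - (complex_of_real (V k))\<^sup>2 * complex_of_real (Re (ip \<xi> (D k)))"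
  proof -
    have "e = b k - (V k)\<^sup>2 * Re (ip \<xi> (D k))" using e by (simp add: eig_def)
    then show ?thesis by (metis of_real_diff of_real_mult of_real_power)
  qed
  show ?thesis
    unfolding aeq_def
  proof
    show "AE p in nu. fst (AA U k (evec k \<xi>)) p = fst (hscal (complex_of_real e) (evec k \<xi>)) p"
      using ae
    proof eventually_elim
      case (elim p)
      have "A U k \<xi> p = D k p + complex_of_real e * \<xi> p" using elim by (simp add: Ash_def algebra_simps)
      then show ?case
        unfolding AA_eq evec_def hscal_def fst_conv snd_conv bdop_scale[OF bdop_A[OF U] \<xi>] by (simp add: algebra_simps)
    qed
    show "snd (AA U k (evec k \<xi>)) = snd (hscal (complex_of_real e) (evec k \<xi>))"
      unfolding AA_eq evec_def hscal_def by (simp add: ip_scale_right r s power2_eq_square)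
  qed
qed

text \<open>Coercivity comes from \<open>eig_ge\<close>. For surjectivity, \<open>X\<close> solves
  the first component in terms of z, and a scalar equation for z remains whose coefficient is the
  Schur complement s.\<close>

lemma eig_resolvent:
  assumes e: "eig e \<xi>" and l: "Re l < e"
  shows "l \<in> resolvent_set (AA U k)"
proof (rule resolvent_setI)
  show "inH (AA U k \<psi>)" if "inH \<psi>" for \<psi> by (rule inH_AA[OF that])
  show "AA U k (hminus a c) = hminus (AA U k a) (AA U k c)" if "inH a" "inH c" for a c by (rule AA_hminus[OF that])
  show "0 < e - Re l" using l by simp
  show co: "(e - Re l) * hq \<psi> \<le> Re (hip \<psi> (hminus (AA U k \<psi>) (hscal l \<psi>)))" if "inH \<psi>" for \<psi>
    using eig_ge[OF e that] by (simp add: hip_hminus_right hip_hscal_right hip_self inH_AA inH_hscal that algebra_simps)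
  fix \<eta> assume \<eta>: "inH \<eta>"
  obtain f w where \<eta>e: "\<eta> = (f, w)" by (cases \<eta>)
  have f: "inL2 f" using \<eta> by (simp add: \<eta>e inH_def)
  have lm: "Re l < m k" using e l by (simp add: eig_def)
  note Xf = X_solves[OF lm f] and XD = X_solves[OF lm inL2_D[of k]]
  let ?V = "complex_of_real (V k)"
  have img: "aeq (hminus (AA U k (\<lambda>p. X l f p - ?V * z * X l (D k) p, z)) (hscal l (\<lambda>p. X l f p - ?V * z * X l (D k) p, z)))
      (f, ?V * ip (D k) (X l f) + (complex_of_real (b k) - l - ?V\<^sup>2 * ip (D k) (X l (D k))) * z)"
    if f: "inL2 f" for f z
  proof -
    note Xf = X_solves[OF lm f]
    have lin: "A U k (\<lambda>p. X l f p - ?V * z * X l (D k) p) = (\<lambda>p. A U k (X l f) p - ?V * z * A U k (X l (D k)) p)"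
      using bdop_linear[OF bdop_A[OF U] Xf(1) XD(1), of k "- (?V * z)"] by simp
    show ?thesis
      unfolding aeq_def AA_eq hminus_def hscal_def
    proof (simp only: fst_conv snd_conv, intro conjI)
      show "AE p in nu. A U k (\<lambda>p. X l f p - ?V * z * X l (D k) p) p + ?V * z * D k p - l * (X l f p - ?V * z * X l (D k) p) = f p"
        using Xf(2) XD(2)
      proof eventually_elim
        case (elim p)
        show ?case unfolding lin elim[symmetric] by (simp add: Ash_def algebra_simps)
      qed
      show "?V * ip (D k) (\<lambda>p. X l f p - ?V * z * X l (D k) p) + complex_of_real (b k) * z - l * z =
        ?V * ip (D k) (X l f) + (complex_of_real (b k) - l - ?V\<^sup>2 * ip (D k) (X l (D k))) * z"
        by (simp add: ip_minus_right ip_scale_right inL2_D Xf(1) XD(1) inL2_scale power2_eq_square algebra_simps)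
    qed
  qed
  define s where "s = complex_of_real (b k) - l - ?V\<^sup>2 * ip (D k) (X l (D k))"
  \<comment> \<open>If s vanished, the vector (-V X d, 1) would be annihilated by A - l,
    contradicting coercivity.\<close>
  have "s \<noteq> 0"
  proof
    assume s0: "s = 0"
    let ?\<psi> = "(\<lambda>p. X l (\<lambda>p. 0) p - ?V * 1 * X l (D k) p, 1)"
    have z: "X l (\<lambda>p. 0) = (\<lambda>p. 0)"
    proof -
      have "(nstep (Ash U k l) (NT l) ^^ n) (\<lambda>p. 0) = (\<lambda>p. 0)" for n
        by (induction n) (auto simp: nstep_def bdop_zero[OF bdop_Ash])
      then show ?thesis by (simp add: X_def nsol_def)
    qed
    have H: "inH ?\<psi>" unfolding z by (simp add: inH_def XD(1) inL2_scale inL2_minus[OF inL2_zero, simplified])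
    have a: "aeq (hminus (AA U k ?\<psi>) (hscal l ?\<psi>)) hzero"
      using img[OF inL2_zero, of 1] s0 by (simp add: z s_def hzero_def)
    have "hip ?\<psi> (hminus (AA U k ?\<psi>) (hscal l ?\<psi>)) = hip ?\<psi> hzero"
      by (rule hip_cong[OF a H]) (intro inH_hminus inH_AA H inH_hscal inH_hzero)+
    also have "\<dots> = 0" by (simp add: hip_def hzero_def)
    finally have "(e - Re l) * hq ?\<psi> \<le> 0" using co[OF H] by simp
    moreover have "1 \<le> hq ?\<psi>" by (simp add: hq_def)
    ultimately show False using l by (simp add: mult_le_0_iff)
  qed
  let ?z = "(w - ?V * ip (D k) (X l f)) / s"
  have "aeq (hminus (AA U k (\<lambda>p. X l f p - ?V * ?z * X l (D k) p, ?z)) (hscal l (\<lambda>p. X l f p - ?V * ?z * X l (D k) p, ?z))) \<eta>"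
    using img[OF f, of ?z] \<open>s \<noteq> 0\<close> unfolding s_def[symmetric] by (simp add: \<eta>e)
  moreover have "inH (\<lambda>p. X l f p - ?V * ?z * X l (D k) p, ?z)"
    unfolding inH_def fst_conv by (intro inL2_minus inL2_scale Xf(1) XD(1))
  ultimately show "\<exists>\<psi>. inH \<psi> \<and> aeq (hminus (AA U k \<psi>) (hscal l \<psi>)) \<eta>" by blast
qed

text \<open>The eigenvector puts e into the spectrum, and \<open>eig_resolvent\<close> excludes
  every complex number of smaller real part, so the infimum in \<open>Eg\<close> is
  attained.\<close>

lemma eig_E: assumes e: "eig e \<xi>" shows "E U k = e"
  unfolding Eg_def
proof (rule cInf_eq_minimum)
  have \<xi>: "inL2 \<xi>" using e by (simp add: eig_def)
  have "complex_of_real e \<in> spectrum (AA U k)"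
  proof (rule eigenvalue_in_spectrum[where T="AA U k", OF inH_evec[OF \<xi>] inH_AA[OF inH_evec[OF \<xi>]] _ eig_AA_evec[OF e]])
    show "0 < hq (evec k \<xi>)" unfolding hq_evec by (simp add: add_nonneg_pos)
  qed
  then show "e \<in> Re ` spectrum (AA U k)" by (rule image_eqI[rotated]) simp
  show "e \<le> x" if "x \<in> Re ` spectrum (AA U k)" for x
    using that eig_resolvent[OF e] unfolding spectrum_def by (auto simp: not_less[symmetric])
qed

end

section \<open>Existence and characterisation of the ground state energy\<close>

definition good :: "pt \<Rightarrow> bool" where "good k \<longleftrightarrow> k \<in> T2 \<and> k \<noteq> 0"

text \<open>If \<open>\<epsilon> = 0\<close> and the coupling vanishes at \<open>k\<close>, then \<open>E = m = 0\<close> and the equation for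
  \<open>(A\<^sub>1\<^sub>,\<^sub>1 - E)\<^sup>-\<^sup>1 d\<close> need not be solvable.\<close>

definition nondegenerate :: "pt \<Rightarrow> bool" where "nondegenerate k \<longleftrightarrow> 0 < eps \<or> V k \<noteq> 0"

text \<open>The negative of the Schur complement at a real q, written with the series solution
  \<open>X\<close> so that it is measurable in k.\<close>

definition h :: "real \<Rightarrow> pt \<Rightarrow> real \<Rightarrow> real" where
  "h U k q = q - b k + (V k)\<^sup>2 * Re (ip (X U k (complex_of_real q) (D k)) (D k))"

lemma Ash_inj:
  assumes U: "0 \<le> U" and q: "q < m k" and a: "inL2 a" and c: "inL2 c"
    and ae: "AE p in nu. Ash U k (complex_of_real q) a p = Ash U k (complex_of_real q) c p"
  shows "AE p in nu. a p = c p"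
proof -
  let ?w = "\<lambda>p. a p - c p"
  have w: "inL2 ?w" by (rule inL2_minus[OF a c])
  have "AE p in nu. Ash U k (complex_of_real q) ?w p = 0"
    using ae by eventually_elim (simp add: bdop_minus[OF bdop_Ash[OF U] a c])
  then have "ip ?w (Ash U k (complex_of_real q) ?w) = ip ?w (\<lambda>p. 0)"
    by (rule ip_cong_AE[OF _ w inL2_Ash[OF U w] inL2_zero])
  then have "(m k - q) * n2 ?w \<le> 0" using Ash_coercive[OF U w, of k "complex_of_real q"] by simp
  then have "n2 ?w \<le> 0" using q by (simp add: mult_le_0_iff)
  then have "n2 ?w = 0" by (intro order_antisym) auto
  then have "AE p in nu. ?w p = 0" using n2_zero_iff_AE[OF w] by simp
  then show ?thesis by eventually_elim simp
qed

context
  fixes U :: real and k :: pt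
  assumes U: "0 \<le> U"
begin

lemma eig_form:
  assumes "eig U k e \<xi>"
  shows "Re (hip (evec k \<xi>) (AA U k (evec k \<xi>))) = e * hq (evec k \<xi>)"
proof -
  have "inL2 \<xi>" using assms unfolding eig_def[OF U] by blast
  note H = inH_evec[OF this, of k]
  have "hip (evec k \<xi>) (AA U k (evec k \<xi>)) = hip (evec k \<xi>) (hscal (complex_of_real e) (evec k \<xi>))"
    by (rule hip_cong[OF eig_AA_evec[OF U assms] H inH_AA[OF U H] inH_hscal[OF H]])
  then show ?thesis by (simp add: hip_hscal_right hip_self)
qed

context
  fixes q :: real
  assumes q: "q < m k"
begin

lemma Xq: "inL2 (X U k (complex_of_real q) (D k))"
  "AE p in nu. Ash U k (complex_of_real q) (X U k (complex_of_real q) (D k)) p = D k p"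
  using X_solves[OF U, of "complex_of_real q" k "D k"] q inL2_D by auto

lemma Xq_coercive:
  "(m k - q) * n2 (X U k (complex_of_real q) (D k)) \<le> Re (ip (X U k (complex_of_real q) (D k)) (D k))"
  using Ash_coercive[OF U Xq(1), of k "complex_of_real q"]
    ip_cong_AE[OF Xq(2) Xq(1) inL2_Ash[OF U Xq(1)] inL2_D] by simp

lemma Xq_nm_le: "nm (X U k (complex_of_real q) (D k)) \<le> nm (D k) / (m k - q)"
  using coercive_nm_le[OF Xq_coercive Xq(1) inL2_D] q by (simp add: field_simps)

lemma form_square_h:
  assumes "inL2 \<phi>"
  shows "Re (hip (\<phi>, z) (AA U k (\<phi>, z))) - q * hq (\<phi>, z)
    = Re (ip (\<lambda>p. \<phi> p + (complex_of_real (V k) * z) * X U k (complex_of_real q) (D k) p)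
        (Ash U k (complex_of_real q) (\<lambda>p. \<phi> p + (complex_of_real (V k) * z) * X U k (complex_of_real q) (D k) p)))
      - h U k q * (cmod z)\<^sup>2"
  unfolding h_def by (rule form_square[OF U assms Xq])

lemma h_nonpos_form_ge:
  assumes "h U k q \<le> 0" "inH \<psi>"
  shows "q * hq \<psi> \<le> Re (hip \<psi> (AA U k \<psi>))"
proof -
  obtain \<phi> z where p: "\<psi> = (\<phi>, z)" by (cases \<psi>)
  have \<phi>: "inL2 \<phi>" using assms by (simp add: p inH_def)
  let ?f = "\<lambda>p. \<phi> p + (complex_of_real (V k) * z) * X U k (complex_of_real q) (D k) p"
  have "(m k - q) * n2 ?f \<le> Re (ip ?f (Ash U k (complex_of_real q) ?f))"
    using Ash_coercive[OF U, of ?f k "complex_of_real q"] by (simp add: inL2_add inL2_scale \<phi> Xq(1))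
  moreover have "0 \<le> (m k - q) * n2 ?f" using q by simp
  moreover have "h U k q * (cmod z)\<^sup>2 \<le> 0" using assms(1) by (simp add: mult_le_0_iff)
  ultimately show ?thesis using form_square_h[OF \<phi>, of z] unfolding p by linarith
qed

text \<open>The vector is the one for which the completed square vanishes; its energy relative to q
  is then -h(q).\<close>

lemma h_pos_witness:
  assumes "h U k q > 0"
  shows "\<exists>\<psi>. inH \<psi> \<and> Re (hip \<psi> (AA U k \<psi>)) < q * hq \<psi>"
proof -
  let ?\<phi> = "\<lambda>p. (- complex_of_real (V k)) * X U k (complex_of_real q) (D k) p"
  have \<phi>: "inL2 ?\<phi>" by (rule inL2_scale[OF Xq(1)])
  have "Re (hip (?\<phi>, 1) (AA U k (?\<phi>, 1))) - q * hq (?\<phi>, 1) = - h U k q"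
    using form_square_h[OF \<phi>, of 1] by simp
  then show ?thesis using assms \<phi> by (intro exI[of _ "(?\<phi>, 1)"]) (auto simp: inH_def)
qed

end

text \<open>Resolvent identity: the solutions x, y for q, q' satisfy (A - q)(x - y) = (q - q') y,
  and coercivity bounds x - y and y. This supplies the continuity for the intermediate value
  theorem.\<close>

lemma h_lipschitz:
  assumes "q0 < m k" "q \<le> q0" "q' \<le> q0"
  shows "\<bar>h U k q - h U k q'\<bar> \<le> (1 + (V k)\<^sup>2 * n2 (D k) / (m k - q0)\<^sup>2) * \<bar>q - q'\<bar>"
proof -
  have q: "q < m k" "q' < m k" using assms by auto
  let ?x = "X U k (complex_of_real q) (D k)" and ?y = "X U k (complex_of_real q') (D k)"
  let ?w = "\<lambda>p. ?x p - ?y p"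
  note x = Xq[OF q(1)] and y = Xq[OF q(2)]
  have w: "inL2 ?w" by (rule inL2_minus[OF x(1) y(1)])
  have "AE p in nu. Ash U k (complex_of_real q) ?w p = complex_of_real (q - q') * ?y p"
    using x(2) y(2)
  proof eventually_elim
    case (elim p)
    have "Ash U k (complex_of_real q) ?w p = Ash U k (complex_of_real q) ?x p - Ash U k (complex_of_real q) ?y p"
      by (subst bdop_minus[OF bdop_Ash[OF U] x(1) y(1)]) simp
    also have "\<dots> = D k p - (Ash U k (complex_of_real q') ?y p + (complex_of_real q' - complex_of_real q) * ?y p)"
      unfolding elim(1) by (simp add: Ash_def algebra_simps)
    also have "\<dots> = complex_of_real (q - q') * ?y p" unfolding elim(2) by (simp add: algebra_simps)
    finally show ?case .
  qed
  from ip_cong_AE[OF this w inL2_Ash[OF U w] inL2_scale[OF y(1)]]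
  have "(m k - q) * n2 ?w \<le> Re (ip ?w (\<lambda>p. complex_of_real (q - q') * ?y p))"
    using Ash_coercive[OF U w, of k "complex_of_real q"] by simp
  from coercive_nm_le[OF this w inL2_scale[OF y(1)]]
  have "(m k - q) * nm ?w \<le> \<bar>q - q'\<bar> * nm ?y" by (simp only: nm_scale norm_of_real)
  then have "nm ?w \<le> \<bar>q - q'\<bar> * nm ?y / (m k - q)" using q by (simp add: field_simps)
  also have "\<dots> \<le> \<bar>q - q'\<bar> * (nm (D k) / (m k - q')) / (m k - q)"
    using q by (intro divide_right_mono mult_left_mono Xq_nm_le) auto
  also have "\<dots> \<le> \<bar>q - q'\<bar> * (nm (D k) / (m k - q0)) / (m k - q0)"
    using assms q by (intro frac_le mult_left_mono mult_nonneg_nonneg divide_nonneg_nonneg) auto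
  finally have w_le: "nm ?w \<le> \<bar>q - q'\<bar> * (nm (D k) / (m k - q0)) / (m k - q0)" .
  have "\<bar>Re (ip ?x (D k)) - Re (ip ?y (D k))\<bar> = \<bar>Re (ip ?w (D k))\<bar>"
    by (simp add: ip_minus_left x(1) y(1) inL2_D)
  also have "\<dots> \<le> nm ?w * nm (D k)"
    using ip_cauchy_schwarz[OF w inL2_D] abs_Re_le_cmod order_trans by blast
  also have "\<dots> \<le> \<bar>q - q'\<bar> * (nm (D k) / (m k - q0)) / (m k - q0) * nm (D k)"
    by (rule mult_right_mono[OF w_le]) simp
  also have "\<dots> = n2 (D k) / (m k - q0)\<^sup>2 * \<bar>q - q'\<bar>"
    by (simp add: power2_eq_square flip: nm_square)
  finally have "(V k)\<^sup>2 * \<bar>Re (ip ?x (D k)) - Re (ip ?y (D k))\<bar> \<le> (V k)\<^sup>2 * (n2 (D k) / (m k - q0)\<^sup>2 * \<bar>q - q'\<bar>)"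
    by (rule mult_left_mono) simp
  moreover have "\<bar>h U k q - h U k q'\<bar> \<le> \<bar>q - q'\<bar> + (V k)\<^sup>2 * \<bar>Re (ip ?x (D k)) - Re (ip ?y (D k))\<bar>"
  proof -
    have "h U k q - h U k q' = (q - q') + (V k)\<^sup>2 * (Re (ip ?x (D k)) - Re (ip ?y (D k)))"
      by (simp add: h_def algebra_simps)
    then show ?thesis using abs_triangle_ineq[of "q - q'" "(V k)\<^sup>2 * (Re (ip ?x (D k)) - Re (ip ?y (D k)))"]
      by (simp add: abs_mult)
  qed
  ultimately show ?thesis by (simp add: algebra_simps)
qed

text \<open>The point lies at least 1 below m, so the solution has at most the norm of d, and the
  coupling term is at most V^2 times the square norm of d; the extra -1 makes the inequality
  strict.\<close>

lemma h_neg: "h U k (- 1 - (V k)\<^sup>2 * n2 (D k)) < 0"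
proof -
  let ?q = "- 1 - (V k)\<^sup>2 * n2 (D k)"
  have v: "0 \<le> (V k)\<^sup>2 * n2 (D k)" by simp
  have q: "?q < m k" "1 \<le> m k - ?q" using m_nonneg[of k] v by linarith+
  let ?x = "X U k (complex_of_real ?q) (D k)"
  have "Re (ip ?x (D k)) \<le> nm ?x * nm (D k)"
    using ip_cauchy_schwarz[OF Xq(1)[OF q(1)] inL2_D] complex_Re_le_cmod order_trans by blast
  also have "\<dots> \<le> nm (D k) * nm (D k)"
  proof (rule mult_right_mono)
    have "nm ?x \<le> nm (D k) / (m k - ?q)" by (rule Xq_nm_le[OF q(1)])
    also have "\<dots> \<le> nm (D k) / 1" using q(2) by (intro divide_left_mono) auto
    finally show "nm ?x \<le> nm (D k)" by simp
  qed simp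
  finally have "(V k)\<^sup>2 * Re (ip ?x (D k)) \<le> (V k)\<^sup>2 * n2 (D k)"
    by (intro mult_left_mono) (auto simp: power2_eq_square simp flip: nm_square)
  then show ?thesis unfolding h_def using b_nonneg[of k] by linarith
qed

text \<open>For \<epsilon> > 0 the vector (0,1) has energy b < m. For \<epsilon> = 0, where b = m =
  0, mixing in a small multiple of d gains energy to first order and costs only to second order;
  this uses d \<noteq> 0.\<close>

lemma form_below_m:
  assumes "good k" "nondegenerate k"
  shows "\<exists>\<psi>. inH \<psi> \<and> Re (hip \<psi> (AA U k \<psi>)) < m k * hq \<psi>"
proof (cases "eps = 0")
  case False
  then have "b k < m k" using assms eps b_less_m[of k] by (auto simp: good_def)
  then show ?thesis
    using AA_form[OF U inL2_zero, of 1 k] by (intro exI[of _ "(\<lambda>p. 0, 1)"]) (simp add: inH_def hq_def)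
next
  case True
  then have V: "V k \<noteq> 0" using assms unfolding nondegenerate_def by simp
  \<comment> \<open>With this s one has s * MA < 1, so the quadratic cost is below half of the
    linear gain 2 s V^2 n2(d).\<close>
  define s where "s = 1 / (MA U + 1)"
  have MA: "0 \<le> MA U" using bdop_A[OF U] by (simp add: bdop_def)
  then have s: "0 < s" "s * MA U < 1" by (auto simp: s_def)
  let ?\<phi> = "\<lambda>p. complex_of_real (- s * V k) * D k p"
  have \<phi>: "inL2 ?\<phi>" by (rule inL2_scale[OF inL2_D])
  have "Re (ip ?\<phi> (A U k ?\<phi>)) \<le> MA U * n2 ?\<phi>" by (rule A_form_le[OF U \<phi>])
  also have "n2 ?\<phi> = (s * V k)\<^sup>2 * n2 (D k)" by (simp only: n2_scale norm_of_real) (simp add: power_mult_distrib)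
  also have "MA U * ((s * V k)\<^sup>2 * n2 (D k)) = (s * MA U) * (s * ((V k)\<^sup>2 * n2 (D k)))"
    by (simp add: power2_eq_square)
  also have "\<dots> < 1 * (s * ((V k)\<^sup>2 * n2 (D k)))"
  proof (rule mult_strict_right_mono[OF s(2)])
    show "0 < s * ((V k)\<^sup>2 * n2 (D k))"
      using s V D_nonzero[of k] assms(1) by (simp add: good_def)
  qed
  finally have "Re (ip ?\<phi> (A U k ?\<phi>)) < s * ((V k)\<^sup>2 * n2 (D k))" by simp
  moreover have "ip ?\<phi> (D k) = complex_of_real (- s * V k * n2 (D k))"
    by (simp only: ip_scale_left ip_self) simp
  then have "2 * V k * Re (1 * ip ?\<phi> (D k)) = - 2 * (s * ((V k)\<^sup>2 * n2 (D k)))"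
    by (simp add: power2_eq_square)
  moreover have "0 \<le> s * ((V k)\<^sup>2 * n2 (D k))" using s by simp
  ultimately have "Re (hip (?\<phi>, 1) (AA U k (?\<phi>, 1))) < 0"
    unfolding AA_form[OF U \<phi>] b_eps0[OF True] by linarith
  then show ?thesis using \<phi> by (intro exI[of _ "(?\<phi>, 1)"]) (auto simp: inH_def m_eps0[OF True])
qed

lemma eig_exists_nd:
  assumes "good k" "nondegenerate k"
  shows "\<exists>e. - 1 - (V k)\<^sup>2 * n2 (D k) \<le> e \<and> e < m k \<and> eig U k e (X U k (complex_of_real e) (D k))"
proof -
  let ?a = "- 1 - (V k)\<^sup>2 * n2 (D k)"
  obtain \<psi> where \<psi>: "inH \<psi>" "Re (hip \<psi> (AA U k \<psi>)) < m k * hq \<psi>" using form_below_m[OF assms] by blast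
  have v: "0 \<le> (V k)\<^sup>2 * n2 (D k)" by simp
  have am: "?a < m k" using m_nonneg[of k] v by linarith
  \<comment> \<open>A vector that vanishes almost everywhere has zero energy by Cauchy-Schwarz, so
    it cannot satisfy the strict inequality.\<close>
  have pos: "0 < hq \<psi>"
  proof (rule ccontr)
    assume "\<not> 0 < hq \<psi>"
    then have "hq \<psi> = 0" using hq_nonneg[of \<psi>] by linarith
    moreover have "Re (hip \<psi> (AA U k \<psi>)) \<ge> - (sqrt (hq \<psi>) * sqrt (hq (AA U k \<psi>)))"
      using hip_cauchy_schwarz[OF \<psi>(1) inH_AA[OF U \<psi>(1), of k]] abs_Re_le_cmod[of "hip \<psi> (AA U k \<psi>)"] by linarith
    ultimately show False using \<psi>(2) by simp
  qed
  let ?r = "Re (hip \<psi> (AA U k \<psi>)) / hq \<psi>"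
  have "?r < m k" using \<psi>(2) pos by (simp add: divide_less_eq)
  then obtain q where q: "max ?a ?r < q" "q < m k" using am dense[of "max ?a ?r" "m k"] by auto
  have "Re (hip \<psi> (AA U k \<psi>)) < q * hq \<psi>" using q(1) pos by (simp add: divide_less_eq)
  then have hq0: "0 < h U k q" using h_nonpos_form_ge[OF q(2) _ \<psi>(1)] by (meson not_le)
  have "continuous_on {?a..q} (h U k)"
  proof (rule lipschitz_on_continuous_on)
    show "(1 + (V k)\<^sup>2 * n2 (D k) / (m k - q)\<^sup>2)-lipschitz_on {?a..q} (h U k)"
      by (rule lipschitz_onI) (use h_lipschitz[OF q(2)] in \<open>auto simp: dist_real_def\<close>)
  qed
  then obtain e where e: "?a \<le> e" "e \<le> q" "h U k e = 0"
    using IVT'[of "h U k" ?a 0 q] h_neg hq0 q(1) by auto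
  have em: "e < m k" using e q by simp
  have "eig U k e (X U k (complex_of_real e) (D k))"
    unfolding eig_def[OF U] using Xq[OF em] em e(3) by (simp add: h_def)
  with e em show ?thesis by blast
qed

lemma eig_degenerate: assumes "\<not> nondegenerate k" shows "eig U k 0 (\<lambda>p. 0)"
  using assms eps b_eps0[of k] m_eps0[of k] unfolding eig_def[OF U] nondegenerate_def by auto

lemma nd_E:
  assumes "good k" "nondegenerate k"
  shows "E U k < m k" "eig U k (E U k) (X U k (complex_of_real (E U k)) (D k))"
  using eig_exists_nd[OF assms] eig_E[OF U] by blast+

lemma not_nd_E: assumes "\<not> nondegenerate k" shows "E U k = 0"
  using eig_E[OF U eig_degenerate[OF assms]] .

text \<open>The value 0 in the degenerate case is a placeholder: there V k = 0, and the eigenvector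
  is (0,-1) whatever function is taken.\<close>

definition Xm :: "pt \<Rightarrow> complex" where
  "Xm = (if nondegenerate k then X U k (complex_of_real (E U k)) (D k) else (\<lambda>p. 0))"

lemma eig_Xm: assumes "good k" shows "eig U k (E U k) Xm"
  using nd_E(2)[OF assms] not_nd_E eig_degenerate by (cases "nondegenerate k") (auto simp: Xm_def)

lemma E_le_b: assumes "good k" shows "E U k \<le> b k"
  using eig_ge[OF U eig_Xm[OF assms], of "(\<lambda>p. 0, 1)"] AA_form[OF U inL2_zero, of 1 k]
  by (simp add: inH_def hq_def)

text \<open>The bound is uniform in k, which makes the exponential series converge in all fibres at
  the same rate.\<close>

lemma E_bound: assumes "good k" shows "\<bar>E U k\<bar> \<le> 1 + VM\<^sup>2 * DM\<^sup>2 + 2 * eps"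
proof -
  have "- 1 - (V k)\<^sup>2 * n2 (D k) \<le> E U k"
  proof (cases "nondegenerate k")
    case True
    then show ?thesis using eig_exists_nd[OF assms True] eig_E[OF U] by blast
  next
    case False
    have "0 \<le> (V k)\<^sup>2 * n2 (D k)" by simp
    then show ?thesis unfolding not_nd_E[OF False] by linarith
  qed
  moreover have "(V k)\<^sup>2 * n2 (D k) \<le> VM\<^sup>2 * DM\<^sup>2"
  proof (intro mult_mono n2_D_le)
    show "(V k)\<^sup>2 \<le> VM\<^sup>2" using power_mono[OF V_bound[of k], of 2] by simp
  qed auto
  moreover have "0 \<le> VM\<^sup>2 * DM\<^sup>2" by simp
  ultimately show ?thesis using E_le_b[OF assms] b_le[of k] eps unfolding abs_le_iff by linarith
qed

text \<open>If h(q) > 0, the witness has energy below q, which E \<ge> q forbids; if h(q) \<le> 0,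
  testing the form bound on the eigenvector gives q \<le> E. For fixed q the condition on h is
  measurable in k, which is not visible from an infimum over a spectrum.\<close>

lemma E_ge_iff:
  assumes "good k" "nondegenerate k" "q < m k"
  shows "q \<le> E U k \<longleftrightarrow> h U k q \<le> 0"
proof
  assume q: "q \<le> E U k"
  show "h U k q \<le> 0"
  proof (rule ccontr)
    assume "\<not> h U k q \<le> 0"
    then obtain \<psi> where \<psi>: "inH \<psi>" "Re (hip \<psi> (AA U k \<psi>)) < q * hq \<psi>"
      using h_pos_witness[OF assms(3)] by auto
    have "E U k * hq \<psi> \<le> Re (hip \<psi> (AA U k \<psi>))" by (rule eig_ge[OF U eig_Xm[OF assms(1)] \<psi>(1)])
    moreover have "q * hq \<psi> \<le> E U k * hq \<psi>" using q by (rule mult_right_mono) simp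
    ultimately show False using \<psi>(2) by linarith
  qed
next
  assume h: "h U k q \<le> 0"
  have H: "inH (evec k Xm)" using eig_Xm[OF assms(1)] by (intro inH_evec) (auto simp: eig_def[OF U])
  have "q * hq (evec k Xm) \<le> E U k * hq (evec k Xm)"
    using h_nonpos_form_ge[OF assms(3) h H] eig_form[OF eig_Xm[OF assms(1)]] by simp
  moreover have "0 < hq (evec k Xm)" unfolding hq_evec by (simp add: add_nonneg_pos)
  ultimately show "q \<le> E U k" by simp
qed

lemma inL2_Xm: "good k \<Longrightarrow> inL2 Xm"
  using eig_Xm unfolding eig_def[OF U] by blast

text \<open>Identifies the choice in \<open>resd\<close>. For V k \<noteq> 0, coercivity makes the
  solution unique almost everywhere; for V k = 0 the factor V k removes whatever function was
  chosen, even if the equation has no solution.\<close>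

lemma Psi_aeq:
  assumes "good k"
  shows "inH (PS U k)" "aeq (PS U k) (evec k Xm)"
proof -
  have "inH (PS U k) \<and> aeq (PS U k) (evec k Xm)"
  proof (cases "V k = 0")
    case True
    then show ?thesis unfolding PsiU_def evec_def aeq_def inH_def by (simp add: fhat_ups)
  next
    case False
    then have nondegenerate: "nondegenerate k" by (simp add: nondegenerate_def)
    let ?E = "complex_of_real (E U k)"
    define r where "r = resd eps hb u ups p1 p2 U k"
    note X = Xq[OF nd_E(1)[OF assms nondegenerate]]
    let ?x = "X U k ?E (D k)"
    have Xm: "Xm = ?x" using nondegenerate by (simp add: Xm_def)
    have z: "l2n2 (\<lambda>p. A U k \<phi> p - ?E * \<phi> p - D k p) = 0 \<longleftrightarrow> (AE p in nu. Ash U k ?E \<phi> p = D k p)" if "inL2 \<phi>" for \<phi>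
    proof -
      have L: "inL2 (\<lambda>p. Ash U k ?E \<phi> p - D k p)" by (intro inL2_minus inL2_Ash[OF U] that inL2_D)
      have "l2n2 (\<lambda>p. Ash U k ?E \<phi> p - D k p) = 0 \<longleftrightarrow> n2 (\<lambda>p. Ash U k ?E \<phi> p - D k p) = 0"
        unfolding l2n2_eq[OF L] by (simp add: ennreal_eq_0_iff order_antisym_conv)
      also have "\<dots> \<longleftrightarrow> (AE p in nu. Ash U k ?E \<phi> p = D k p)" using n2_zero_iff_AE[OF L] by simp
      finally show ?thesis by (simp add: Ash_def)
    qed
    have "\<exists>\<phi>. inL2 \<phi> \<and> l2n2 (\<lambda>p. A U k \<phi> p - ?E * \<phi> p - D k p) = 0"
      using X z by blast
    then have "inL2 r \<and> l2n2 (\<lambda>p. A U k r p - ?E * r p - D k p) = 0"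
      unfolding r_def resd_def by (rule someI_ex)
    then have r: "inL2 r" "AE p in nu. Ash U k ?E r p = D k p" using z by auto
    have "AE p in nu. Ash U k ?E r p = Ash U k ?E ?x p" using r(2) X(2) by eventually_elim simp
    then have "AE p in nu. r p = ?x p" by (rule Ash_inj[OF U nd_E(1)[OF assms nondegenerate] r(1) X(1)])
    then have ae: "AE p in nu. complex_of_real (V k) * r p = complex_of_real (V k) * ?x p" by eventually_elim simp
    show ?thesis
      unfolding PsiU_def evec_def aeq_def inH_def Xm fhat_ups r_def[symmetric] fst_conv snd_conv
      using ae inL2_scale[OF r(1)] by blast
  qed
  then show "inH (PS U k)" "aeq (PS U k) (evec k Xm)" by auto
qed

end

end

section \<open>Joint measurability\<close>

definition jointly_measurable :: "(pt \<Rightarrow> pt \<Rightarrow> complex) \<Rightarrow> bool" where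
  "jointly_measurable F \<longleftrightarrow> (\<lambda>kp. F (fst kp) (snd kp)) \<in> borel_measurable (nu \<Otimes>\<^sub>M nu)"

lemma cnj_measurable: "f \<in> borel_measurable M \<Longrightarrow> (\<lambda>x. cnj (f x)) \<in> borel_measurable M"
  by (rule borel_measurable_continuous_on[of cnj]) (auto intro: continuous_intros)

lemma jm_ip: assumes "jointly_measurable F" "jointly_measurable G" shows "(\<lambda>k. ip (F k) (G k)) \<in> borel_measurable nu"
proof -
  have "(\<lambda>kp. cnj (F (fst kp) (snd kp)) * G (fst kp) (snd kp)) \<in> borel_measurable (nu \<Otimes>\<^sub>M nu)"
    using assms unfolding jointly_measurable_def by (intro borel_measurable_times cnj_measurable)
  then have "(\<lambda>(k, p). cnj (F k p) * G k p) \<in> borel_measurable (nu \<Otimes>\<^sub>M nu)"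
    by (simp add: case_prod_beta)
  from nu.borel_measurable_lebesgue_integral[OF this] show ?thesis by (simp add: ip_def)
qed

lemma jm_l2n2: assumes "jointly_measurable F" shows "(\<lambda>k. l2n2 (F k)) \<in> borel_measurable nu"
proof -
  have "(\<lambda>kp. ennreal ((cmod (F (fst kp) (snd kp)))\<^sup>2)) \<in> borel_measurable (nu \<Otimes>\<^sub>M nu)"
    using assms unfolding jointly_measurable_def by measurable
  then have "(\<lambda>(k, p). ennreal ((cmod (F k p))\<^sup>2)) \<in> borel_measurable (nu \<Otimes>\<^sub>M nu)"
    by (simp add: case_prod_beta)
  from nu.borel_measurable_nn_integral[OF this] show ?thesis by (simp add: l2n2_def)
qed

lemma jm_fst: assumes "c \<in> borel_measurable nu" shows "jointly_measurable (\<lambda>k p. c k)"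
  unfolding jointly_measurable_def using measurable_comp[OF measurable_fst assms] by (simp add: o_def)

lemma jm_snd: assumes "c \<in> borel_measurable nu" shows "jointly_measurable (\<lambda>k p. c p)"
  unfolding jointly_measurable_def using measurable_comp[OF measurable_snd assms] by (simp add: o_def)

lemma jm_add: "jointly_measurable F \<Longrightarrow> jointly_measurable G \<Longrightarrow> jointly_measurable (\<lambda>k p. F k p + G k p)"
  and jm_minus: "jointly_measurable F \<Longrightarrow> jointly_measurable G \<Longrightarrow> jointly_measurable (\<lambda>k p. F k p - G k p)"
  and jm_mult: "jointly_measurable F \<Longrightarrow> jointly_measurable G \<Longrightarrow> jointly_measurable (\<lambda>k p. F k p * G k p)"
  unfolding jointly_measurable_def by auto

lemma jm_scale: "c \<in> borel_measurable nu \<Longrightarrow> jointly_measurable F \<Longrightarrow> jointly_measurable (\<lambda>k p. c k * F k p)"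
  by (rule jm_mult[OF jm_fst])

lemma jm_suminf: "(\<And>n. jointly_measurable (F n)) \<Longrightarrow> jointly_measurable (\<lambda>k p. \<Sum>n. F n k p)"
  unfolding jointly_measurable_def by (rule borel_measurable_suminf_banach)

lemma jm_if: assumes "jointly_measurable F" "{k. P k} \<in> sets borel" shows "jointly_measurable (\<lambda>k p. if P k then F k p else 0)"
proof -
  have "jointly_measurable (\<lambda>k p. (if P k then 1 else 0) * F k p)"
  proof (rule jm_scale[OF _ assms(1)])
    show "(\<lambda>k. if P k then 1 else 0 :: complex) \<in> borel_measurable nu"
      by (rule measurable_If) (use assms(2) in auto)
  qed
  then show ?thesis by (rule back_subst[where P=jointly_measurable]) (auto simp: fun_eq_iff)
qed

lemma jm_FS:
  assumes "\<And>x. (\<lambda>k. c k x) \<in> borel_measurable nu" "\<And>k. (\<lambda>x. cmod (c k x)) summable_on UNIV"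
  shows "jointly_measurable (\<lambda>k. FS (c k))"
proof -
  have "jointly_measurable (\<lambda>k p. \<Sum>n. c k (site_enum n) * ehat (site_enum n) p)"
    by (intro jm_suminf jm_scale assms(1) jm_snd ehat_measurable_nu)
  then show ?thesis by (rule back_subst[where P=jointly_measurable]) (simp add: fun_eq_iff FS_suminf[OF assms(2)])
qed

lemma hn2_measurable:
  assumes "jointly_measurable (\<lambda>k. fst (G k))" "(\<lambda>k. snd (G k)) \<in> borel_measurable nu"
  shows "(\<lambda>k. hn2 (G k)) \<in> borel_measurable nu"
  unfolding hn2_def using jm_l2n2[OF assms(1)] assms(2) by measurable

lemma continuous_measurable_nu:
  fixes f :: "pt \<Rightarrow> 'a::{second_countable_topology, t2_space}"
  shows "continuous_on UNIV f \<Longrightarrow> f \<in> borel_measurable nu"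
  using borel_measurable_continuous_onI measurable_cong_sets[OF sets_nu refl] by blast

context model
begin

lemma fhat_FS: "fhat ups k = FS (\<lambda>x. complex_of_real (ups x)) k"
  by (simp add: fhat_def FS_def ehat_def mult.commute)

lemma V_measurable: "V \<in> borel_measurable nu"
proof -
  have "FS (\<lambda>x. complex_of_real (ups x)) \<in> borel_measurable nu"
    by (rule FS_measurable) (use ups_sum in simp)
  then have "(\<lambda>k. Re (FS (\<lambda>x. complex_of_real (ups x)) k)) \<in> borel_measurable nu" by measurable
  then show ?thesis by (rule back_subst[where P="\<lambda>f. f \<in> borel_measurable nu"]) (simp add: fun_eq_iff V_def fhat_FS)
qed

lemma jm_D: "jointly_measurable D"
proof -
  have "jointly_measurable (\<lambda>k. FS (dc k))"
  proof (rule jm_FS[OF _ dc_summable])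
    show "(\<lambda>k. dc k x) \<in> borel_measurable nu" for x
      unfolding dc_def dotp_def by (intro continuous_measurable_nu continuous_intros) auto
  qed
  then show ?thesis by (rule back_subst[where P=jointly_measurable]) (simp add: fun_eq_iff D_FS)
qed

lemma m_measurable: "m \<in> borel_measurable nu"
  unfolding m_def[abs_def] by (intro continuous_measurable_nu continuous_intros) auto

lemma b_measurable: "b \<in> borel_measurable nu"
  unfolding bfun_def[abs_def] cos2_def by (intro continuous_measurable_nu continuous_intros)

lemma jm_A:
  assumes F: "jointly_measurable F" and L: "\<And>k. inL2 (F k)"
  shows "jointly_measurable (\<lambda>k. A U k (F k))"
proof -
  have ipm: "(\<lambda>k. ip (ehat x) (F k)) \<in> borel_measurable nu" for x
    by (rule jm_ip[OF jm_snd[OF ehat_measurable_nu] F])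
  have f: "jointly_measurable (\<lambda>k p. complex_of_real (ffun eps k p))"
  proof -
    have c: "continuous_on UNIV (\<lambda>kp::pt \<times> pt. complex_of_real (ffun eps (fst kp) (snd kp)))"
      unfolding ffun_def cos2_def by (intro continuous_intros)
    have s: "sets (nu \<Otimes>\<^sub>M nu) = sets (borel :: (pt \<times> pt) measure)"
    proof -
      have "sets (nu \<Otimes>\<^sub>M nu) = sets (borel \<Otimes>\<^sub>M borel :: (pt \<times> pt) measure)"
        by (rule sets_pair_measure_cong) simp_all
      then show ?thesis by (simp only: borel_prod)
    qed
    show ?thesis unfolding jointly_measurable_def
      using borel_measurable_continuous_onI[OF c] measurable_cong_sets[OF s refl] by blast
  qed
  have k: "jointly_measurable (\<lambda>k. FS (kc (F k)))"
  proof (rule jm_FS[OF _ kc_summable[OF L]])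
    show "(\<lambda>k. kc (F k) x) \<in> borel_measurable nu" for x
      unfolding kc_def using ipm[of x] by measurable
  qed
  have c: "(\<lambda>k. complex_of_real U * ip e0 (F k)) \<in> borel_measurable nu"
    using ipm[of "(0,0)"] by measurable
  show ?thesis unfolding A_eq
    by (intro jm_add jm_mult[OF f F] k jm_scale[OF c jm_snd[OF ehat_measurable_nu]])
qed

context
  fixes U :: real
  assumes U: "0 \<le> U"
begin

text \<open>Inner products of jointly measurable functions are measurable in k, so A_{1,1} and each
  Neumann step preserve joint measurability. The induction also carries square integrability, which
  \<open>jm_A\<close> requires.\<close>

lemma jm_X:
  assumes l: "l \<in> borel_measurable nu"
  shows "jointly_measurable (\<lambda>k. X U k (complex_of_real (l k)) (D k))"
proof -
  have t: "(\<lambda>k. NT U k (complex_of_real (l k))) \<in> borel_measurable nu"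
    unfolding NT_def[OF U] using l m_measurable by simp
  have lc: "(\<lambda>k. complex_of_real (l k)) \<in> borel_measurable nu" using l by (rule borel_measurable_of_real[THEN measurable_compose_rev])
  have tc: "(\<lambda>k. complex_of_real (NT U k (complex_of_real (l k)))) \<in> borel_measurable nu"
    using t by (rule borel_measurable_of_real[THEN measurable_compose_rev])
  let ?S = "\<lambda>k. nstep (Ash U k (complex_of_real (l k))) (NT U k (complex_of_real (l k)))"
  have "jointly_measurable (\<lambda>k. (?S k ^^ n) (D k)) \<and> (\<forall>k. inL2 ((?S k ^^ n) (D k)))" for n
  proof (induction n)
    case 0 then show ?case by (simp add: jm_D inL2_D)
  next
    case (Suc n)
    have L: "inL2 ((?S k ^^ n) (D k))" for k using Suc by blast
    have J: "jointly_measurable (\<lambda>k. (?S k ^^ n) (D k))" using Suc by blast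
    have "jointly_measurable (\<lambda>k. ?S k ((?S k ^^ n) (D k)))"
      unfolding nstep_def[of "Ash U _ _" _ "(?S _ ^^ n) (D _)"] Ash_def[of _ _ _ "(?S _ ^^ n) (D _)"]
      by (intro jm_minus jm_scale[OF tc] jm_A jm_scale[OF lc] J L)
    moreover have "inL2 (?S k ((?S k ^^ n) (D k)))" for k
      unfolding nstep_def[of "Ash U _ _" _ "(?S _ ^^ n) (D _)"]
      by (intro inL2_minus inL2_scale inL2_Ash[OF U] L)
    ultimately show ?case by simp
  qed
  then have "jointly_measurable (\<lambda>k p. complex_of_real (NT U k (complex_of_real (l k))) * (\<Sum>n. (?S k ^^ n) (D k) p))"
    by (intro jm_scale[OF tc] jm_suminf) blast
  then show ?thesis by (simp add: X_def[OF U] nsol_def)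
qed

lemma h_measurable: "(\<lambda>k. h U k q) \<in> borel_measurable nu"
proof -
  have "(\<lambda>k. ip (X U k (complex_of_real q) (D k)) (D k)) \<in> borel_measurable nu"
    by (rule jm_ip[OF jm_X jm_D]) simp
  then show ?thesis unfolding h_def using b_measurable V_measurable by simp
qed

lemma good_sets: "{k. good k} \<in> sets borel"
proof -
  have "{k. good k} = T2 - {0}" by (auto simp: good_def)
  then show ?thesis by auto
qed

lemma nd_sets: "{k. good k \<and> nondegenerate k} \<in> sets borel"
proof -
  have "{k \<in> space nu. V k \<noteq> 0} \<in> sets nu" using V_measurable by measurable
  then have "{k. V k \<noteq> 0} \<in> sets borel" by simp
  moreover have "{k. good k \<and> nondegenerate k} = {k. good k} \<inter> (if 0 < eps then UNIV else {k. V k \<noteq> 0})"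
    by (auto simp: nondegenerate_def)
  ultimately show ?thesis using good_sets by auto
qed

text \<open>Set to 0 off the good points, a null set for \<open>nu\<close>, to obtain a function
  measurable on the whole plane.\<close>

definition Em :: "pt \<Rightarrow> real" where "Em k = (if good k then E U k else 0)"

lemma Em_measurable: "Em \<in> borel_measurable nu"
proof (subst borel_measurable_iff_ge, intro allI)
  fix q
  have "{k \<in> space nu. q < m k \<and> h U k q \<le> 0} \<in> sets nu"
    using m_measurable h_measurable[of q] by measurable
  then have 1: "{k. q < m k \<and> h U k q \<le> 0} \<in> sets borel" by simp
  \<comment> \<open>On the nondegenerate part E < m, so demanding q < m loses nothing; elsewhere
    \<open>Em\<close> is 0.\<close>
  have "q \<le> Em k \<longleftrightarrow> (if good k \<and> nondegenerate k then q < m k \<and> h U k q \<le> 0 else q \<le> 0)" for k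
  proof (cases "good k \<and> nondegenerate k")
    case True
    then have "E U k < m k" using nd_E(1)[OF U] by blast
    then show ?thesis using True E_ge_iff[OF U, of k q] by (auto simp: Em_def)
  next
    case False
    then show ?thesis using not_nd_E[OF U, of k] by (auto simp: Em_def)
  qed
  then have "{w \<in> space nu. q \<le> Em w} = ({k. good k \<and> nondegenerate k} \<inter> {k. q < m k \<and> h U k q \<le> 0})
      \<union> (- {k. good k \<and> nondegenerate k} \<inter> (if q \<le> 0 then UNIV else {}))" by auto
  then show "{w \<in> space nu. q \<le> Em w} \<in> sets nu" using 1 nd_sets by auto
qed

definition XM :: "pt \<Rightarrow> pt \<Rightarrow> complex" where
  "XM k p = (if good k then Xm U k p else 0)"

lemma jm_XM: "jointly_measurable XM"
proof -
  have "jointly_measurable (\<lambda>k p. if good k \<and> nondegenerate k then X U k (complex_of_real (Em k)) (D k) p else 0)"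
    by (rule jm_if[OF jm_X[OF Em_measurable] nd_sets])
  then show ?thesis
    by (rule back_subst[where P=jointly_measurable]) (auto simp: fun_eq_iff XM_def Xm_def[OF U] Em_def)
qed

lemma inL2_XM: "inL2 (XM k)"
proof (cases "good k")
  case True
  then have "XM k = Xm U k" by (simp add: fun_eq_iff XM_def)
  then show ?thesis using inL2_Xm[OF U True] by simp
next
  case False
  then have "XM k = (\<lambda>p. 0)" by (simp add: fun_eq_iff XM_def)
  then show ?thesis by simp
qed

end

end

section \<open>The limit of infinite repulsion\<close>

text \<open>Completeness for a real parameter, with a Cauchy modulus B uniform over all later U'.
  Parameters with B \<le> 4^-j have geometrically small differences, and uniformity of B extends
  convergence from this sequence to all real U.\<close>

lemma L2_convergent_at_top:
  fixes f :: "real \<Rightarrow> pt \<Rightarrow> complex"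
  assumes L: "\<And>U. 0 \<le> U \<Longrightarrow> inL2 (f U)"
    and B: "\<And>U U'. 0 \<le> U \<Longrightarrow> U \<le> U' \<Longrightarrow> n2 (\<lambda>p. f U' p - f U p) \<le> B U"
    and B0: "(B \<longlongrightarrow> 0) at_top"
  shows "\<exists>g. inL2 g \<and> ((\<lambda>U. nm (\<lambda>p. f U p - g p)) \<longlongrightarrow> 0) at_top"
proof -
  have "\<exists>T\<ge>0. \<forall>U\<ge>T. B U \<le> (1/4) ^ j" for j :: nat
  proof -
    have "\<forall>\<^sub>F U in at_top. B U < (1/4) ^ j" using order_tendstoD(2)[OF B0] by simp
    then obtain T where "\<forall>U\<ge>T. B U < (1/4) ^ j" by (auto simp: eventually_at_top_linorder)
    then show ?thesis by (intro exI[of _ "max 0 T"]) (auto intro: less_imp_le)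
  qed
  then obtain T where T: "\<And>j::nat. 0 \<le> T j" "\<And>j U. T j \<le> U \<Longrightarrow> B U \<le> (1/4) ^ j" by metis
  \<comment> \<open>Partial sums of the non-negative thresholds: increasing, and still W j \<ge> T
    j.\<close>
  define W where "W j = (\<Sum>i\<le>j. T i)" for j
  have W0: "0 \<le> W j" for j unfolding W_def by (rule sum_nonneg) (rule T)
  have WT: "T j \<le> W j" for j unfolding W_def by (rule member_le_sum) (use T in auto)
  have Wm: "W j \<le> W (Suc j)" for j unfolding W_def using T by simp
  have near: "nm (\<lambda>p. f U p - f (W j) p) \<le> (1/2) ^ j" if "W j \<le> U" for U j
  proof -
    have "n2 (\<lambda>p. f U p - f (W j) p) \<le> (1/4) ^ j"
      using B[OF W0 that] T(2)[OF WT] by (rule order_trans)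
    also have "\<dots> = ((1/2) ^ j)\<^sup>2" by (simp add: power_mult[symmetric] mult.commute[of j] power_mult power_divide)
    finally show ?thesis unfolding nm_def by (intro real_le_lsqrt) auto
  qed
  define x where "x j = (\<lambda>p. f (W (Suc j)) p - f (W j) p)" for j
  have xL: "inL2 (x j)" for j unfolding x_def by (intro inL2_minus L W0)
  have xn: "nm (x j) \<le> 1 * (1/2) ^ j" for j unfolding x_def using near[OF Wm] by simp
  let ?S = "\<lambda>p. \<Sum>n. x n p"
  have S: "inL2 ?S" and SN: "\<And>N. nm (\<lambda>p. ?S p - (\<Sum>n<N. x n p)) \<le> 1 * (1/2) ^ N / (1 - 1/2)"
    using L2_geometric_series[of x 1 "1/2"] xL xn by auto
  define g where "g = (\<lambda>p. f (W 0) p + ?S p)"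
  have g: "inL2 g" unfolding g_def by (intro inL2_add S L W0)
  have gN: "nm (\<lambda>p. g p - f (W N) p) \<le> 2 * (1/2) ^ N" for N
  proof -
    have "(\<Sum>n<N. x n p) = f (W N) p - f (W 0) p" for p
      unfolding x_def by (rule sum_lessThan_telescope)
    then have "(\<lambda>p. g p - f (W N) p) = (\<lambda>p. ?S p - (\<Sum>n<N. x n p))" by (simp add: g_def fun_eq_iff)
    then show ?thesis using SN[of N] by simp
  qed
  have bd: "nm (\<lambda>p. f U p - g p) \<le> 3 * (1/2) ^ N" if "W N \<le> U" for U N
  proof -
    have U: "0 \<le> U" using W0[of N] that by linarith
    have "nm (\<lambda>p. (f U p - f (W N) p) - (g p - f (W N) p)) \<le> nm (\<lambda>p. f U p - f (W N) p) + nm (\<lambda>p. g p - f (W N) p)"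
      by (rule nm_triangle_minus) (intro inL2_minus L U W0 g)+
    then show ?thesis using near[OF that] gN[of N] by simp
  qed
  have "((\<lambda>U. nm (\<lambda>p. f U p - g p)) \<longlongrightarrow> 0) at_top"
  proof (rule tendstoI)
    fix e :: real assume e: "0 < e"
    obtain N where N: "(1/2 :: real) ^ N < e / 3" using real_arch_pow_inv[of "e / 3" "1/2"] e by auto
    have "dist (nm (\<lambda>p. f U p - g p)) 0 < e" if "W N \<le> U" for U
      using bd[OF that] N by (simp add: dist_real_def)
    then show "\<forall>\<^sub>F U in at_top. dist (nm (\<lambda>p. f U p - g p)) 0 < e"
      by (auto simp: eventually_at_top_linorder)
  qed
  with g show ?thesis by blast
qed

context model
begin

lemma AA_form_mono:
  assumes "0 \<le> U" "U \<le> U'" "inH \<psi>"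
  shows "Re (hip \<psi> (AA U k \<psi>)) \<le> Re (hip \<psi> (AA U' k \<psi>))"
proof -
  obtain \<phi> z where p: "\<psi> = (\<phi>, z)" by (cases \<psi>)
  have \<phi>: "inL2 \<phi>" using assms by (simp add: p inH_def)
  have U': "0 \<le> U'" using assms by simp
  have "0 \<le> (U' - U) * (cmod (ip e0 \<phi>))\<^sup>2" using assms by simp
  then show ?thesis
    unfolding p AA_form[OF assms(1) \<phi>] AA_form[OF U' \<phi>] A_change_U[OF assms(1) U' \<phi>, of k] by linarith
qed

context
  fixes k :: pt
  assumes good: "good k"
begin

lemma inH_evec_Xm: "0 \<le> U \<Longrightarrow> inH (evec k (Xm U k))"
  by (rule inH_evec[OF inL2_Xm[OF _ good]])

lemma evec_form_le:
  assumes "0 \<le> U" "U \<le> U'"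
  shows "Re (hip (evec k (Xm U' k)) (AA U k (evec k (Xm U' k)))) \<le> E U' k * hq (evec k (Xm U' k))"
proof -
  have U': "0 \<le> U'" using assms by simp
  show ?thesis
    using AA_form_mono[OF assms inH_evec_Xm[OF U'], of k] eig_form[OF U' eig_Xm[OF U' good]] by simp
qed

lemma E_mono: assumes "0 \<le> U" "U \<le> U'" shows "E U k \<le> E U' k"
proof -
  have U': "0 \<le> U'" using assms by simp
  have "E U k * hq (evec k (Xm U' k)) \<le> E U' k * hq (evec k (Xm U' k))"
    using eig_ge[OF assms(1) eig_Xm[OF assms(1) good] inH_evec_Xm[OF U']] evec_form_le[OF assms] by linarith
  moreover have "0 < hq (evec k (Xm U' k))" unfolding hq_evec by (simp add: add_nonneg_pos)
  ultimately show ?thesis by simp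
qed

text \<open>The energy is monotone in U and bounded by b, so it converges to its supremum; thus the
  \<open>Lim\<close> in \<open>Einf\<close> denotes an actual limit.\<close>

lemma E_limit:
  shows "((\<lambda>U. E U k) \<longlongrightarrow> EI k) at_top"
    and "\<And>U. 0 \<le> U \<Longrightarrow> E U k \<le> EI k"
proof -
  define L where "L = (SUP U\<in>{0..}. E U k)"
  have bdd: "bdd_above ((\<lambda>U. E U k) ` {0..})"
    by (rule bdd_aboveI[of _ "b k"]) (use E_le_b[OF _ good] in auto)
  have le: "E U k \<le> L" if "0 \<le> U" for U
    unfolding L_def by (rule cSUP_upper[OF _ bdd]) (use that in auto)
  have "((\<lambda>U. E U k) \<longlongrightarrow> L) at_top"
  proof (rule increasing_tendsto)
    show "\<forall>\<^sub>F U in at_top. E U k \<le> L"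
      using eventually_ge_at_top[of 0] by eventually_elim (rule le)
    fix x assume "x < L"
    then obtain U0 where U0: "0 \<le> U0" "x < E U0 k"
      unfolding L_def using less_cSUP_iff[OF _ bdd, of x] by auto
    show "\<forall>\<^sub>F U in at_top. x < E U k"
      using eventually_ge_at_top[of U0] by eventually_elim (use E_mono[OF U0(1)] U0(2) in fastforce)
  qed
  moreover from this have "EI k = L"
    unfolding Einf_def by (intro tendsto_Lim) auto
  ultimately show "((\<lambda>U. E U k) \<longlongrightarrow> EI k) at_top"
    "\<And>U. 0 \<le> U \<Longrightarrow> E U k \<le> EI k" using le by auto
qed

text \<open>Both eigenvectors have the last component \<open>-1\<close>, so their difference lies in
  \<open>L\<^sup>2\<close>; its energy at \<open>U\<close> is that of the eigenvector at \<open>U'\<close>.\<close>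

lemma evec_diff_le:
  assumes "0 \<le> U" "U \<le> U'"
  shows "(m k - E U k) * n2 (\<lambda>p. complex_of_real (V k) * Xm U' k p - complex_of_real (V k) * Xm U k p)
    \<le> (E U' k - E U k) * hq (evec k (Xm U' k))"
proof -
  have U': "0 \<le> U'" using assms by simp
  note e = eig_Xm[OF assms(1) good, unfolded eig_def[OF assms(1)]]
  let ?\<phi> = "\<lambda>p. complex_of_real (V k) * Xm U' k p"
  let ?w = "\<lambda>p. complex_of_real (V k) * Xm U' k p - complex_of_real (V k) * Xm U k p"
  have \<phi>: "inL2 ?\<phi>" by (rule inL2_scale[OF inL2_Xm[OF U' good]])
  have w: "inL2 ?w" by (intro inL2_minus inL2_scale inL2_Xm[OF U' good] inL2_Xm[OF assms(1) good])
  have ev: "evec k (Xm U' k) = (?\<phi>, -1)" by (simp add: evec_def)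
  have sol: "V k \<noteq> 0 \<Longrightarrow> AE p in nu. Ash U k (complex_of_real (E U k)) (Xm U k) p = D k p"
    using e by blast
  have "E U k = b k - (V k)\<^sup>2 * Re (ip (Xm U k) (D k))" using e by blast
  then have h0: "E U k - b k + (V k)\<^sup>2 * Re (ip (Xm U k) (D k)) = 0" by linarith
  have "Re (hip (evec k (Xm U' k)) (AA U k (evec k (Xm U' k)))) - E U k * hq (evec k (Xm U' k))
      = Re (ip ?w (Ash U k (complex_of_real (E U k)) ?w))"
    unfolding ev using form_square[OF assms(1) \<phi> inL2_Xm[OF assms(1) good] sol, of "-1"] h0 by simp
  moreover have "(m k - E U k) * n2 ?w \<le> Re (ip ?w (Ash U k (complex_of_real (E U k)) ?w))"
    using Ash_coercive[OF assms(1) w, of k "complex_of_real (E U k)"] by simp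
  ultimately show ?thesis using evec_form_le[OF assms] by (simp add: left_diff_distrib)
qed

text \<open>The gap g bounds all eigenvectors through the resolvent estimate, with H bounding their
  square norms, and it can be divided out of \<open>evec_diff_le\<close>. The Cauchy modulus (EI -
  E(U)) H / g tends to 0.\<close>

lemma limit_of_gap:
  assumes V: "V k \<noteq> 0" and g: "0 < g" "\<And>U. 0 \<le> U \<Longrightarrow> E U k \<le> m k - g"
  shows "\<exists>f. inL2 f \<and> ((\<lambda>U. nm (\<lambda>p. complex_of_real (V k) * Xm U k p - f p)) \<longlongrightarrow> 0) at_top"
proof (rule L2_convergent_at_top)
  show "inL2 (\<lambda>p. complex_of_real (V k) * Xm U k p)" if "0 \<le> U" for U
    by (rule inL2_scale[OF inL2_Xm[OF that good]])
  let ?L = "EI k"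
  define H where "H = (V k)\<^sup>2 * (nm (D k) / g)\<^sup>2 + 1"
  have nondegenerate: "nondegenerate k" using V by (simp add: nondegenerate_def)
  show "n2 (\<lambda>p. complex_of_real (V k) * Xm U' k p - complex_of_real (V k) * Xm U k p) \<le> (?L - E U k) * H / g"
    if "0 \<le> U" "U \<le> U'" for U U'
  proof -
    have U': "0 \<le> U'" using that by simp
    have "nm (Xm U' k) \<le> nm (D k) / (m k - E U' k)"
      using Xq_nm_le[OF U' nd_E(1)[OF U' good nondegenerate]] nondegenerate by (simp add: Xm_def[OF U'])
    also have "\<dots> \<le> nm (D k) / g"
    proof -
      have "g \<le> m k - E U' k" using g(2)[OF U'] by linarith
      then show ?thesis using g(1) by (intro divide_left_mono mult_pos_pos) auto
    qed
    finally have "n2 (Xm U' k) \<le> (nm (D k) / g)\<^sup>2"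
      unfolding nm_square[symmetric] by (rule power_mono) simp
    then have "hq (evec k (Xm U' k)) \<le> H"
      unfolding hq_evec H_def by (simp add: mult_left_mono)
    then have "(E U' k - E U k) * hq (evec k (Xm U' k)) \<le> (?L - E U k) * H"
      using E_limit(2)[OF U'] E_mono[OF that] by (intro mult_mono) auto
    moreover have "g * n2 (\<lambda>p. complex_of_real (V k) * Xm U' k p - complex_of_real (V k) * Xm U k p)
      \<le> (m k - E U k) * n2 (\<lambda>p. complex_of_real (V k) * Xm U' k p - complex_of_real (V k) * Xm U k p)"
      using g(2)[OF that(1)] by (intro mult_right_mono) auto
    ultimately have "g * n2 (\<lambda>p. complex_of_real (V k) * Xm U' k p - complex_of_real (V k) * Xm U k p)
        \<le> (?L - E U k) * H" using evec_diff_le[OF that] by linarith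
    then show ?thesis using g(1) by (simp add: le_divide_eq mult.commute)
  qed
  have "((\<lambda>U. (?L - E U k) * H / g) \<longlongrightarrow> (?L - ?L) * H / g) at_top"
    by (intro tendsto_intros E_limit(1)) (use g in auto)
  then show "((\<lambda>U. (?L - E U k) * H / g) \<longlongrightarrow> 0) at_top" by simp
qed

text \<open>The part w of d orthogonal to the constant function does not feel U. The trial vector
  (-s V w, 1) therefore has one negative energy bound for all U, which keeps E away from m =
  0.\<close>

lemma gap_of_D_not_e0:
  assumes eps0: "eps = 0" and V: "V k \<noteq> 0" and w0: "n2 (\<lambda>p. D k p - ip e0 (D k) * e0 p) \<noteq> 0"
  shows "\<exists>g>0. \<forall>U\<ge>0. E U k \<le> m k - g"
proof -
  define w where "w = (\<lambda>p. D k p - ip e0 (D k) * e0 p)"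
  have w: "inL2 w" unfolding w_def by (intro inL2_minus inL2_D inL2_scale inL2_ehat)
  have wpos: "0 < n2 w" using w0 by (simp add: w_def order_less_le)
  have e0w: "ip e0 w = 0"
    unfolding w_def by (simp add: ip_minus_right ip_scale_right inL2_D inL2_scale ip_ehat)
  have "ip w (D k) = ip w (\<lambda>p. w p + ip e0 (D k) * e0 p)" by (simp add: w_def)
  also have "\<dots> = ip w w + ip e0 (D k) * ip w e0"
    by (simp add: ip_add_right ip_scale_right w inL2_scale)
  also have "ip w e0 = 0" using ip_cnj[of w e0] e0w by simp
  finally have wD: "ip w (D k) = complex_of_real (n2 w)" by (simp add: ip_self)
  \<comment> \<open>The norm bound at U = 0 serves for all U, since the trial vector is orthogonal
    to \<open>e0\<close>.\<close>
  define s where "s = 1 / (MA 0 + 1)"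
  have MA: "0 \<le> MA 0" using bdop_A[of 0] by (simp add: bdop_def)
  then have s: "0 < s" "s * MA 0 \<le> 1" by (auto simp: s_def)
  let ?\<phi> = "\<lambda>p. complex_of_real (- s * V k) * w p"
  have \<phi>: "inL2 ?\<phi>" by (rule inL2_scale[OF w])
  define r where "r = s * ((V k)\<^sup>2 * n2 w)"
  have r: "0 < r" unfolding r_def using s V wpos by simp
  have ip\<phi>: "2 * V k * Re (1 * ip ?\<phi> (D k)) = - 2 * r"
  proof -
    have "ip ?\<phi> (D k) = complex_of_real (- s * V k * n2 w)" by (simp only: ip_scale_left wD) simp
    then show ?thesis by (simp add: power2_eq_square r_def)
  qed
  have form: "Re (hip (?\<phi>, 1) (AA U k (?\<phi>, 1))) \<le> - r" if U: "0 \<le> U" for U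
  proof -
    have "ip e0 ?\<phi> = 0" by (simp only: ip_scale_right e0w) simp
    then have "Re (ip ?\<phi> (A U k ?\<phi>)) = Re (ip ?\<phi> (A 0 k ?\<phi>))"
      using A_change_U[OF order_refl U \<phi>, of k] by (simp del: of_real_mult of_real_minus)
    also have "\<dots> \<le> MA 0 * n2 ?\<phi>" by (rule A_form_le[OF order_refl \<phi>])
    also have "n2 ?\<phi> = (s * V k)\<^sup>2 * n2 w" by (simp only: n2_scale norm_of_real) (simp add: power_mult_distrib)
    also have "MA 0 * ((s * V k)\<^sup>2 * n2 w) = (s * MA 0) * r" by (simp add: power2_eq_square r_def)
    also have "\<dots> \<le> 1 * r" using s(2) r by (intro mult_right_mono) auto
    finally show ?thesis using ip\<phi> unfolding AA_form[OF U \<phi>] b_eps0[OF eps0] by linarith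
  qed
  let ?N = "hq (?\<phi>, 1)"
  have N: "0 < ?N" unfolding hq_def by (simp add: add_nonneg_pos)
  have "E U k \<le> m k - r / ?N" if U: "0 \<le> U" for U
  proof -
    have H: "inH (?\<phi>, 1)" using \<phi> by (simp add: inH_def)
    have "E U k * ?N \<le> - r" using order_trans[OF eig_ge[OF U eig_Xm[OF U good] H] form[OF U]] .
    then have "E U k \<le> - r / ?N" using pos_le_divide_eq[OF N, of "E U k" "- r"] by blast
    then show ?thesis unfolding m_eps0[OF eps0] by simp
  qed
  then show ?thesis using r N by (intro exI[of _ "r / ?N"]) (auto intro: divide_pos_pos)
qed

text \<open>Here d = c e0 almost everywhere, and e0 is an eigenvector of A_{1,1}, so the solution is
  c e0 / (u(0) + U - E) with E < 0. Its norm is at most |c|/U and decays without any gap below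
  m.\<close>

lemma limit_of_D_e0:
  assumes eps0: "eps = 0" and V: "V k \<noteq> 0" and w0: "n2 (\<lambda>p. D k p - ip e0 (D k) * e0 p) = 0"
  shows "((\<lambda>U. nm (\<lambda>p. complex_of_real (V k) * Xm U k p - 0)) \<longlongrightarrow> 0) at_top"
proof -
  define c where "c = ip e0 (D k)"
  have L: "inL2 (\<lambda>p. D k p - c * e0 p)" by (intro inL2_minus inL2_D inL2_scale inL2_ehat)
  have De: "AE p in nu. D k p = c * e0 p" using w0 n2_zero_iff_AE[OF L] by (simp add: c_def)
  have nondegenerate: "nondegenerate k" using V by (simp add: nondegenerate_def)
  have bd: "nm (\<lambda>p. complex_of_real (V k) * Xm U k p - 0) \<le> \<bar>V k\<bar> * cmod c * inverse U" if U: "0 < U" for U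
  proof -
    have U0: "0 \<le> U" using U by simp
    have Em: "E U k < m k" by (rule nd_E(1)[OF U0 good nondegenerate])
    then have E0: "E U k < 0" using m_eps0[OF eps0, of k] by simp
    define t where "t = u (0,0) + U - E U k"
    have t: "U \<le> t" "0 < t" using E0 u_nonneg[of "(0,0)"] U by (auto simp: t_def)
    let ?y = "\<lambda>p. (c / complex_of_real t) * e0 p"
    have y: "inL2 ?y" by (rule inL2_scale[OF inL2_ehat])
    have Ay: "Ash U k (complex_of_real (E U k)) ?y p = c * e0 p" for p
    proof -
      have "Ash U k (complex_of_real (E U k)) ?y p = (c / complex_of_real t) * Ash U k (complex_of_real (E U k)) e0 p"
        by (subst bdop_scale[OF bdop_Ash[OF U0] inL2_ehat]) simp
      also have "Ash U k (complex_of_real (E U k)) e0 p = complex_of_real t * e0 p"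
        unfolding Ash_def A_e0[OF eps0] by (simp add: t_def algebra_simps)
      finally show ?thesis using t by simp
    qed
    note x = Xq[OF U0 Em]
    have Xm: "Xm U k = X U k (complex_of_real (E U k)) (D k)" using nondegenerate by (simp add: Xm_def[OF U0])
    have "AE p in nu. Ash U k (complex_of_real (E U k)) (Xm U k) p = Ash U k (complex_of_real (E U k)) ?y p"
      using x(2) De unfolding Xm by eventually_elim (simp only: Ay)
    then have "AE p in nu. Xm U k p = ?y p" by (rule Ash_inj[OF U0 Em inL2_Xm[OF U0 good] y])
    then have "n2 (Xm U k) = n2 ?y" by (rule n2_cong_AE[OF _ inL2_Xm[OF U0 good] y])
    then have "nm (Xm U k) = nm ?y" by (simp add: nm_def)
    also have "\<dots> = cmod c / t" using t by (simp only: nm_scale nm_ehat) (simp add: norm_divide)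
    also have "\<dots> \<le> cmod c / U" using t U by (intro divide_left_mono) auto
    finally have "\<bar>V k\<bar> * nm (Xm U k) \<le> \<bar>V k\<bar> * (cmod c / U)" by (rule mult_left_mono) simp
    then show ?thesis by (simp add: nm_scale divide_inverse mult.assoc)
  qed
  have "((\<lambda>U. \<bar>V k\<bar> * cmod c * inverse U) \<longlongrightarrow> \<bar>V k\<bar> * cmod c * 0) at_top"
    by (intro tendsto_mult tendsto_const tendsto_inverse_0_at_top filterlim_ident)
  then have z: "((\<lambda>U. \<bar>V k\<bar> * cmod c * inverse U) \<longlongrightarrow> 0) at_top" by simp
  have ev: "\<forall>\<^sub>F U in at_top. norm (nm (\<lambda>p. complex_of_real (V k) * Xm U k p - 0)) \<le> \<bar>V k\<bar> * cmod c * inverse U"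
    using eventually_gt_at_top[of 0] by eventually_elim (use bd in simp)
  show ?thesis by (rule Lim_null_comparison[OF ev z])
qed

lemma Xm_limit:
  "\<exists>f. inL2 f \<and> ((\<lambda>U. nm (\<lambda>p. complex_of_real (V k) * Xm U k p - f p)) \<longlongrightarrow> 0) at_top"
proof (cases "V k = 0")
  case True
  then show ?thesis by (intro exI[of _ "\<lambda>p. 0"]) simp
next
  case V: False
  show ?thesis
  proof (cases "eps = 0")
    case False
    then have "b k < m k" using good eps b_less_m[of k] by (auto simp: good_def)
    then show ?thesis using E_le_b[OF _ good] by (intro limit_of_gap[OF V, of "m k - b k"]) auto
  next
    case eps0: True
    show ?thesis
    proof (cases "n2 (\<lambda>p. D k p - ip e0 (D k) * e0 p) = 0")
      case True
      from limit_of_D_e0[OF eps0 V this] show ?thesis by (intro exI[of _ "\<lambda>p. 0"]) simp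
    next
      case False
      from gap_of_D_not_e0[OF eps0 V this] show ?thesis using limit_of_gap[OF V] by blast
    qed
  qed
qed

end

end

section \<open>Dynamics\<close>

lemma hq_hscal: "hq (hscal c a) = (cmod c)\<^sup>2 * hq a"
  by (simp add: hq_def hscal_def n2_scale norm_mult power_mult_distrib distrib_left)

lemma n2_minus_le: assumes "inL2 a" "inL2 c" shows "n2 (\<lambda>p. a p - c p) \<le> 2 * n2 a + 2 * n2 c"
proof -
  have "n2 (\<lambda>p. a p - c p) \<le> (nm a + nm c)\<^sup>2"
    unfolding nm_square[symmetric] by (intro power_mono nm_triangle_minus assms) simp
  also have "\<dots> \<le> 2 * (nm a)\<^sup>2 + 2 * (nm c)\<^sup>2"
    using sum_squares_bound[of "nm a" "nm c"] by (simp add: power2_sum)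
  finally show ?thesis by simp
qed

lemma cmod_minus_square_le: "(cmod (x - y))\<^sup>2 \<le> 2 * (cmod x)\<^sup>2 + 2 * (cmod y)\<^sup>2"
proof -
  have "(cmod (x - y))\<^sup>2 \<le> (cmod x + cmod y)\<^sup>2"
    by (intro power_mono norm_triangle_ineq4) simp
  also have "\<dots> \<le> 2 * (cmod x)\<^sup>2 + 2 * (cmod y)\<^sup>2"
    using sum_squares_bound[of "cmod x" "cmod y"] by (simp add: power2_sum)
  finally show ?thesis .
qed

lemma hq_hminus_le: assumes "inH a" "inH c" shows "hq (hminus a c) \<le> 2 * hq a + 2 * hq c"
  using n2_minus_le[of "fst a" "fst c"] cmod_minus_square_le[of "snd a" "snd c"] assms
  by (simp add: hq_def hminus_def inH_def)

text \<open>Kept in the extended reals because it is applied to the chosen exponential, which is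
  known to be measurable but not yet square integrable.\<close>

lemma hn2_triangle:
  assumes a: "fst a \<in> borel_measurable nu" and c: "fst c \<in> borel_measurable nu" and d: "fst d \<in> borel_measurable nu"
  shows "hn2 (hminus a d) \<le> 2 * hn2 (hminus c a) + 2 * hn2 (hminus c d)"
proof -
  have e: "ennreal ((cmod (x - y))\<^sup>2) \<le> 2 * ennreal ((cmod (z - x))\<^sup>2) + 2 * ennreal ((cmod (z - y))\<^sup>2)" for x y z
  proof -
    have "(cmod (x - y))\<^sup>2 \<le> 2 * (cmod (z - x))\<^sup>2 + 2 * (cmod (z - y))\<^sup>2"
      using cmod_minus_square_le[of "z - y" "z - x"] by (simp add: norm_minus_commute)
    then have "ennreal ((cmod (x - y))\<^sup>2) \<le> ennreal (2 * (cmod (z - x))\<^sup>2 + 2 * (cmod (z - y))\<^sup>2)"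
      by (rule ennreal_leI)
    then show ?thesis by (simp add: ennreal_plus ennreal_mult)
  qed
  have "l2n2 (\<lambda>p. fst a p - fst d p) \<le> (\<integral>\<^sup>+p. 2 * ennreal ((cmod (fst c p - fst a p))\<^sup>2) + 2 * ennreal ((cmod (fst c p - fst d p))\<^sup>2) \<partial>nu)"
    unfolding l2n2_def by (rule nn_integral_mono) (rule e)
  also have "\<dots> = 2 * l2n2 (\<lambda>p. fst c p - fst a p) + 2 * l2n2 (\<lambda>p. fst c p - fst d p)"
    unfolding l2n2_def using a c d by (simp add: nn_integral_add nn_integral_cmult)
  finally have "l2n2 (\<lambda>p. fst a p - fst d p) + ennreal ((cmod (snd a - snd d))\<^sup>2)
    \<le> (2 * l2n2 (\<lambda>p. fst c p - fst a p) + 2 * l2n2 (\<lambda>p. fst c p - fst d p))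
      + (2 * ennreal ((cmod (snd c - snd a))\<^sup>2) + 2 * ennreal ((cmod (snd c - snd d))\<^sup>2))"
    by (rule add_mono[OF _ e])
  then show ?thesis by (simp add: hn2_def hminus_def distrib_left add_ac)
qed

lemma hq_hminus_tendsto:
  assumes ev: "\<forall>\<^sub>F n in F. inH (a n)" and a: "inH a'" and c: "inH c"
    and l1: "((\<lambda>n. nm (\<lambda>p. fst (a n) p - fst a' p)) \<longlongrightarrow> 0) F" and l2: "((\<lambda>n. snd (a n)) \<longlongrightarrow> snd a') F"
  shows "((\<lambda>n. hq (hminus c (a n))) \<longlongrightarrow> hq (hminus c a')) F"
proof -
  have "((\<lambda>n. nm (\<lambda>p. fst c p - fst (a n) p) - nm (\<lambda>p. fst c p - fst a' p)) \<longlongrightarrow> 0) F"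
  proof (rule Lim_null_comparison[OF _ l1])
    show "\<forall>\<^sub>F n in F. norm (nm (\<lambda>p. fst c p - fst (a n) p) - nm (\<lambda>p. fst c p - fst a' p)) \<le> nm (\<lambda>p. fst (a n) p - fst a' p)"
      using ev
    proof eventually_elim
      case (elim n)
      have "\<bar>nm (\<lambda>p. fst c p - fst (a n) p) - nm (\<lambda>p. fst c p - fst a' p)\<bar>
          \<le> nm (\<lambda>p. (fst c p - fst (a n) p) - (fst c p - fst a' p))"
        by (rule nm_diff_le) (use elim a c in \<open>auto simp: inH_def intro: inL2_minus\<close>)
      also have "\<dots> = nm (\<lambda>p. fst a' p - fst (a n) p)" by simp
      also have "\<dots> = nm (\<lambda>p. fst (a n) p - fst a' p)" by (rule nm_commute_minus)
      finally show ?case by simp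
    qed
  qed
  then have "((\<lambda>n. nm (\<lambda>p. fst c p - fst (a n) p)) \<longlongrightarrow> nm (\<lambda>p. fst c p - fst a' p)) F"
    by (rule LIM_zero_cancel)
  then have "((\<lambda>n. (nm (\<lambda>p. fst c p - fst (a n) p))\<^sup>2 + (cmod (snd c - snd (a n)))\<^sup>2)
      \<longlongrightarrow> (nm (\<lambda>p. fst c p - fst a' p))\<^sup>2 + (cmod (snd c - snd a'))\<^sup>2) F"
    by (intro tendsto_add tendsto_power tendsto_norm tendsto_diff tendsto_const l2)
  then show ?thesis by (simp add: hq_def hminus_def)
qed

text \<open>Each term of the tail is dominated by the term of the real series at c, so the error is
  uniform over the disc of radius c.\<close>

lemma exp_partial_sum_error:
  fixes z :: complex
  assumes "cmod z \<le> c"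
  shows "cmod ((\<Sum>n<N. z ^ n / fact n) - exp z) \<le> exp c - (\<Sum>n<N. c ^ n / fact n)"
proof -
  have s: "(\<lambda>n. w ^ n / fact n) sums exp w" for w :: complex
    using exp_converges[of w] by (simp add: scaleR_conv_of_real field_simps)
  have r: "(\<lambda>n. w ^ n / fact n) sums exp w" for w :: real
    using exp_converges[of w] by (simp add: field_simps)
  have "exp z - (\<Sum>n<N. z ^ n / fact n) = (\<Sum>n. z ^ (n + N) / fact (n + N))"
    using suminf_minus_initial_segment[OF sums_summable[OF s[of z]], of N] sums_unique[OF s[of z]] by simp
  also have "cmod \<dots> \<le> (\<Sum>n. c ^ (n + N) / fact (n + N))"
  proof (rule norm_suminf_le)
    show "cmod (z ^ (n + N) / fact (n + N)) \<le> c ^ (n + N) / fact (n + N)" for n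
      using assms by (simp add: norm_divide norm_power divide_right_mono power_mono)
    show "summable (\<lambda>n. c ^ (n + N) / fact (n + N))"
      using summable_ignore_initial_segment[OF sums_summable[OF r[of c]], of N] .
  qed
  also have "\<dots> = exp c - (\<Sum>n<N. c ^ n / fact n)"
    using suminf_minus_initial_segment[OF sums_summable[OF r[of c]], of N] sums_unique[OF r[of c]] by simp
  finally show ?thesis by (simp add: norm_minus_commute)
qed

lemma exp_partial_sum_error_tendsto:
  "(\<lambda>N. exp c - (\<Sum>n<N. c ^ n / fact n)) \<longlonglongrightarrow> (0::real)"
proof -
  have "(\<lambda>n. c ^ n / fact n) sums exp c" using exp_converges[of c] by (simp add: field_simps)
  then have "(\<lambda>N. exp c - (\<Sum>n<N. c ^ n / fact n)) \<longlonglongrightarrow> exp c - exp c"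
    unfolding sums_def by (intro tendsto_diff tendsto_const)
  then show ?thesis by simp
qed

context model
begin

section \<open>Normalised eigenvectors and their limit\<close>

lemma AE_good: "AE k in nu. good k"
  using AE_nu_T2 AE_nu_nonzero by eventually_elim (simp add: good_def)

text \<open>\<open>Xm_limit\<close> supplies one vector with the limit property, so the choice in
  \<open>PsiInf\<close> has it too and is used through that property alone.\<close>

lemma PI_limit:
  assumes good: "good k"
  shows "inH (PI k)" "snd (PI k) = -1"
    "((\<lambda>U. nm (\<lambda>p. complex_of_real (V k) * Xm U k p - fst (PI k) p)) \<longlongrightarrow> 0) at_top"
proof -
  have hn: "hn2 (hminus (PS U k) \<psi>) = ennreal (hq (hminus (evec k (Xm U k)) \<psi>))" if "0 \<le> U" "inH \<psi>" for U \<psi>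
    using hn2_cong[OF aeq_hminus[OF Psi_aeq(2)[OF that(1) good] aeq_refl, of \<psi>]]
      hn2_eq[OF inH_hminus[OF inH_evec[OF inL2_Xm[OF that(1) good]] that(2)]] by simp
  have ev: "\<forall>\<^sub>F U::real in at_top. 0 \<le> U" by (rule eventually_ge_at_top)
  have equiv: "((\<lambda>U. hn2 (hminus (PS U k) \<psi>)) \<longlongrightarrow> 0) at_top
      \<longleftrightarrow> ((\<lambda>U. hq (hminus (evec k (Xm U k)) \<psi>)) \<longlongrightarrow> 0) at_top" if "inH \<psi>" for \<psi>
  proof -
    have "((\<lambda>U. hn2 (hminus (PS U k) \<psi>)) \<longlongrightarrow> 0) at_top
        \<longleftrightarrow> ((\<lambda>U. ennreal (hq (hminus (evec k (Xm U k)) \<psi>))) \<longlongrightarrow> ennreal 0) at_top"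
      unfolding ennreal_0
      by (rule tendsto_cong) (use ev in eventually_elim, rule hn[OF _ that])
    also have "\<dots> \<longleftrightarrow> ((\<lambda>U. hq (hminus (evec k (Xm U k)) \<psi>)) \<longlongrightarrow> 0) at_top"
      by (rule tendsto_ennreal_iff) auto
    finally show ?thesis .
  qed
  obtain f where f: "inL2 f" "((\<lambda>U. nm (\<lambda>p. complex_of_real (V k) * Xm U k p - f p)) \<longlongrightarrow> 0) at_top"
    using Xm_limit[OF good] by blast
  have "inH (f, -1) \<and> ((\<lambda>U. hn2 (hminus (PS U k) (f, -1))) \<longlongrightarrow> 0) at_top"
  proof
    show H: "inH (f, -1)" using f(1) by (simp add: inH_def)
    have "((\<lambda>U. (nm (\<lambda>p. complex_of_real (V k) * Xm U k p - f p))\<^sup>2) \<longlongrightarrow> 0\<^sup>2) at_top"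
      by (rule tendsto_power[OF f(2)])
    then show "((\<lambda>U. hn2 (hminus (PS U k) (f, -1))) \<longlongrightarrow> 0) at_top"
      unfolding equiv[OF H] by (simp add: hq_def hminus_def evec_def)
  qed
  then have PI: "inH (PI k) \<and> ((\<lambda>U. hn2 (hminus (PS U k) (PI k))) \<longlongrightarrow> 0) at_top"
    unfolding PsiInf_def by (rule someI)
  then show H: "inH (PI k)" by blast
  have l: "((\<lambda>U. hq (hminus (evec k (Xm U k)) (PI k))) \<longlongrightarrow> 0) at_top"
    using PI equiv[OF H] by blast
  \<comment> \<open>All approximants have last component -1, so this constant is a lower bound for
    square distances that tend to 0.\<close>
  have "(cmod (-1 - snd (PI k)))\<^sup>2 \<le> 0"
    by (rule tendsto_lowerbound[OF l]) (auto simp: hq_def hminus_def evec_def intro!: always_eventually)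
  then show "snd (PI k) = -1" by (simp add: eq_neg_iff_add_eq_0 add.commute)
  have l': "((\<lambda>U. sqrt (hq (hminus (evec k (Xm U k)) (PI k)))) \<longlongrightarrow> 0) at_top"
    using tendsto_real_sqrt[OF l] by simp
  show "((\<lambda>U. nm (\<lambda>p. complex_of_real (V k) * Xm U k p - fst (PI k) p)) \<longlongrightarrow> 0) at_top"
    by (rule Lim_null_comparison[OF _ l'])
       (auto simp: nm_def hq_def hminus_def evec_def intro!: always_eventually)
qed

definition nrm :: "real \<Rightarrow> pt \<Rightarrow> real" where "nrm U k = sqrt ((V k)\<^sup>2 * n2 (XM U k) + 1)"

definition cc :: "real \<Rightarrow> real \<Rightarrow> (pt \<Rightarrow> complex) \<Rightarrow> pt \<Rightarrow> complex" where
  "cc U t \<phi> k = (if good k then cis (t * Em U k) * \<phi> k / complex_of_real (nrm U k) else 0)"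

text \<open>A jointly measurable version of \<open>\<PP>\<^sub>U e\<^sup>i\<^sup>t\<^sup>E \<phi>\<close>.\<close>

definition G :: "real \<Rightarrow> real \<Rightarrow> (pt \<Rightarrow> complex) \<Rightarrow> pt \<Rightarrow> hv" where
  "G U t \<phi> k = hscal (cc U t \<phi> k) (evec k (XM U k))"

definition GI :: "real \<Rightarrow> (pt \<Rightarrow> complex) \<Rightarrow> pt \<Rightarrow> hv" where
  "GI t \<phi> k = Pmap PI (\<lambda>k. cis (t * EI k) * \<phi> k) k"

lemma nrm_pos: "0 < nrm U k"
  unfolding nrm_def by (simp add: add_nonneg_pos)

context
  fixes U :: real
  assumes U: "0 \<le> U"
begin

lemma XM_good: "good k \<Longrightarrow> XM U k = Xm U k"
  by (simp add: fun_eq_iff XM_def[OF U])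

lemma Em_good: "good k \<Longrightarrow> Em U k = E U k"
  by (simp add: Em_def[OF U])

lemma inH_G: "inH (G U t \<phi> k)"
  unfolding G_def by (intro inH_hscal inH_evec inL2_XM[OF U])

lemma hq_G: "good k \<Longrightarrow> hq (G U t \<phi> k) = (cmod (\<phi> k))\<^sup>2"
proof -
  assume "good k"
  have "hq (evec k (XM U k)) = (nrm U k)\<^sup>2" by (simp add: hq_evec nrm_def)
  then show ?thesis using \<open>good k\<close> nrm_pos[of U k]
    by (simp add: G_def hq_hscal cc_def norm_mult norm_divide power_divide power_mult_distrib)
qed

lemma cc_measurable: assumes \<phi>: "\<phi> \<in> borel_measurable nu" shows "cc U t \<phi> \<in> borel_measurable nu"
proof -
  have "(\<lambda>k. Re (ip (XM U k) (XM U k))) \<in> borel_measurable nu"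
    using jm_ip[OF jm_XM[OF U] jm_XM[OF U]] by measurable
  then have "nrm U \<in> borel_measurable nu"
    unfolding nrm_def[abs_def] ip_self using V_measurable by simp
  then have n: "(\<lambda>k. complex_of_real (nrm U k)) \<in> borel_measurable nu"
    by (rule borel_measurable_of_real[THEN measurable_compose_rev])
  have "(\<lambda>k. cis (t * Em U k) * \<phi> k / complex_of_real (nrm U k)) \<in> borel_measurable nu"
    using Em_measurable[OF U] \<phi> n by measurable
  then show ?thesis unfolding cc_def[abs_def]
    by (intro measurable_If) (use good_sets[OF U] in auto)
qed

lemma jm_hscal_evec:
  assumes "c \<in> borel_measurable nu"
  shows "jointly_measurable (\<lambda>k. fst (hscal (c k) (evec k (XM U k))))" "(\<lambda>k. snd (hscal (c k) (evec k (XM U k)))) \<in> borel_measurable nu"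
proof -
  have v: "(\<lambda>k. complex_of_real (V k)) \<in> borel_measurable nu"
    using V_measurable by (rule borel_measurable_of_real[THEN measurable_compose_rev])
  show "jointly_measurable (\<lambda>k. fst (hscal (c k) (evec k (XM U k))))"
    unfolding hscal_def evec_def fst_conv by (intro jm_scale assms v jm_XM[OF U])
  show "(\<lambda>k. snd (hscal (c k) (evec k (XM U k)))) \<in> borel_measurable nu"
    unfolding hscal_def evec_def snd_conv using assms by measurable
qed

lemma jm_G:
  assumes "\<phi> \<in> borel_measurable nu"
  shows "jointly_measurable (\<lambda>k. fst (G U t \<phi> k))" "(\<lambda>k. snd (G U t \<phi> k)) \<in> borel_measurable nu"
  unfolding G_def using jm_hscal_evec[OF cc_measurable[OF assms]] by auto

lemma hnorm_PS: assumes "good k" shows "hnorm (PS U k) = nrm U k"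
proof -
  have "hnorm (PS U k) = hnorm (evec k (Xm U k))"
    unfolding hnorm_def hn2_cong[OF Psi_aeq(2)[OF U assms]] ..
  also have "\<dots> = nrm U k"
    unfolding hnorm_eq[OF inH_evec[OF inL2_Xm[OF U assms]]] hq_evec nrm_def XM_good[OF assms] ..
  finally show ?thesis .
qed

lemma Pmap_aeq:
  assumes "good k"
  shows "inH (Pmap (PS U) (\<lambda>k. cis (t * E U k) * \<phi> k) k)"
    "aeq (Pmap (PS U) (\<lambda>k. cis (t * E U k) * \<phi> k) k) (G U t \<phi> k)"
proof -
  have "k \<noteq> 0" using assms by (simp add: good_def)
  then have e: "Pmap (PS U) (\<lambda>k. cis (t * E U k) * \<phi> k) k = hscal (cc U t \<phi> k) (PS U k)"
    using assms by (simp add: Pmap_def cc_def hnorm_PS Em_good)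
  show "inH (Pmap (PS U) (\<lambda>k. cis (t * E U k) * \<phi> k) k)"
    unfolding e by (rule inH_hscal[OF Psi_aeq(1)[OF U assms]])
  show "aeq (Pmap (PS U) (\<lambda>k. cis (t * E U k) * \<phi> k) k) (G U t \<phi> k)"
    unfolding e G_def XM_good[OF assms] by (rule aeq_hscal[OF Psi_aeq(2)[OF U assms]])
qed

end

lemma hnorm_PI: assumes "good k" shows "hnorm (PI k) = sqrt (n2 (fst (PI k)) + 1)"
  unfolding hnorm_eq[OF PI_limit(1)[OF assms]] hq_def PI_limit(2)[OF assms] by simp

lemma GI_eq: assumes "good k" shows "GI t \<phi> k = hscal (cis (t * EI k) * \<phi> k / complex_of_real (hnorm (PI k))) (PI k)"
  using assms by (simp add: GI_def Pmap_def good_def)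

lemma inH_GI: "good k \<Longrightarrow> inH (GI t \<phi> k)"
  unfolding GI_eq by (rule inH_hscal[OF PI_limit(1)])

lemma hq_GI: assumes "good k" shows "hq (GI t \<phi> k) = (cmod (\<phi> k))\<^sup>2"
proof -
  have "hq (PI k) = (hnorm (PI k))\<^sup>2" by (simp add: hnorm_eq[OF PI_limit(1)[OF assms]])
  moreover have "0 < hnorm (PI k)" unfolding hnorm_PI[OF assms] by (simp add: add_nonneg_pos)
  ultimately show ?thesis
    by (simp add: GI_eq[OF assms] hq_hscal norm_mult norm_divide power_divide power_mult_distrib)
qed

lemma G_limit:
  assumes good: "good k"
  shows "((\<lambda>U. nm (\<lambda>p. fst (G U t \<phi> k) p - fst (GI t \<phi> k) p)) \<longlongrightarrow> 0) at_top"
    and "((\<lambda>U. snd (G U t \<phi> k)) \<longlongrightarrow> snd (GI t \<phi> k)) at_top"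
proof -
  let ?f = "\<lambda>U p. complex_of_real (V k) * Xm U k p" and ?g = "fst (PI k)"
  let ?c = "\<lambda>U. cis (t * E U k) * \<phi> k / complex_of_real (sqrt (n2 (?f U) + 1))"
  let ?d = "cis (t * EI k) * \<phi> k / complex_of_real (sqrt (n2 ?g + 1))"
  have ev: "\<forall>\<^sub>F U::real in at_top. 0 \<le> U" by (rule eventually_ge_at_top)
  have g: "inL2 ?g" using PI_limit(1)[OF good] by (simp add: inH_def)
  have f: "inL2 (?f U)" if "0 \<le> U" for U by (rule inL2_scale[OF inL2_Xm[OF that good]])
  note fl = PI_limit(3)[OF good]
  have "((\<lambda>U. nm (?f U) - nm ?g) \<longlongrightarrow> 0) at_top"
  proof (rule Lim_null_comparison[OF _ fl])
    show "\<forall>\<^sub>F U in at_top. norm (nm (?f U) - nm ?g) \<le> nm (\<lambda>p. ?f U p - ?g p)"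
      using ev by eventually_elim (simp only: real_norm_def, rule nm_diff_le[OF f g])
  qed
  then have nl: "((\<lambda>U. nm (?f U)) \<longlongrightarrow> nm ?g) at_top" by (rule LIM_zero_cancel)
  have n2l: "((\<lambda>U. n2 (?f U)) \<longlongrightarrow> n2 ?g) at_top"
    using tendsto_power[OF nl, of 2] by (simp only: nm_square)
  have pos: "n2 ?g + 1 > 0" by (simp add: add_nonneg_pos)
  have cl: "(?c \<longlongrightarrow> ?d) at_top"
  proof (intro tendsto_divide tendsto_mult tendsto_const tendsto_of_real tendsto_real_sqrt tendsto_add n2l)
    have "continuous_on UNIV cis" by (intro continuous_intros)
    then have "isCont cis (t * EI k)" by (simp add: continuous_on_eq_continuous_at)
    then show "((\<lambda>U. cis (t * E U k)) \<longlongrightarrow> cis (t * EI k)) at_top"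
      by (rule isCont_tendsto_compose) (intro tendsto_mult tendsto_const E_limit(1)[OF good])
    show "complex_of_real (sqrt (n2 ?g + 1)) \<noteq> 0" using pos by simp
  qed
  have Ge: "G U t \<phi> k = hscal (?c U) (?f U, -1)" if U: "0 \<le> U" for U
  proof -
    have "cc U t \<phi> k = ?c U"
      using good by (simp add: cc_def Em_good[OF U] nrm_def XM_good[OF U good] n2_scale)
    then show ?thesis by (simp add: G_def evec_def XM_good[OF U good])
  qed
  have GIe: "GI t \<phi> k = hscal ?d (PI k)" unfolding GI_eq[OF good] hnorm_PI[OF good] ..
  have "((\<lambda>U. cmod (?c U) * nm (\<lambda>p. ?f U p - ?g p) + cmod (?c U - ?d) * nm ?g) \<longlongrightarrow> cmod ?d * 0 + cmod (?d - ?d) * nm ?g) at_top"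
    by (intro tendsto_add tendsto_mult tendsto_norm cl fl tendsto_diff tendsto_const)
  then have z: "((\<lambda>U. cmod (?c U) * nm (\<lambda>p. ?f U p - ?g p) + cmod (?c U - ?d) * nm ?g) \<longlongrightarrow> 0) at_top" by simp
  show "((\<lambda>U. nm (\<lambda>p. fst (G U t \<phi> k) p - fst (GI t \<phi> k) p)) \<longlongrightarrow> 0) at_top"
  proof (rule Lim_null_comparison[OF _ z])
    show "\<forall>\<^sub>F U in at_top. norm (nm (\<lambda>p. fst (G U t \<phi> k) p - fst (GI t \<phi> k) p))
        \<le> cmod (?c U) * nm (\<lambda>p. ?f U p - ?g p) + cmod (?c U - ?d) * nm ?g"
      using ev
    proof eventually_elim
      case (elim U)
      have eq: "(\<lambda>p. fst (G U t \<phi> k) p - fst (GI t \<phi> k) p) = (\<lambda>p. ?c U * (?f U p - ?g p) + (?c U - ?d) * ?g p)"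
        unfolding Ge[OF elim] GIe hscal_def fst_conv by (rule ext) (simp only: right_diff_distrib left_diff_distrib, simp)
      have "nm (\<lambda>p. fst (G U t \<phi> k) p - fst (GI t \<phi> k) p)
          \<le> nm (\<lambda>p. ?c U * (?f U p - ?g p)) + nm (\<lambda>p. (?c U - ?d) * ?g p)"
        unfolding eq by (rule nm_triangle[OF inL2_scale[OF inL2_minus[OF f[OF elim] g]] inL2_scale[OF g]])
      then show ?case by (simp only: nm_scale real_norm_def abs_of_nonneg[OF nm_nonneg])
    qed
  qed
  have "((\<lambda>U. - ?c U) \<longlongrightarrow> - ?d) at_top" by (rule tendsto_minus[OF cl])
  moreover have "\<forall>\<^sub>F U in at_top. - ?c U = snd (G U t \<phi> k)"
    using ev by eventually_elim (simp add: Ge hscal_def)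
  ultimately have "((\<lambda>U. snd (G U t \<phi> k)) \<longlongrightarrow> - ?d) at_top" by (rule Lim_transform_eventually)
  then show "((\<lambda>U. snd (G U t \<phi> k)) \<longlongrightarrow> snd (GI t \<phi> k)) at_top"
    unfolding GIe by (simp add: hscal_def PI_limit(2)[OF good])
qed

lemma hq_G_limit:
  assumes "good k" "inH c"
  shows "((\<lambda>U. hq (hminus c (G U t \<phi> k))) \<longlongrightarrow> hq (hminus c (GI t \<phi> k))) at_top"
proof (rule hq_hminus_tendsto)
  show "\<forall>\<^sub>F U in at_top. inH (G U t \<phi> k)"
    using eventually_ge_at_top[of 0] by eventually_elim (rule inH_G)
qed (use assms inH_GI G_limit in auto)

lemma L2Hdist2_G_limit:
  assumes \<phi>: "inL2 \<phi>"
  shows "((\<lambda>U. L2Hdist2 (G U t \<phi>) (GI t \<phi>)) \<longlongrightarrow> 0) at_top"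
proof -
  have \<phi>m: "\<phi> \<in> borel_measurable nu" using \<phi> by (rule inL2_measurable)
  let ?g = "\<lambda>U k. if good k then ennreal (hq (hminus (G U t \<phi> k) (GI t \<phi> k))) else 0"
  have eq: "L2Hdist2 (G U t \<phi>) (GI t \<phi>) = (\<integral>\<^sup>+k. ?g U k \<partial>nu)" if U: "0 \<le> U" for U
    unfolding L2Hdist2_def L2Hn2_def
  proof (rule nn_integral_cong_AE)
    show "AE k in nu. hn2 (hminus (G U t \<phi> k) (GI t \<phi> k)) = ?g U k"
      using AE_good by eventually_elim (simp add: hn2_eq inH_hminus inH_G[OF U] inH_GI)
  qed
  have gm: "?g U \<in> borel_measurable nu" if U: "0 \<le> U" for U
  proof (rule borel_measurable_LIMSEQ_order)
    let ?u = "\<lambda>n k. if good k then hn2 (hminus (G U t \<phi> k) (G (real n) t \<phi> k)) else 0"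
    show "?u n \<in> borel_measurable nu" for n
    proof (rule measurable_If)
      show "(\<lambda>k. hn2 (hminus (G U t \<phi> k) (G (real n) t \<phi> k))) \<in> borel_measurable nu"
        by (rule hn2_measurable; unfold hminus_def fst_conv snd_conv)
           (intro jm_minus borel_measurable_diff jm_G[OF _ \<phi>m] U of_nat_0_le_iff)+
    qed (use good_sets in auto)
    show "(\<lambda>n. ?u n k) \<longlonglongrightarrow> ?g U k" for k
    proof (cases "good k")
      case True
      have "(\<lambda>n. hq (hminus (G U t \<phi> k) (G (real n) t \<phi> k))) \<longlonglongrightarrow> hq (hminus (G U t \<phi> k) (GI t \<phi> k))"
        by (rule filterlim_compose[OF hq_G_limit[OF True inH_G[OF U]] filterlim_real_sequentially])
      then have "(\<lambda>n. ennreal (hq (hminus (G U t \<phi> k) (G (real n) t \<phi> k)))) \<longlonglongrightarrow> ennreal (hq (hminus (G U t \<phi> k) (GI t \<phi> k)))"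
        by (rule tendsto_ennrealI)
      then show ?thesis using True by (simp add: hn2_eq inH_hminus inH_G[OF U] inH_G)
    qed simp
  qed
  \<comment> \<open>Both fibre vectors have norm |\<phi> k| because the eigenvectors are normalised;
    this yields a majorant independent of U.\<close>
  have bound: "?g U k \<le> ennreal (4 * (cmod (\<phi> k))\<^sup>2)" if U: "0 \<le> U" for U k
  proof (cases "good k")
    case True
    have "hq (hminus (G U t \<phi> k) (GI t \<phi> k)) \<le> 2 * hq (G U t \<phi> k) + 2 * hq (GI t \<phi> k)"
      by (rule hq_hminus_le[OF inH_G[OF U] inH_GI[OF True]])
    then show ?thesis using True by (auto simp: hq_G[OF U] hq_GI intro!: ennreal_leI)
  qed simp
  have lim: "((\<lambda>U. ?g U k) \<longlongrightarrow> 0) at_top" for k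
  proof (cases "good k")
    case True
    have "((\<lambda>U. hq (hminus (GI t \<phi> k) (G U t \<phi> k))) \<longlongrightarrow> hq (hminus (GI t \<phi> k) (GI t \<phi> k))) at_top"
      by (rule hq_G_limit[OF True inH_GI[OF True]])
    also have "hq (hminus (GI t \<phi> k) (GI t \<phi> k)) = 0" by (simp add: hq_def hminus_def)
    also have "(\<lambda>U. hq (hminus (GI t \<phi> k) (G U t \<phi> k))) = (\<lambda>U. hq (hminus (G U t \<phi> k) (GI t \<phi> k)))"
      by (simp add: fun_eq_iff hq_def hminus_def n2_def norm_minus_commute)
    finally have "((\<lambda>U. hq (hminus (G U t \<phi> k) (GI t \<phi> k))) \<longlongrightarrow> 0) at_top" .
    from tendsto_ennrealI[OF this] show ?thesis using True by simp
  qed simp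
  have fin: "(\<integral>\<^sup>+k. ennreal (4 * (cmod (\<phi> k))\<^sup>2) \<partial>nu) < \<infinity>"
  proof -
    have "(\<integral>\<^sup>+k. ennreal (4 * (cmod (\<phi> k))\<^sup>2) \<partial>nu) = 4 * l2n2 \<phi>"
      unfolding l2n2_def using \<phi>m by (simp add: ennreal_mult nn_integral_cmult)
    also have "\<dots> < \<infinity>" using \<phi> by (simp add: l2n2_eq ennreal_mult_less_top)
    finally show ?thesis .
  qed
  \<comment> \<open>Replacing U by max 0 U makes measurability and the majorant available along
    every sequence tending to infinity.\<close>
  have "((\<lambda>U. \<integral>\<^sup>+k. ?g (max 0 U) k \<partial>nu) \<longlongrightarrow> 0) at_top"
  proof (rule tendsto_at_topI_sequentially)
    fix W :: "nat \<Rightarrow> real" assume W: "filterlim W at_top sequentially"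
    have W': "filterlim (\<lambda>n. max 0 (W n)) at_top sequentially"
      by (rule filterlim_at_top_mono[OF W]) simp
    have "(\<lambda>n. \<integral>\<^sup>+k. ?g (max 0 (W n)) k \<partial>nu) \<longlonglongrightarrow> (\<integral>\<^sup>+k. 0 \<partial>nu)"
    proof (rule nn_integral_dominated_convergence)
      show "(\<lambda>k. ennreal (4 * (cmod (\<phi> k))\<^sup>2)) \<in> borel_measurable nu" using \<phi>m by measurable
      show "AE k in nu. ?g (max 0 (W n)) k \<le> ennreal (4 * (cmod (\<phi> k))\<^sup>2)" for n
        by (rule AE_I2, rule bound) simp
      show "AE k in nu. (\<lambda>n. ?g (max 0 (W n)) k) \<longlonglongrightarrow> 0"
        by (rule AE_I2, rule filterlim_compose[OF lim W'])
    qed (use gm[OF max.cobounded1] fin in simp_all)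
    then show "(\<lambda>n. \<integral>\<^sup>+k. ?g (max 0 (W n)) k \<partial>nu) \<longlonglongrightarrow> 0" by simp
  qed
  moreover have "\<forall>\<^sub>F U in at_top. (\<integral>\<^sup>+k. ?g (max 0 U) k \<partial>nu) = L2Hdist2 (G U t \<phi>) (GI t \<phi>)"
    using eventually_ge_at_top[of 0] by eventually_elim (simp only: eq max.absorb2)
  ultimately show ?thesis by (rule Lim_transform_eventually)
qed

section \<open>The exponential series on the eigenvectors\<close>

lemma L2Hdist2_cong:
  assumes "AE k in nu. aeq (F k) (F' k)" "AE k in nu. aeq (H k) (H' k)"
  shows "L2Hdist2 F H = L2Hdist2 F' H'"
  unfolding L2Hdist2_def L2Hn2_def
  by (rule nn_integral_cong_AE) (use assms in \<open>eventually_elim\<close>, blast intro: hn2_cong aeq_hminus)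

context
  fixes U :: real
  assumes U: "0 \<le> U"
begin

lemma Pmap0: "Pmap (PS U) (\<lambda>k. cis (0 * E U k) * \<phi> k) = Pmap (PS U) \<phi>"
  by simp

text \<open>The iteration starts from \<open>PsiU\<close>, an eigenvector only almost everywhere;
  \<open>AA_cong\<close> carries this equality through each application of the fibre
  operator.\<close>

lemma AA_funpow:
  assumes good: "good k"
  shows "inH ((AA U k ^^ n) (Pmap (PS U) \<phi> k)) \<and>
    aeq ((AA U k ^^ n) (Pmap (PS U) \<phi> k)) (hscal ((complex_of_real (E U k)) ^ n) (G U 0 \<phi> k))"
proof (induction n)
  case 0
  then show ?case using Pmap_aeq[OF U good, of 0 \<phi>] unfolding Pmap0 by (simp add: hscal_def)
next
  case (Suc n)
  let ?x = "(AA U k ^^ n) (Pmap (PS U) \<phi> k)" and ?e = "complex_of_real (E U k)"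
  have ev: "inH (evec k (XM U k))" by (rule inH_evec[OF inL2_XM[OF U]])
  let ?c = "?e ^ n * cc U 0 \<phi> k"
  have "aeq ?x (hscal ?c (evec k (XM U k)))"
    using Suc by (simp add: G_def hscal_def mult.assoc)
  then have "aeq (AA U k ?x) (AA U k (hscal ?c (evec k (XM U k))))"
    using Suc ev by (intro AA_cong[OF U] inH_hscal) auto
  also have "AA U k (hscal ?c (evec k (XM U k))) = hscal ?c (AA U k (evec k (XM U k)))"
    by (rule AA_hscal[OF U ev])
  finally have "aeq (AA U k ?x) (hscal ?c (AA U k (evec k (XM U k))))" .
  from aeq_trans[OF this] have "aeq (AA U k ?x) (hscal ?c (hscal ?e (evec k (XM U k))))"
    using aeq_hscal[OF eig_AA_evec[OF U eig_Xm[OF U good]], of ?c] by (simp only: XM_good[OF U good])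
  also have "hscal ?c (hscal ?e (evec k (XM U k))) = hscal (?e ^ Suc n) (G U 0 \<phi> k)"
    by (simp add: G_def hscal_def mult_ac)
  finally have "aeq (AA U k ?x) (hscal (?e ^ Suc n) (G U 0 \<phi> k))" .
  moreover have "inH (AA U k ?x)" using Suc by (intro inH_AA[OF U]) blast
  ultimately show ?case by simp
qed

definition SN :: "real \<Rightarrow> nat \<Rightarrow> pt \<Rightarrow> complex" where
  "SN t N k = (\<Sum>n<N. (\<i> * complex_of_real (t * Em U k)) ^ n / fact n)"

lemma exp_partial_aeq:
  assumes good: "good k"
  shows "aeq (exp_partial (AA U) t N (Pmap (PS U) \<phi>) k) (hscal (SN t N k) (G U 0 \<phi> k))"
proof -
  let ?x = "\<lambda>n. (AA U k ^^ n) (Pmap (PS U) \<phi> k)" and ?e = "complex_of_real (E U k)"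
  have x: "AE p in nu. fst (?x n) p = ?e ^ n * fst (G U 0 \<phi> k) p" "snd (?x n) = ?e ^ n * snd (G U 0 \<phi> k)" for n
    using AA_funpow[OF good, of n \<phi>] by (auto simp: aeq_def hscal_def)
  have s: "(\<i> * complex_of_real t) ^ n / of_nat (fact n) * (?e ^ n * z) = (\<i> * complex_of_real (t * Em U k)) ^ n / fact n * z" for n z
    by (simp add: Em_good[OF U good] power_mult_distrib)
  \<comment> \<open>The null sets of all powers are merged into one, since the powers are countably
    many.\<close>
  have "AE p in nu. \<forall>n. fst (?x n) p = ?e ^ n * fst (G U 0 \<phi> k) p"
    unfolding AE_all_countable using x(1) by blast
  then have "AE p in nu. (\<Sum>n<N. (\<i> * complex_of_real t) ^ n / of_nat (fact n) * fst (?x n) p) = SN t N k * fst (G U 0 \<phi> k) p"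
    by eventually_elim (simp only: s SN_def sum_distrib_right)
  moreover have "(\<Sum>n<N. (\<i> * complex_of_real t) ^ n / of_nat (fact n) * snd (?x n)) = SN t N k * snd (G U 0 \<phi> k)"
    unfolding x(2) s SN_def sum_distrib_right ..
  ultimately show ?thesis unfolding aeq_def exp_partial_def hscal_def by simp
qed

lemma G_hscal: "good k \<Longrightarrow> G U t \<phi> k = hscal (cis (t * Em U k)) (G U 0 \<phi> k)"
  by (simp add: G_def cc_def hscal_def mult_ac)

lemma exp_partial_tendsto:
  assumes \<phi>: "inL2 \<phi>"
  shows "(\<lambda>N. L2Hdist2 (exp_partial (AA U) t N (Pmap (PS U) \<phi>)) (G U t \<phi>)) \<longlonglongrightarrow> 0"
proof -
  \<comment> \<open>A bound for |t E| over all good k, so that one scalar remainder controls every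
    fibre.\<close>
  define c where "c = \<bar>t\<bar> * (1 + VM\<^sup>2 * DM\<^sup>2 + 2 * eps)"
  define r where "r N = exp c - (\<Sum>n<N. c ^ n / fact n)" for N
  have le: "L2Hdist2 (exp_partial (AA U) t N (Pmap (PS U) \<phi>)) (G U t \<phi>) \<le> ennreal ((r N)\<^sup>2 * n2 \<phi>)" for N
  proof -
    have "L2Hdist2 (exp_partial (AA U) t N (Pmap (PS U) \<phi>)) (G U t \<phi>)
        \<le> (\<integral>\<^sup>+k. ennreal ((r N)\<^sup>2) * ennreal ((cmod (\<phi> k))\<^sup>2) \<partial>nu)"
      unfolding L2Hdist2_def L2Hn2_def
    proof (rule nn_integral_mono_AE)
      show "AE k in nu. hn2 (hminus (exp_partial (AA U) t N (Pmap (PS U) \<phi>) k) (G U t \<phi> k))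
          \<le> ennreal ((r N)\<^sup>2) * ennreal ((cmod (\<phi> k))\<^sup>2)"
        using AE_good
      proof eventually_elim
        case (elim k)
        let ?d = "SN t N k - cis (t * Em U k)"
        have "hn2 (hminus (exp_partial (AA U) t N (Pmap (PS U) \<phi>) k) (G U t \<phi> k))
            = hn2 (hminus (hscal (SN t N k) (G U 0 \<phi> k)) (G U t \<phi> k))"
          by (rule hn2_cong[OF aeq_hminus[OF exp_partial_aeq[OF elim] aeq_refl]])
        also have "hminus (hscal (SN t N k) (G U 0 \<phi> k)) (G U t \<phi> k) = hscal ?d (G U 0 \<phi> k)"
          unfolding G_hscal[OF elim, of t \<phi>] by (simp add: hminus_def hscal_def left_diff_distrib)
        also have "hn2 (hscal ?d (G U 0 \<phi> k)) = ennreal ((cmod ?d)\<^sup>2 * (cmod (\<phi> k))\<^sup>2)"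
          by (simp add: hn2_eq inH_hscal inH_G[OF U] hq_hscal hq_G[OF U elim])
        also have "\<dots> \<le> ennreal ((r N)\<^sup>2 * (cmod (\<phi> k))\<^sup>2)"
        proof (intro ennreal_leI mult_right_mono power_mono)
          let ?z = "\<i> * complex_of_real (t * Em U k)"
          have "cmod ?z = \<bar>t\<bar> * \<bar>E U k\<bar>" by (simp only: norm_mult norm_of_real norm_ii abs_mult Em_good[OF U elim] mult_1)
          also have "\<dots> \<le> c" unfolding c_def by (rule mult_left_mono[OF E_bound[OF U elim]]) simp
          finally show "cmod ?d \<le> r N"
            unfolding SN_def r_def cis_conv_exp by (rule exp_partial_sum_error)
        qed auto
        finally show ?case by (simp add: ennreal_mult)
      qed
    qed
    also have "\<dots> = ennreal ((r N)\<^sup>2) * l2n2 \<phi>"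
      unfolding l2n2_def using inL2_measurable[OF \<phi>] by (simp add: nn_integral_cmult)
    also have "\<dots> = ennreal ((r N)\<^sup>2 * n2 \<phi>)" by (simp add: l2n2_eq[OF \<phi>] ennreal_mult)
    finally show ?thesis .
  qed
  have "(\<lambda>N. (r N)\<^sup>2 * n2 \<phi>) \<longlonglongrightarrow> 0\<^sup>2 * n2 \<phi>"
    unfolding r_def by (intro tendsto_mult tendsto_power tendsto_const exp_partial_sum_error_tendsto)
  then have z: "(\<lambda>N. ennreal ((r N)\<^sup>2 * n2 \<phi>)) \<longlonglongrightarrow> 0" using tendsto_ennrealI by fastforce
  show ?thesis
    by (rule tendsto_sandwich[OF _ _ tendsto_const z]) (use le in auto)
qed

text \<open>G meets the specification in \<open>exp_it\<close>, so the chosen function exists and is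
  a limit of the same partial sums. The triangle inequality puts it at distance 0 from G, and
  measurability turns this into equality in almost every fibre.\<close>

lemma exp_it_aeq:
  assumes \<phi>: "inL2 \<phi>"
  shows "AE k in nu. aeq (exp_it (AA U) t (Pmap (PS U) \<phi>) k) (G U t \<phi> k)"
proof -
  have \<phi>m: "\<phi> \<in> borel_measurable nu" using \<phi> by (rule inL2_measurable)
  define F where "F = Pmap (PS U) \<phi>"
  define K where "K = exp_it (AA U) t F"
  let ?P = "\<lambda>G. (\<lambda>kp. fst (G (fst kp)) (snd kp)) \<in> borel_measurable (nu \<Otimes>\<^sub>M nu) \<and>
      (\<lambda>k. snd (G k)) \<in> borel_measurable nu \<and>
      (\<lambda>N. L2Hdist2 (exp_partial (AA U) t N F) G) \<longlonglongrightarrow> 0"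
  have "?P (G U t \<phi>)"
    by (intro conjI jm_G(1)[OF U \<phi>m, unfolded jointly_measurable_def] jm_G(2)[OF U \<phi>m] exp_partial_tendsto[OF \<phi>, folded F_def])
  then have PK: "?P K" unfolding K_def exp_it_def by (rule someI[of ?P])
  have K: "jointly_measurable (\<lambda>k. fst (K k))" "(\<lambda>k. snd (K k)) \<in> borel_measurable nu"
    "(\<lambda>N. L2Hdist2 (exp_partial (AA U) t N F) K) \<longlonglongrightarrow> 0"
    unfolding jointly_measurable_def by (rule PK[THEN conjunct1] PK[THEN conjunct2, THEN conjunct1] PK[THEN conjunct2, THEN conjunct2])+
  have Km: "fst (K k) \<in> borel_measurable nu" for k
  proof -
    have "(\<lambda>p. (k, p)) \<in> nu \<rightarrow>\<^sub>M nu \<Otimes>\<^sub>M nu" by simp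
    from measurable_compose[OF this K(1)[unfolded jointly_measurable_def]] show ?thesis by simp
  qed
  have Gm: "fst (G U t \<phi> k) \<in> borel_measurable nu" for t k
    using inH_G[OF U, of t \<phi> k] by (simp add: inH_def inL2_def)
  let ?I = "L2Hdist2 K (G U t \<phi>)"
  have dm: "(\<lambda>k. hn2 (hminus (a k) (c k))) \<in> borel_measurable nu"
    if "jointly_measurable (\<lambda>k. fst (a k))" "(\<lambda>k. snd (a k)) \<in> borel_measurable nu" "jointly_measurable (\<lambda>k. fst (c k))" "(\<lambda>k. snd (c k)) \<in> borel_measurable nu" for a c
    by (rule hn2_measurable; unfold hminus_def fst_conv snd_conv) (intro jm_minus borel_measurable_diff that)+
  have le: "?I \<le> 2 * L2Hdist2 (exp_partial (AA U) t N F) K + 2 * L2Hdist2 (exp_partial (AA U) t N F) (G U t \<phi>)" for N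
  proof -
    \<comment> \<open>The partial sums are built from the chosen \<open>PsiU\<close> and carry no
      joint measurability of their own; this measurable version allows the integral to be
      split.\<close>
    let ?Y = "\<lambda>k. hscal (SN t N k) (G U 0 \<phi> k)"
    have YN: "AE k in nu. aeq (exp_partial (AA U) t N F k) (?Y k)"
      using AE_good by eventually_elim (unfold F_def, rule exp_partial_aeq)
    have Ye: "?Y k = hscal (SN t N k * cc U 0 \<phi> k) (evec k (XM U k))" for k
      by (simp add: G_def hscal_def mult.assoc)
    have em: "(\<lambda>k. complex_of_real (t * Em U k)) \<in> borel_measurable nu"
      by (rule borel_measurable_of_real[THEN measurable_compose_rev]) (use Em_measurable[OF U] in measurable)
    have "SN t N \<in> borel_measurable nu" unfolding SN_def[abs_def] using em by measurable
    then have sm: "(\<lambda>k. SN t N k * cc U 0 \<phi> k) \<in> borel_measurable nu"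
      using cc_measurable[OF U \<phi>m, of 0] by measurable
    have Y: "jointly_measurable (\<lambda>k. fst (?Y k))" "(\<lambda>k. snd (?Y k)) \<in> borel_measurable nu"
      unfolding Ye using jm_hscal_evec[OF U sm] by auto
    have Ym: "fst (?Y k) \<in> borel_measurable nu" for k
      using inH_hscal[OF inH_G[OF U, of 0 \<phi> k], of "SN t N k"] by (simp add: inH_def inL2_def)
    have "?I \<le> (\<integral>\<^sup>+k. 2 * hn2 (hminus (?Y k) (K k)) + 2 * hn2 (hminus (?Y k) (G U t \<phi> k)) \<partial>nu)"
      unfolding L2Hdist2_def L2Hn2_def by (rule nn_integral_mono, rule hn2_triangle[OF Km Ym Gm])
    also have "\<dots> = 2 * L2Hdist2 ?Y K + 2 * L2Hdist2 ?Y (G U t \<phi>)"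
      unfolding L2Hdist2_def L2Hn2_def
      using dm[OF Y K(1,2)] dm[OF Y jm_G[OF U \<phi>m, of t]] by (simp add: nn_integral_add nn_integral_cmult)
    also have "L2Hdist2 ?Y K = L2Hdist2 (exp_partial (AA U) t N F) K"
      by (rule L2Hdist2_cong[symmetric]) (use YN in auto)
    also have "L2Hdist2 ?Y (G U t \<phi>) = L2Hdist2 (exp_partial (AA U) t N F) (G U t \<phi>)"
      by (rule L2Hdist2_cong[symmetric]) (use YN in auto)
    finally show ?thesis .
  qed
  have lim: "(\<lambda>N. 2 * L2Hdist2 (exp_partial (AA U) t N F) K + 2 * L2Hdist2 (exp_partial (AA U) t N F) (G U t \<phi>)) \<longlonglongrightarrow> 2 * 0 + 2 * 0"
    using K(3) exp_partial_tendsto[OF \<phi>, of t] unfolding F_def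
    by (intro tendsto_add ennreal_tendsto_cmult) simp_all
  have "?I \<le> 2 * 0 + 2 * 0" by (rule LIMSEQ_le_const[OF lim]) (use le in blast)
  then have "(\<integral>\<^sup>+k. hn2 (hminus (K k) (G U t \<phi> k)) \<partial>nu) = 0" by (simp add: L2Hdist2_def L2Hn2_def)
  then have "AE k in nu. hn2 (hminus (K k) (G U t \<phi> k)) = 0"
    using dm[OF K(1,2) jm_G[OF U \<phi>m, of t]] by (simp add: nn_integral_0_iff_AE)
  then have "AE k in nu. aeq (K k) (G U t \<phi> k)"
  proof eventually_elim
    case (elim k)
    then have 1: "l2n2 (\<lambda>p. fst (K k) p - fst (G U t \<phi> k) p) = 0" and 2: "snd (K k) = snd (G U t \<phi> k)"
      by (auto simp: hn2_def hminus_def)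
    have "inL2 (\<lambda>p. fst (K k) p - fst (G U t \<phi> k) p)" using Km[of k] Gm[of t k] 1 by (simp add: inL2_def)
    then have "inH (hminus (K k) (G U t \<phi> k))" by (simp add: inH_def hminus_def)
    then have "aeq (hminus (K k) (G U t \<phi> k)) hzero"
      using elim hq_eq_0 unfolding hn2_eq[OF \<open>inH (hminus (K k) (G U t \<phi> k))\<close>] by simp
    then show ?case by (simp add: aeq_def hminus_def hzero_def)
  qed
  then show ?thesis by (simp add: K_def F_def)
qed

lemma AE_Pmap_aeq: "AE k in nu. aeq (G U t \<phi> k) (Pmap (PS U) (\<lambda>k. cis (t * E U k) * \<phi> k) k)"
  using AE_good by eventually_elim (rule aeq_sym[OF Pmap_aeq(2)[OF U]])

lemma exp_it_Pmap:
  assumes "inL2 \<phi>"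
  shows "L2Hdist2 (exp_it (AA U) t (Pmap (PS U) \<phi>)) (Pmap (PS U) (\<lambda>k. cis (t * E U k) * \<phi> k)) = 0"
proof -
  have "L2Hdist2 (exp_it (AA U) t (Pmap (PS U) \<phi>)) (Pmap (PS U) (\<lambda>k. cis (t * E U k) * \<phi> k))
      = L2Hdist2 (G U t \<phi>) (G U t \<phi>)"
    by (rule L2Hdist2_cong[symmetric], use exp_it_aeq[OF assms, of t] in eventually_elim, rule aeq_sym)
       (assumption, rule AE_Pmap_aeq)
  also have "\<dots> = 0" by (simp add: L2Hdist2_def L2Hn2_def hn2_def hminus_def l2n2_def)
  finally show ?thesis .
qed

end

lemma Pmap_limit:
  assumes "inL2 \<phi>"
  shows "((\<lambda>U. L2Hdist2 (Pmap (PS U) (\<lambda>k. cis (t * E U k) * \<phi> k)) (Pmap PI (\<lambda>k. cis (t * EI k) * \<phi> k))) \<longlongrightarrow> 0) at_top"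
proof (rule Lim_transform_eventually[OF L2Hdist2_G_limit[OF assms]])
  show "\<forall>\<^sub>F U in at_top. L2Hdist2 (G U t \<phi>) (GI t \<phi>)
      = L2Hdist2 (Pmap (PS U) (\<lambda>k. cis (t * E U k) * \<phi> k)) (Pmap PI (\<lambda>k. cis (t * EI k) * \<phi> k))"
    using eventually_ge_at_top[of 0]
    by eventually_elim (rule L2Hdist2_cong, rule AE_Pmap_aeq, simp_all add: GI_def)
qed

lemma exp_it_limit:
  assumes "inL2 \<phi>"
  shows "((\<lambda>U. L2Hdist2 (exp_it (AA U) t (Pmap (PS U) \<phi>)) (Pmap PI (\<lambda>k. cis (t * EI k) * \<phi> k))) \<longlongrightarrow> 0) at_top"
proof (rule Lim_transform_eventually[OF L2Hdist2_G_limit[OF assms]])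
  have "L2Hdist2 (G U t \<phi>) (GI t \<phi>) = L2Hdist2 (exp_it (AA U) t (Pmap (PS U) \<phi>)) (Pmap PI (\<lambda>k. cis (t * EI k) * \<phi> k))"
    if U: "0 \<le> U" for U
  proof (rule L2Hdist2_cong)
    show "AE k in nu. aeq (G U t \<phi> k) (exp_it (AA U) t (Pmap (PS U) \<phi>) k)"
      using exp_it_aeq[OF U assms, of t] by eventually_elim (rule aeq_sym)
  qed (simp add: GI_def)
  then show "\<forall>\<^sub>F U in at_top. L2Hdist2 (G U t \<phi>) (GI t \<phi>)
      = L2Hdist2 (exp_it (AA U) t (Pmap (PS U) \<phi>)) (Pmap PI (\<lambda>k. cis (t * EI k) * \<phi> k))"
    using eventually_ge_at_top[of 0] by (rule eventually_mono[rotated])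
qed

end

theorem theorem3p14:
  fixes eps hb :: real and u ups p1 p2 :: "site \<Rightarrow> real"
  assumes eps: "eps \<ge> 0" and hb: "0 \<le> hb" "hb \<le> 1/2"
    and u_nonneg: "\<forall>x. u x \<ge> 0"
    and rot: "\<forall>x. u (rot90 x) = u x" "\<forall>x. ups (rot90 x) = ups x"
             "\<forall>x. p1 (rot90 x) = p1 x" "\<forall>x. p2 (rot90 x) = p2 x"
    and summ: "(\<lambda>x. \<bar>u x\<bar>) summable_on UNIV" "(\<lambda>x. \<bar>ups x\<bar>) summable_on UNIV"
    and expdec: "\<exists>\<alpha>0>0. (\<lambda>z. exp (\<alpha>0 * enorm_site z) * \<bar>p1 z\<bar>) summable_on UNIV
                      \<and> (\<lambda>z. exp (\<alpha>0 * enorm_site z) * \<bar>p2 z\<bar>) summable_on UNIV"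
    and p2_supp: "\<forall>z. \<not> (even (fst z) \<and> even (snd z)) \<longrightarrow> p2 z = 0"
    and p_nz: "(\<lambda>z. p1 z + p2 z) \<noteq> (\<lambda>z. 0)"
    and p_cond: "\<forall>k\<in>T2. \<exists>x. complex_of_real (p2 x)
                     \<noteq> - cis (dotp k x / 2) * complex_of_real (p1 x)"
  shows
    "(\<forall>U t \<phi>. U \<ge> 0 \<and> inL2 \<phi> \<longrightarrow>
        L2Hdist2
          (exp_it (Aop eps hb u ups p1 p2 U) t (Pmap (PsiU eps hb u ups p1 p2 U) \<phi>))
          (Pmap (PsiU eps hb u ups p1 p2 U)
             (\<lambda>k. cis (t * Eg eps hb u ups p1 p2 U k) * \<phi> k)) = 0)
     \<and> (\<forall>\<phi>. inL2 \<phi> \<longrightarrow>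
        ((\<lambda>U. L2Hdist2 (Pmap (PsiU eps hb u ups p1 p2 U) \<phi>)
                        (Pmap (PsiInf eps hb u ups p1 p2) \<phi>)) \<longlongrightarrow> 0) at_top)
     \<and> (\<forall>t \<phi>. inL2 \<phi> \<longrightarrow>
        ((\<lambda>U. L2Hdist2
               (exp_it (Aop eps hb u ups p1 p2 U) t (Pmap (PsiU eps hb u ups p1 p2 U) \<phi>))
               (Pmap (PsiInf eps hb u ups p1 p2)
                  (\<lambda>k. cis (t * Einf eps hb u ups p1 p2 k) * \<phi> k))) \<longlongrightarrow> 0) at_top)"
proof -
  \<comment> \<open>The exponential weight is at least 1.\<close>
  have p_sum: "(\<lambda>x. \<bar>p x\<bar>) summable_on UNIV"
    if "0 < \<alpha>" "(\<lambda>z. exp (\<alpha> * enorm_site z) * \<bar>p z\<bar>) summable_on UNIV" for \<alpha> and p :: "site \<Rightarrow> real"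
  proof (rule summable_on_comparison_test[OF that(2)])
    show "\<bar>p x\<bar> \<le> exp (\<alpha> * enorm_site x) * \<bar>p x\<bar>" for x
      using that(1) by (intro mult_le_cancel_right1[THEN iffD2]) (auto simp: enorm_site_def)
  qed simp
  interpret model eps hb u ups p1 p2
  proof
    show "u summable_on UNIV" using summ(1) u_nonneg by simp
    show "(\<lambda>x. \<bar>p1 x\<bar>) summable_on UNIV" "(\<lambda>x. \<bar>p2 x\<bar>) summable_on UNIV" using expdec p_sum by blast+
    show "\<exists>x. complex_of_real (p2 x) \<noteq> - cis (dotp k x / 2) * complex_of_real (p1 x)" if "k \<in> T2" for k
      using p_cond that by blast
  qed (use eps hb u_nonneg rot(2) summ(2) in auto)
  \<comment> \<open>At t = 0 all phases are 1, which turns the limit with phases into strong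
    convergence of the embeddings.\<close>
  have "((\<lambda>U. L2Hdist2 (Pmap (PS U) \<phi>) (Pmap PI \<phi>)) \<longlongrightarrow> 0) at_top" if "inL2 \<phi>" for \<phi>
    using Pmap_limit[OF that, of 0] by simp
  then show ?thesis using exp_it_Pmap exp_it_limit by blast
qed

end
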